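(* Let $N\ge 2$, let $\{p_t\}_{t\ge 1}$ and $\{q_k\}_{k=1}^N$ be positive parameters, and let $(Y(t))_{t\ge 0}=(Y_1(t)>\dots>Y_N(t))_{t\geq 0}$ be the locations of $N$ particles evolving according to the discrete-time Bernoulli TASEP (dTASEP) dynamics with these parameters and initial configuration $Y(0)=\bm{y}=(y_1>y_2>\dots>y_N)\in\mathbb{Z}^N$. Assume that $q_kp_t<1$ for all $k,t$ and $q_k>1$ for all $k$. Then, for every time $t$, any $m\in\mathbb{N}$, any $1\le k_1<k_2<\dots<k_m\le N$ and any $(s_1,\dots,s_m)\in\mathbb{R}^m$, $$\mathbb{P}\Big(\bigcap_{i=1}^m\{Y_{k_i}(t)\ge s_i\}\;\Big|\;Y(0)=\bm{y}\Big)=\det(I-\chi_sK\chi_s)_{\ell^2(\{k_1,\dots,k_m\}\times\mathbb{Z})},$$ where $\chi_s(k_i,x):=\mathbf{1}_{x<s_i}$ and $K$ is the kernel $$K(l,x;n,x')=-Q_{(l,n]}(x,x')\,\mathbf{1}_{n>l}+\big(\mathcal{S}_{[1,l],(0,t]}\circ\bar{\mathcal{S}}^{\mathrm{epi}(\bm{y})}_{[1,n],(0,t]}\big)(x,x').$$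
   Context: dTASEP: let $W_{t,k}$ ($t\ge1$, $1\le k\le N$) be independent Bernoulli variables with $\mathbb{P}(W_{t,k}=1)=p_tq_k/(1+p_tq_k)$ and $\mathbb{P}(W_{t,k}=0)=1/(1+p_tq_k)$. At each time $t\ge1$ positions are updated sequentially for $k=1,\dots,N$ by $Y_k(t)=\min\{Y_{k-1}(t)-1,\;Y_k(t-1)+W_{t,k}\}$, with the convention $Y_0(t)=\infty$. Kernels on $\mathbb{Z}\times\mathbb{Z}$ are composed by $(A\circ B)(x,z)=\sum_{y\in\mathbb{Z}}A(x,y)B(y,z)$. $Q_i(x,y):=q_i^{y-x}\mathbf{1}_{\{y<x\}}$ and $Q_{(l,n]}:=Q_{l+1}\circ\cdots\circ Q_n$ for $n>l$. For $1\le j\le k$ and $0\le r\le t$: $$\mathcal{S}_{[j,k],(r,t]}(x,y):=\oint_{\Gamma_0}\frac{dz}{2\pi\mathrm{i}z}\,\frac{\prod_{\ell=j}^k(q_\ell-z)\prod_{\ell=r+1}^t(1+p_\ell z)}{z^{x-y+k-j+1}},$$ $$\bar{\mathcal{S}}_{[j,k],(r,t]}(x,y):=-\prod_{\ell=j}^k(q_\ell-1)\oint_{\Gamma_{\bm q}}\frac{dz}{2\pi\mathrm{i}z}\,\frac{z^{y-x+k-j+1}}{\prod_{\ell=j}^k(q_\ell-z)\prod_{\ell=r+1}^t(1+p_\ell z)},$$ where $\Gamma_0$ and $\Gamma_{\bm q}$ are counterclockwise simple closed contours enclosing, as the only poles, $0$ and $\{q_i\}_{i=1}^N$, respectively (so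 $\Gamma_{\bm q}$ encloses neither $0$ nor any $-p_\ell^{-1}$). For fixed $n\le N$, $S=(S_0,\dots,S_n)$ is the inhomogeneous geometric random walk with $\mathbb{P}(S_\ell=y\mid S_{\ell-1}=x)=(q_\ell-1)q_\ell^{\,y-x}\mathbf{1}_{y<x}$ for $1\le\ell\le n$, and $\tau:=\min\{m\in\{0,\dots,n\}: S_m>y_{m+1}\}$, with the convention $y_{n+1}:=-\infty$ (so the event $\tau<n$ means that $S_m>y_{m+1}$ for some $m\in\{0,\dots,n-1\}$). Then $$\bar{\mathcal{S}}^{\mathrm{epi}(\bm{y})}_{[1,n],(r,t]}(x,y):=\frac{\mathbb{E}_{S_0=x}\big[\bar{\mathcal{S}}_{[\tau+1,n],(r,t]}(S_\tau,y)\,\mathbf{1}_{\tau<n}\big]}{\prod_{\ell=1}^n(q_\ell-1)}.$$ The Fredholm determinant is given by its series: for a kernel $A$ on a countable set $X$, $\det(I-A)_{\ell^2(X)}=\sum_{d\ge0}\frac{(-1)^d}{d!}\sum_{u_1,\dots,u_d\in X}\det(A(u_a,u_b))_{a,b=1}^d$. *)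

theory Defs
  imports "HOL-Complex_Analysis.Complex_Analysis" "HOL-Probability.Probability"
    "Jordan_Normal_Form.Determinant"
begin

section \<open>The particle system\<close>

text \<open>
  Times \<open>t\<close> and particle labels \<open>k\<close> are natural numbers; parameters, positions and noise are only
  constrained for \<open>t \<ge> 1\<close> (\<open>t \<ge> 0\<close> for positions) and \<open>1 \<le> k \<le> N\<close>. The convention
  \<open>Y\<^sub>0(t) = \<infinity>\<close> is the case distinction \<open>k = 1\<close>: the first particle is never blocked.
\<close>

definition dTASEP ::
  "'a measure \<Rightarrow> nat \<Rightarrow> (nat \<Rightarrow> real) \<Rightarrow> (nat \<Rightarrow> real) \<Rightarrow> (nat \<Rightarrow> int) \<Rightarrow>
   (nat \<Rightarrow> nat \<Rightarrow> 'a \<Rightarrow> int) \<Rightarrow> (nat \<Rightarrow> nat \<Rightarrow> 'a \<Rightarrow> int) \<Rightarrow> bool" where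
  "dTASEP M N p q y W Y \<longleftrightarrow>
     prob_space M \<and>
     prob_space.indep_vars M (\<lambda>_. count_space UNIV) (\<lambda>(t, k). W t k) ({1..} \<times> {1..N}) \<and>
     (\<forall>t\<ge>1. \<forall>k\<in>{1..N}.
        \<P>(\<omega> in M. W t k \<omega> = 1) = p t * q k / (1 + p t * q k) \<and>
        \<P>(\<omega> in M. W t k \<omega> = 0) = 1 / (1 + p t * q k)) \<and>
     (\<forall>\<omega>\<in>space M. \<forall>k\<in>{1..N}. Y 0 k \<omega> = y k) \<and>
     (\<forall>\<omega>\<in>space M. \<forall>t\<ge>1. \<forall>k\<in>{1..N}.
        Y t k \<omega> = (if k = 1 then Y (t - 1) k \<omega> + W t k \<omega>
                   else min (Y t (k - 1) \<omega> - 1) (Y (t - 1) k \<omega> + W t k \<omega>)))"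


section \<open>Contours\<close>

text \<open>
  A counterclockwise simple closed (piecewise \<open>C\<^sup>1\<close>) contour with all points of \<open>A\<close> strictly inside
  and all points of \<open>B\<close> strictly outside.
\<close>

definition ccw_contour :: "(real \<Rightarrow> complex) \<Rightarrow> complex set \<Rightarrow> complex set \<Rightarrow> bool" where
  "ccw_contour \<Gamma> A B \<longleftrightarrow>
     valid_path \<Gamma> \<and> simple_path \<Gamma> \<and> pathfinish \<Gamma> = pathstart \<Gamma> \<and>
     (\<forall>z\<in>inside (path_image \<Gamma>). winding_number \<Gamma> z = 1) \<and>
     A \<subseteq> inside (path_image \<Gamma>) \<and> B \<subseteq> outside (path_image \<Gamma>)"


section \<open>Kernels\<close>

type_synonym kernel = "int \<Rightarrow> int \<Rightarrow> complex"

definition kcomp :: "kernel \<Rightarrow> kernel \<Rightarrow> kernel"  (infixr \<open>\<circ>\<^sub>K\<close> 70) where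
  "(A \<circ>\<^sub>K B) x z = (\<Sum>\<^sub>\<infinity>y\<in>UNIV. A x y * B y z)"

definition kId :: kernel where
  "kId x y = of_bool (x = y)"

definition Q :: "(nat \<Rightarrow> real) \<Rightarrow> nat \<Rightarrow> kernel" where
  "Q q i x y = complex_of_real (q i) powi (y - x) * of_bool (y < x)"

text \<open>\<open>Q_range q l n\<close> is \<open>Q\<^sub>l\<^sub>+\<^sub>1 \<circ> \<dots> \<circ> Q\<^sub>n\<close>; it is only used for \<open>n > l\<close>.\<close>

definition Q_range :: "(nat \<Rightarrow> real) \<Rightarrow> nat \<Rightarrow> nat \<Rightarrow> kernel" where
  "Q_range q l n = foldr (\<lambda>i A. Q q i \<circ>\<^sub>K A) [Suc l..<Suc n] kId"

definition S_ker ::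
  "(real \<Rightarrow> complex) \<Rightarrow> (nat \<Rightarrow> real) \<Rightarrow> (nat \<Rightarrow> real) \<Rightarrow> nat \<Rightarrow> nat \<Rightarrow> nat \<Rightarrow> nat \<Rightarrow> kernel" where
  "S_ker \<Gamma> p q j k r t x y =
     contour_integral \<Gamma> (\<lambda>z. 1 / (2 * pi * \<i> * z) *
       ((\<Prod>l=j..k. of_real (q l) - z) * (\<Prod>l=Suc r..t. 1 + of_real (p l) * z)
         / z powi (x - y + int k - int j + 1)))"

definition Sbar_ker ::
  "(real \<Rightarrow> complex) \<Rightarrow> (nat \<Rightarrow> real) \<Rightarrow> (nat \<Rightarrow> real) \<Rightarrow> nat \<Rightarrow> nat \<Rightarrow> nat \<Rightarrow> nat \<Rightarrow> kernel" where
  "Sbar_ker \<Gamma> p q j k r t x y =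
     - (\<Prod>l=j..k. of_real (q l) - 1) *
     contour_integral \<Gamma> (\<lambda>z. 1 / (2 * pi * \<i> * z) *
       (z powi (y - x + int k - int j + 1)
         / ((\<Prod>l=j..k. of_real (q l) - z) * (\<Prod>l=Suc r..t. 1 + of_real (p l) * z))))"


section \<open>The random walk and the epigraph kernel\<close>

definition geom_step :: "real \<Rightarrow> int \<Rightarrow> int pmf" where
  "geom_step b x = embed_pmf (\<lambda>y. (b - 1) * b powi (y - x) * of_bool (y < x))"

text \<open>
  The embedded function is a probability mass function for \<open>b > 1\<close>.
\<close>

lemma pmf_geom_step:
  assumes "b > 1"
  shows "pmf (geom_step b x) y = (b - 1) * b powi (y - x) * of_bool (y < x)"
proof -
  define G where "G = map_pmf (\<lambda>g. x - 1 - int g) (geometric_pmf (1 - 1 / b))"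
  have b: "0 < 1 - 1 / b" "1 - 1 / b \<le> 1" using assms by auto
  have inj: "inj (\<lambda>g. x - 1 - int g)" by (auto intro: injI)
  have eq: "pmf G v = (b - 1) * b powi (v - x) * of_bool (v < x)" for v
  proof (cases "v < x")
    case True
    define g where "g = nat (x - 1 - v)"
    have v: "v = x - 1 - int g" using True by (simp add: g_def)
    have "pmf G v = pmf (geometric_pmf (1 - 1 / b)) g"
      unfolding G_def v by (rule pmf_map_inj'[OF inj])
    also have "\<dots> = (1 / b) ^ g * (1 - 1 / b)"
      using b by simp
    also have "\<dots> = (b - 1) * b powi (- int (Suc g))"
      using assms unfolding power_int_minus power_int_of_nat
      by (simp add: field_simps)
    finally show ?thesis using True by (simp add: v)
  next
    case False
    then have "v \<notin> set_pmf G" by (auto simp: G_def)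
    then show ?thesis using False by (simp add: set_pmf_iff)
  qed
  have "(\<lambda>v. (b - 1) * b powi (v - x) * of_bool (v < x)) = pmf G"
    using eq by auto
  then have "geom_step b x = G"
    unfolding geom_step_def by (simp add: type_definition.Rep_inverse[OF td_pmf_embed_pmf])
  then show ?thesis using eq by simp
qed

text \<open>
  Law of the path \<open>(S\<^sub>0, \<dots>, S\<^sub>n)\<close> with \<open>S\<^sub>0 = x\<close>, step \<open>\<ell>\<close> having parameter \<open>q\<^sub>\<ell>\<close>. Entries of index
  above \<open>n\<close> carry no meaning.
\<close>

primrec walk :: "(nat \<Rightarrow> real) \<Rightarrow> int \<Rightarrow> nat \<Rightarrow> (nat \<Rightarrow> int) pmf" where
  "walk q x 0 = return_pmf (\<lambda>_. x)"
| "walk q x (Suc n) =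
     bind_pmf (walk q x n) (\<lambda>S. map_pmf (\<lambda>v. S(Suc n := v)) (geom_step (q (Suc n)) (S n)))"

text \<open>
  The disjunct \<open>m = n\<close> is the convention \<open>y\<^sub>n\<^sub>+\<^sub>1 = -\<infinity>\<close>, which takes precedence over the actual
  \<open>(n+1)\<close>-st coordinate of \<open>y\<close> when \<open>n < N\<close>.
\<close>

definition hit :: "(nat \<Rightarrow> int) \<Rightarrow> nat \<Rightarrow> (nat \<Rightarrow> int) \<Rightarrow> nat" where
  "hit y n S = (LEAST m. m \<le> n \<and> (m = n \<or> S m > y (Suc m)))"

definition Sbar_epi ::
  "(real \<Rightarrow> complex) \<Rightarrow> (nat \<Rightarrow> real) \<Rightarrow> (nat \<Rightarrow> real) \<Rightarrow> (nat \<Rightarrow> int) \<Rightarrow>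
   nat \<Rightarrow> nat \<Rightarrow> nat \<Rightarrow> kernel" where
  "Sbar_epi \<Gamma> p q y n r t x x' =
     measure_pmf.expectation (walk q x n) (\<lambda>S. let \<tau> = hit y n S in
       Sbar_ker \<Gamma> p q (Suc \<tau>) n r t (S \<tau>) x' * of_bool (\<tau> < n))
     / (\<Prod>l=1..n. of_real (q l) - 1)"

definition K_ker ::
  "(real \<Rightarrow> complex) \<Rightarrow> (real \<Rightarrow> complex) \<Rightarrow> (nat \<Rightarrow> real) \<Rightarrow> (nat \<Rightarrow> real) \<Rightarrow> (nat \<Rightarrow> int) \<Rightarrow> nat \<Rightarrow>
   nat \<times> int \<Rightarrow> nat \<times> int \<Rightarrow> complex" where
  "K_ker \<Gamma>0 \<Gamma>q p q y t = (\<lambda>(l, x) (n, x').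
     - Q_range q l n x x' * of_bool (n > l)
     + (S_ker \<Gamma>0 p q 1 l 0 t \<circ>\<^sub>K Sbar_epi \<Gamma>q p q y n 0 t) x x')"

definition chi :: "nat \<Rightarrow> (nat \<Rightarrow> nat) \<Rightarrow> (nat \<Rightarrow> real) \<Rightarrow> nat \<times> int \<Rightarrow> complex" where
  "chi m \<kappa> s = (\<lambda>(k, x). of_bool (\<exists>i\<in>{1..m}. k = \<kappa> i \<and> real_of_int x < s i))"

definition cut_ker :: "('x \<Rightarrow> complex) \<Rightarrow> ('x \<Rightarrow> 'x \<Rightarrow> complex) \<Rightarrow> 'x \<Rightarrow> 'x \<Rightarrow> complex" where
  "cut_ker c A u v = c u * A u v * c v"


section \<open>Fredholm determinants on countable sets\<close>

text \<open>
  The inner sum runs over all \<open>d\<close>-tuples of points of \<open>X\<close>. Since \<open>infsum\<close> and \<open>suminf\<close> are total,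
  convergence of the series is a separate predicate.
\<close>

definition fredholm_minor :: "('x \<Rightarrow> 'x \<Rightarrow> complex) \<Rightarrow> nat \<Rightarrow> (nat \<Rightarrow> 'x) \<Rightarrow> complex" where
  "fredholm_minor A d u = Determinant.det (Matrix.mat d d (\<lambda>(a, b). A (u a) (u b)))"

definition fredholm_term :: "('x \<Rightarrow> 'x \<Rightarrow> complex) \<Rightarrow> 'x set \<Rightarrow> nat \<Rightarrow> complex" where
  "fredholm_term A X d =
     (-1) ^ d / fact d * (\<Sum>\<^sub>\<infinity>u\<in>({0..<d} \<rightarrow>\<^sub>E X). fredholm_minor A d u)"

text \<open>\<open>fredholm_det A X\<close> is \<open>det (I - A)\<close> on \<open>\<ell>\<^sup>2(X)\<close>.\<close>

definition fredholm_det :: "('x \<Rightarrow> 'x \<Rightarrow> complex) \<Rightarrow> 'x set \<Rightarrow> complex" where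
  "fredholm_det A X = (\<Sum>d. fredholm_term A X d)"

definition fredholm_converges :: "('x \<Rightarrow> 'x \<Rightarrow> complex) \<Rightarrow> 'x set \<Rightarrow> bool" where
  "fredholm_converges A X \<longleftrightarrow>
     (\<forall>d. fredholm_minor A d summable_on ({0..<d} \<rightarrow>\<^sub>E X)) \<and> summable (fredholm_term A X)"

end

theory Submission
  imports Defs
begin

text \<open>
  The Fredholm determinant is a martingale of the particle dynamics.

  One time step moves the particles one after the other, so it is a chain of \<open>N\<close> elementary moves.
  A configuration in which particles \<open>1..k\<close> have made the move of time \<open>r + 1\<close> and the others have not
  is again strictly decreasing, and it gets a kernel of its own, \<open>K_mid\<close>. For \<open>k = 0\<close> and \<open>k = N\<close> this is
  the kernel \<open>K_from\<close> of a system started at time \<open>r\<close> and at time \<open>r + 1\<close>.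

  If \<open>y\<^sub>k\<close> increases by one, \<open>K_mid\<close> changes by a kernel of rank one: only those walks feel the change that
  stand exactly at \<open>y\<^sub>k + 1\<close> at level \<open>k - 1\<close>. The kernel before the move of particle \<open>k\<close> lies on the
  line through the two kernels after the move, and its position on that line is given by the Bernoulli
  weights \<open>1 / (1 + p q)\<close> and \<open>p q / (1 + p q)\<close> (\<open>epi_mid_step\<close>). A determinant is affine along a line of rank one, so
  the determinants are averaged with the same weights (\<open>fredholm_det_rank_one_affine\<close>,
  \<open>fredholm_det_move\<close>). If particle \<open>k\<close> is blocked, no walk can stand at \<open>y\<^sub>k + 1 = y\<^sub>k\<^sub>-\<^sub>1\<close>
  without having hit before, so the kernel does not change at all (\<open>reach_blocked\<close>).
  Thus the determinant at time \<open>0\<close> is the expectation of the determinant of the final configuration.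

  At the final time the kernel is explicit. If no particle \<open>k\<^sub>i\<close> is to the left of \<open>s\<^sub>i\<close>, it is strictly upper
  triangular in the particle label and the determinant is \<open>1\<close>. Otherwise, for the last such particle
  \<open>k\<close>, the column of \<open>(k, y\<^sub>k)\<close> is a unit vector and the determinant is \<open>0\<close> (\<open>fredholm_det_final\<close>).

  The algebra behind the rank one identity uses two operators, \<open>Uop\<close> and \<open>Dop\<close>. They represent the factors \<open>1 + p z\<close>
  and \<open>(q - z) / z\<close> of the contour integrands as difference operators: \<open>S_ker\<close> is a product of such
  operators, and each of them removes one factor from \<open>Sbar_ker\<close>. The Bernoulli average then comes from the
  commutator of \<open>Uop\<close> with the indicator of \<open>{v. v > y\<^sub>k}\<close>, which is a point mass.

  The series converge because conjugation by \<open>\<mu>\<^sub>l\<^sup>x\<close>, with slightly decreasing \<open>\<mu>\<^sub>l > 1\<close>, dominates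
  the cut kernel by a summable function of the row, and because, apart from finitely many rows, it is
  strictly upper triangular in the label, so that all large minors vanish (\<open>tame_kernel\<close>).
\<close>


section \<open>Fredholm determinants of tame kernels\<close>

abbreviation "tuples d X \<equiv> {0..<d} \<rightarrow>\<^sub>E X"

lemma fredholm_minor_leibniz:
  "fredholm_minor A d u =
     (\<Sum>\<pi> | \<pi> permutes {0..<d}. signof \<pi> * (\<Prod>a = 0..<d. A (u a) (u (\<pi> a))))"
proof -
  have "(\<Prod>a = 0..<d. Matrix.mat d d (\<lambda>(a, b). A (u a) (u b)) $$ (a, \<pi> a)) =
      (\<Prod>a = 0..<d. A (u a) (u (\<pi> a)))" if "\<pi> permutes {0..<d}" for \<pi>
    using permutes_in_image[OF that] by (intro prod.cong) auto
  then show ?thesis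
    unfolding fredholm_minor_def by (subst det_def') (auto intro!: sum.cong)
qed

lemma fredholm_minor_not_inj:
  assumes "a < d" "b < d" "a \<noteq> b" "u a = u b"
  shows "fredholm_minor A d u = 0"
  unfolding fredholm_minor_def
  by (rule det_identical_rows[of _ d a b]) (use assms in \<open>auto simp: row_def\<close>)

text \<open>
  The weights \<open>g\<close>, \<open>h\<close> say that conjugation by \<open>g\<close>, which leaves every minor unchanged, makes \<open>A\<close> bounded
  by a summable function of its row. The labels say that outside the finitely many rows in \<open>R\<close> the kernel
  is strictly upper triangular.
\<close>

definition tame_kernel :: "('x \<Rightarrow> 'x \<Rightarrow> complex) \<Rightarrow> 'x set \<Rightarrow> bool" where
  "tame_kernel A X \<longleftrightarrow> countable X \<and>
     (\<exists>g h :: 'x \<Rightarrow> real. (\<forall>u\<in>X. 0 < g u \<and> 0 \<le> h u) \<and> h summable_on X \<and>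
        (\<forall>u\<in>X. \<forall>v\<in>X. norm (A u v) * g u \<le> h u * g v)) \<and>
     (\<exists>(lab :: 'x \<Rightarrow> nat) b R. finite R \<and> (\<forall>u\<in>X. lab u \<le> b) \<and>
        (\<forall>u\<in>X. \<forall>v\<in>X. A u v \<noteq> 0 \<longrightarrow> u \<in> R \<or> lab u < lab v))"

text \<open>
  The quotients \<open>g (u (\<pi> a)) / g (u a)\<close> cancel over the permutation \<open>\<pi>\<close>, so each Leibniz term is at most
  \<open>\<Prod>a. h (u a)\<close>.
\<close>

lemma fredholm_minor_bound:
  assumes g: "\<And>u. u \<in> X \<Longrightarrow> 0 < g u" and h: "\<And>u. u \<in> X \<Longrightarrow> 0 \<le> h u"
    and A: "\<And>u v. u \<in> X \<Longrightarrow> v \<in> X \<Longrightarrow> norm (A u v) * g u \<le> h u * g v"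
    and u: "u \<in> tuples d X"
  shows "norm (fredholm_minor A d u) \<le> fact d * (\<Prod>a = 0..<d. h (u a))"
proof -
  have uX: "u a \<in> X" if "a < d" for a using u that by auto
  have "norm (signof \<pi> * (\<Prod>a = 0..<d. A (u a) (u (\<pi> a)))) \<le> (\<Prod>a = 0..<d. h (u a))"
    if \<pi>: "\<pi> permutes {0..<d}" for \<pi>
  proof -
    have \<pi>d: "\<pi> a < d" if "a < d" for a using permutes_in_image[OF \<pi>, of a] that by auto
    have "(\<Prod>a = 0..<d. norm (A (u a) (u (\<pi> a)))) \<le> (\<Prod>a = 0..<d. h (u a) * (g (u (\<pi> a)) / g (u a)))"
    proof (intro prod_mono conjI)
      fix a assume "a \<in> {0..<d}"
      then show "norm (A (u a) (u (\<pi> a))) \<le> h (u a) * (g (u (\<pi> a)) / g (u a))"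
        using A[of "u a" "u (\<pi> a)"] g[of "u a"] uX \<pi>d by (simp add: pos_le_divide_eq)
    qed auto
    also have "\<dots> = (\<Prod>a = 0..<d. h (u a)) * ((\<Prod>a = 0..<d. g (u (\<pi> a))) / (\<Prod>a = 0..<d. g (u a)))"
      by (simp add: prod.distrib prod_dividef)
    also have "(\<Prod>a = 0..<d. g (u (\<pi> a))) = (\<Prod>a = 0..<d. g (u a))"
      using prod.permute[OF \<pi>, of "\<lambda>a. g (u a)"] by (simp add: o_def)
    also have "(\<Prod>a = 0..<d. g (u a)) / (\<Prod>a = 0..<d. g (u a)) = 1"
      using g uX by (intro divide_self) (fastforce simp: prod_zero_iff)
    finally show ?thesis by (simp only: norm_mult prod_norm) (simp add: sign_def)
  qed
  then have "norm (fredholm_minor A d u) \<le> (\<Sum>\<pi> | \<pi> permutes {0..<d}. (\<Prod>a = 0..<d. h (u a)))"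
    unfolding fredholm_minor_leibniz by (intro sum_norm_le) auto
  then show ?thesis by (simp add: card_permutations)
qed

text \<open>
  In a nonzero Leibniz term the label grows by at least one from \<open>u a\<close> to \<open>u (\<pi> a)\<close>, except at points
  of \<open>R\<close>, where it drops by at most \<open>b\<close>. These changes add up to zero over the permutation, and by
  injectivity of \<open>u\<close> at most \<open>card R\<close> of the points lie in \<open>R\<close>.
\<close>

lemma fredholm_minor_eq_0_of_large:
  fixes lab :: "'x \<Rightarrow> nat"
  assumes R: "finite R" and lab: "\<And>u. u \<in> X \<Longrightarrow> lab u \<le> b"
    and A: "\<And>u v. u \<in> X \<Longrightarrow> v \<in> X \<Longrightarrow> A u v \<noteq> 0 \<Longrightarrow> u \<in> R \<or> lab u < lab v"
    and u: "u \<in> tuples d X" and d: "d > (b + 1) * card R"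
  shows "fredholm_minor A d u = 0"
proof (rule ccontr)
  assume nz: "fredholm_minor A d u \<noteq> 0"
  have uX: "u a \<in> X" if "a < d" for a using u that by auto
  have inj: "inj_on u {0..<d}"
    unfolding inj_on_def using nz fredholm_minor_not_inj by (metis atLeastLessThan_iff)
  from nz obtain \<pi> where \<pi>: "\<pi> permutes {0..<d}"
    and nz': "(\<Prod>a = 0..<d. A (u a) (u (\<pi> a))) \<noteq> 0"
  proof -
    obtain \<pi> where "\<pi> \<in> {\<pi>. \<pi> permutes {0..<d}}" "signof \<pi> * (\<Prod>a = 0..<d. A (u a) (u (\<pi> a))) \<noteq> 0"
      by (rule sum.not_neutral_contains_not_neutral[OF nz[unfolded fredholm_minor_leibniz]])
    then show thesis using that[of \<pi>] by force
  qed
  have \<pi>d: "\<pi> a < d" if "a < d" for a using permutes_in_image[OF \<pi>, of a] that by auto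
  define G where "G = {a \<in> {0..<d}. u a \<in> R}"
  have "card G \<le> card R"
    using inj R by (intro card_inj_on_le[of u]) (auto simp: G_def inj_on_def)
  have step: "int (lab (u (\<pi> a))) - int (lab (u a)) \<ge> 1 - (int b + 1) * of_bool (a \<in> G)"
    if "a \<in> {0..<d}" for a
  proof -
    have "A (u a) (u (\<pi> a)) \<noteq> 0" using nz' that by auto
    then have "u a \<in> R \<or> lab (u a) < lab (u (\<pi> a))" using A uX \<pi>d that by auto
    moreover have "lab (u a) \<le> b" using lab uX that by auto
    ultimately show ?thesis using that by (auto simp: G_def)
  qed
  have "(\<Sum>a = 0..<d. int (lab (u (\<pi> a)))) = (\<Sum>a = 0..<d. int (lab (u a)))"
    using sum.permute[OF \<pi>, of "\<lambda>a. int (lab (u a))"] by (simp add: o_def)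
  then have "0 = (\<Sum>a = 0..<d. int (lab (u (\<pi> a))) - int (lab (u a)))"
    by (simp add: sum_subtractf)
  also have "\<dots> \<ge> (\<Sum>a = 0..<d. 1 - (int b + 1) * of_bool (a \<in> G))"
    using step by (intro sum_mono)
  also have "(\<Sum>a = 0..<d. 1 - (int b + 1) * of_bool (a \<in> G)) = int d - (int b + 1) * int (card G)"
  proof -
    have "(\<Sum>a = 0..<d. of_bool (a \<in> G)) = int (card G)"
      by (simp add: G_def of_bool_def sum.If_cases Int_def)
    then show ?thesis by (simp only: sum_subtractf sum_distrib_left[symmetric]) simp
  qed
  finally have "int d \<le> (int b + 1) * int (card G)" by simp
  also have "\<dots> \<le> (int b + 1) * int (card R)" using \<open>card G \<le> card R\<close> by (intro mult_left_mono) auto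
  finally have "d \<le> (b + 1) * card R" by (metis of_nat_1 of_nat_add of_nat_le_iff of_nat_mult)
  with d show False by simp
qed

lemma fredholm_minor_summable:
  assumes "tame_kernel A X"
  shows "fredholm_minor A d summable_on (tuples d X)"
proof -
  obtain g h :: "'a \<Rightarrow> real" where g: "\<And>u. u \<in> X \<Longrightarrow> 0 < g u" and h: "\<And>u. u \<in> X \<Longrightarrow> 0 \<le> h u"
    and hs: "h summable_on X"
    and A: "\<And>u v. u \<in> X \<Longrightarrow> v \<in> X \<Longrightarrow> norm (A u v) * g u \<le> h u * g v"
    using assms unfolding tame_kernel_def by blast
  have "(\<lambda>u. norm (h u)) summable_on X"
    using hs h by (simp cong: summable_on_cong)
  then have "Infinite_Set_Sum.abs_summable_on h X" by (simp add: abs_summable_equivalent[symmetric])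
  then have "Infinite_Set_Sum.abs_summable_on (\<lambda>u. \<Prod>a\<in>{0..<d}. h (u a)) (tuples d X)"
    using assms by (intro abs_summable_on_prod_PiE) (auto simp: tame_kernel_def)
  then have "(\<lambda>u. norm (\<Prod>a\<in>{0..<d}. h (u a))) summable_on (tuples d X)"
    by (simp add: abs_summable_equivalent[symmetric])
  then have "(\<lambda>u. \<Prod>a\<in>{0..<d}. h (u a)) summable_on (tuples d X)"
    by (rule abs_summable_summable)
  then have "(\<lambda>u. fact d * (\<Prod>a\<in>{0..<d}. h (u a))) summable_on (tuples d X)"
    by (rule summable_on_cmult_right)
  then have "(\<lambda>u. norm (fredholm_minor A d u)) summable_on (tuples d X)"
    by (rule Infinite_Sum.abs_summable_on_comparison_test')
       (rule fredholm_minor_bound[where g = g and h = h and X = X], use g h A in auto)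
  then show ?thesis by (rule abs_summable_summable)
qed

lemma fredholm_term_eventually_0:
  assumes "tame_kernel A X"
  obtains D where "\<And>d. d > D \<Longrightarrow> fredholm_term A X d = 0"
proof -
  obtain lab :: "'a \<Rightarrow> nat" and b R where "finite R" "\<And>u. u \<in> X \<Longrightarrow> lab u \<le> b"
    "\<And>u v. u \<in> X \<Longrightarrow> v \<in> X \<Longrightarrow> A u v \<noteq> 0 \<Longrightarrow> u \<in> R \<or> lab u < lab v"
    using assms unfolding tame_kernel_def by blast
  then have "fredholm_minor A d u = 0" if "d > (b + 1) * card R" "u \<in> tuples d X" for d u
    using that fredholm_minor_eq_0_of_large[of R X lab b A u d] by blast
  then have "fredholm_term A X d = 0" if "d > (b + 1) * card R" for d
    using that by (auto simp: fredholm_term_def intro!: infsum_0)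
  then show ?thesis using that by blast
qed

lemma tame_fredholm_converges:
  assumes "tame_kernel A X"
  shows "fredholm_converges A X"
proof -
  obtain D where "\<And>d. d > D \<Longrightarrow> fredholm_term A X d = 0"
    using fredholm_term_eventually_0[OF assms] by blast
  then have "summable (fredholm_term A X)"
    by (intro summable_finite[of "{..D}"]) (auto simp: not_le)
  then show ?thesis using fredholm_minor_summable[OF assms] by (simp add: fredholm_converges_def)
qed

lemma fredholm_term_0 [simp]: "fredholm_term A X 0 = 1"
  by (simp add: fredholm_term_def fredholm_minor_def)

text \<open>
  Without exceptional rows only the empty minor survives.
\<close>

lemma fredholm_det_upper:
  fixes lab :: "'x \<Rightarrow> nat"
  assumes lab: "\<And>u. u \<in> X \<Longrightarrow> lab u \<le> b"
    and A: "\<And>u v. u \<in> X \<Longrightarrow> v \<in> X \<Longrightarrow> A u v \<noteq> 0 \<Longrightarrow> lab u < lab v"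
  shows "fredholm_det A X = 1"
proof -
  have "fredholm_minor A d u = 0" if "d > 0" "u \<in> tuples d X" for d u
    by (rule fredholm_minor_eq_0_of_large[of "{}" X lab b]) (use that lab A in auto)
  then have "fredholm_term A X d = 0" if "d > 0" for d
    using that by (auto simp: fredholm_term_def intro!: infsum_0)
  then have "fredholm_term A X = (\<lambda>d. if d = 0 then 1 else 0)" by (auto simp: fun_eq_iff)
  then show ?thesis unfolding fredholm_det_def
    using suminf_finite[of "{0::nat}" "\<lambda>d. if d = 0 then 1 else 0 :: complex"] by simp
qed

text \<open>
  Bordering: the matrix with first row \<open>(1, w)\<close>, first column \<open>(1, - s x)\<close> and remaining block \<open>M\<close> has the
  same determinant as \<open>M + s x w\<^sup>T\<close>, and \<open>s\<close> occurs in its first column only, so Laplace expansion along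
  that column is affine in \<open>s\<close>.
\<close>

lemma det_rank_one_affine:
  fixes c :: "'a :: idom"
  assumes "\<And>i j. i < n \<Longrightarrow> j < n \<Longrightarrow> P i j = M i j + c * (x i * w j)"
    and "\<And>i j. i < n \<Longrightarrow> j < n \<Longrightarrow> R i j = M i j + x i * w j"
  shows "Determinant.det (Matrix.mat n n (\<lambda>(i, j). P i j)) =
     (1 - c) * Determinant.det (Matrix.mat n n (\<lambda>(i, j). M i j))
     + c * Determinant.det (Matrix.mat n n (\<lambda>(i, j). R i j))"
proof -
  \<comment> \<open>\<open>L s\<close> is the bordered matrix; multiplying by \<open>T\<close> clears its first row.\<close>
  define L where "L s = Matrix.mat (Suc n) (Suc n) (\<lambda>(i, j).
     if i = 0 then (if j = 0 then 1 else w (j - 1))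
     else if j = 0 then - s * x (i - 1) else M (i - 1) (j - 1))" for s
  define T where "T = Matrix.mat (Suc n) (Suc n) (\<lambda>(i, j).
     if i = 0 then (if j = 0 then 1 else - w (j - 1)) else of_bool (i = j))"
  define D where "D s = Determinant.det (Matrix.mat n n (\<lambda>(i, j). M i j + s * (x i * w j)))" for s
  have Lc: "L s \<in> carrier_mat (Suc n) (Suc n)" and Tc: "T \<in> carrier_mat (Suc n) (Suc n)" for s
    by (auto simp: L_def T_def)
  have "Determinant.det T = 1"
  proof -
    have "upper_triangular T" by (auto simp: T_def upper_triangular_def)
    then have "Determinant.det T = (\<Prod>i = 0..<Suc n. T $$ (i, i))"
      using det_upper_triangular[OF _ Tc] prod_list_diag_prod[of T] by (simp add: T_def)
    also have "\<dots> = 1" by (intro prod.neutral) (auto simp: T_def)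
    finally show ?thesis .
  qed
  moreover have "Determinant.det (L s * T) = D s" for s
  proof -
    have LT: "L s * T = Matrix.mat (Suc n) (Suc n) (\<lambda>(i, j).
       if i = 0 then of_bool (j = 0)
       else if j = 0 then - s * x (i - 1) else M (i - 1) (j - 1) + s * (x (i - 1) * w (j - 1)))" (is "_ = ?P")
    proof (rule eq_matI)
      fix i j assume "i < dim_row ?P" "j < dim_col ?P"
      then have ij: "i < Suc n" "j < Suc n" by auto
      have "(L s * T) $$ (i, j) = (\<Sum>k = 0..<Suc n. L s $$ (i, k) * T $$ (k, j))"
        using ij Lc[of s] Tc by (simp add: scalar_prod_def)
      also have "\<dots> = L s $$ (i, 0) * T $$ (0, j) + (\<Sum>k = 0..<n. L s $$ (i, Suc k) * T $$ (Suc k, j))"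
        by (simp only: sum.atLeast0_lessThan_Suc_shift o_def)
      also have "(\<Sum>k = 0..<n. L s $$ (i, Suc k) * T $$ (Suc k, j)) =
         (\<Sum>k = 0..<n. if j = Suc k then L s $$ (i, Suc k) else 0)"
        using ij by (intro sum.cong) (auto simp: T_def)
      also have "\<dots> = (if j = 0 then 0 else L s $$ (i, j))"
        using ij by (cases j) (auto simp: sum.delta)
      finally show "(L s * T) $$ (i, j) = ?P $$ (i, j)"
        using ij by (auto simp: L_def T_def)
    qed (auto simp: L_def T_def)
    have P: "?P \<in> carrier_mat (Suc n) (Suc n)" by auto
    have "Determinant.det ?P = (\<Sum>j<Suc n. ?P $$ (0, j) * cofactor ?P 0 j)"
      using laplace_expansion_row[OF P, of 0] by simp
    also have "\<dots> = (\<Sum>j<Suc n. if j = 0 then cofactor ?P 0 0 else 0)"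
      by (intro sum.cong) auto
    also have "\<dots> = cofactor ?P 0 0" by (simp add: sum.delta)
    also have "\<dots> = D s" unfolding cofactor_def D_def
      by (auto simp: mat_delete_def intro!: arg_cong[where f = Determinant.det] eq_matI)
    finally show ?thesis unfolding LT .
  qed
  ultimately have DL: "D s = Determinant.det (L s)" for s
    using det_mult[OF Lc[of s] Tc] by simp
  define K where "K i = cofactor (L 0) i 0" for i
  have cof: "cofactor (L s) i 0 = K i" for s i
    unfolding cofactor_def K_def
    by (auto simp: mat_delete_def L_def intro!: arg_cong[where f = Determinant.det] eq_matI)
  have aff: "D s = K 0 - s * (\<Sum>i<n. x i * K (Suc i))" for s
  proof -
    have "D s = (\<Sum>i<Suc n. L s $$ (i, 0) * cofactor (L s) i 0)"
      using laplace_expansion_column[OF Lc[of s], of 0] DL by simp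
    also have "\<dots> = L s $$ (0, 0) * K 0 + (\<Sum>i<n. L s $$ (Suc i, 0) * K (Suc i))"
      by (simp add: sum.lessThan_Suc_shift cof del: sum.lessThan_Suc)
    also have "\<dots> = K 0 - s * (\<Sum>i<n. x i * K (Suc i))"
      by (simp add: L_def sum_distrib_left sum_negf[symmetric] mult.assoc del: sum_negf)
    finally show ?thesis .
  qed
  have "D c = (1 - c) * D 0 + c * D 1" unfolding aff by (simp add: algebra_simps)
  moreover have "Determinant.det (Matrix.mat n n (\<lambda>(i, j). P i j)) = D c"
    "Determinant.det (Matrix.mat n n (\<lambda>(i, j). R i j)) = D 1"
    "Determinant.det (Matrix.mat n n (\<lambda>(i, j). M i j)) = D 0"
    unfolding D_def by (auto intro!: arg_cong[where f = Determinant.det] eq_matI simp: assms)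
  ultimately show ?thesis by simp
qed

lemma fredholm_det_rank_one_affine:
  assumes tame: "tame_kernel A X" "tame_kernel B X"
    and B: "\<And>u v. u \<in> X \<Longrightarrow> v \<in> X \<Longrightarrow> B u v = A u v + x u * w v"
    and C: "\<And>u v. u \<in> X \<Longrightarrow> v \<in> X \<Longrightarrow> C u v = A u v + c * (x u * w v)"
  shows "fredholm_det C X = (1 - c) * fredholm_det A X + c * fredholm_det B X"
proof -
  have "fredholm_minor C d u = (1 - c) * fredholm_minor A d u + c * fredholm_minor B d u"
    if "u \<in> tuples d X" for d u
    unfolding fredholm_minor_def
    by (rule det_rank_one_affine[where x = "\<lambda>i. x (u i)" and w = "\<lambda>i. w (u i)"])
       (use that in \<open>auto simp: B C PiE_iff\<close>)
  then have e1: "infsum (fredholm_minor C d) (tuples d X) =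
      (\<Sum>\<^sub>\<infinity>u\<in>tuples d X. (1 - c) * fredholm_minor A d u + c * fredholm_minor B d u)" for d
    by (intro infsum_cong) auto
  have e2: "(\<Sum>\<^sub>\<infinity>u\<in>tuples d X. (1 - c) * fredholm_minor A d u + c * fredholm_minor B d u) =
      (1 - c) * infsum (fredholm_minor A d) (tuples d X)
      + c * infsum (fredholm_minor B d) (tuples d X)" for d
    using infsum_add[OF summable_on_cmult_right[OF fredholm_minor_summable[OF tame(1)], of "1 - c"]
        summable_on_cmult_right[OF fredholm_minor_summable[OF tame(2)], of c], of d]
    by (simp only: infsum_cmult_right')
  have eq: "infsum (fredholm_minor C d) (tuples d X) =
      (1 - c) * infsum (fredholm_minor A d) (tuples d X)
      + c * infsum (fredholm_minor B d) (tuples d X)" for d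
    by (rule trans[OF e1 e2])
  have "fredholm_term C X d = (1 - c) * fredholm_term A X d + c * fredholm_term B X d" for d
    unfolding fredholm_term_def eq
    by (simp only: distrib_left mult.left_commute[of "(- 1) ^ d / fact d"])
  moreover have "summable (fredholm_term A X)" "summable (fredholm_term B X)"
    using tame tame_fredholm_converges by (auto simp: fredholm_converges_def)
  ultimately show ?thesis
    unfolding fredholm_det_def
    by (simp add: suminf_add[symmetric] suminf_mult summable_mult cong: suminf_cong)
qed

lemma fredholm_cong:
  assumes "\<And>u v. u \<in> X \<Longrightarrow> v \<in> X \<Longrightarrow> A u v = B u v"
  shows "fredholm_det A X = fredholm_det B X" "fredholm_converges A X = fredholm_converges B X"
proof -
  have minor: "fredholm_minor A d u = fredholm_minor B d u" if "u \<in> tuples d X" for d u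
    unfolding fredholm_minor_def using that assms
    by (intro arg_cong[where f = Determinant.det] eq_matI) (auto simp: PiE_iff)
  then have summ: "fredholm_minor A d summable_on (tuples d X) \<longleftrightarrow>
      fredholm_minor B d summable_on (tuples d X)" for d
    by (rule summable_on_cong)
  have "infsum (fredholm_minor A d) (tuples d X) = infsum (fredholm_minor B d) (tuples d X)" for d
    using minor by (rule infsum_cong)
  then have "fredholm_term A X = fredholm_term B X" by (simp add: fun_eq_iff fredholm_term_def)
  then show "fredholm_det A X = fredholm_det B X" "fredholm_converges A X = fredholm_converges B X"
    by (simp_all add: fredholm_det_def fredholm_converges_def summ)
qed

lemma tame_kernel_subset:
  assumes "tame_kernel A X" "X' \<subseteq> X"
  shows "tame_kernel A X'"
proof -
  obtain g h :: "'a \<Rightarrow> real" where gh: "\<forall>u\<in>X. 0 < g u \<and> 0 \<le> h u" "h summable_on X"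
      "\<forall>u\<in>X. \<forall>v\<in>X. norm (A u v) * g u \<le> h u * g v"
    using assms unfolding tame_kernel_def by blast
  obtain lab :: "'a \<Rightarrow> nat" and b R where lab: "finite R" "\<forall>u\<in>X. lab u \<le> b"
      "\<forall>u\<in>X. \<forall>v\<in>X. A u v \<noteq> 0 \<longrightarrow> u \<in> R \<or> lab u < lab v"
    using assms unfolding tame_kernel_def by blast
  have hs: "h summable_on X'" using gh(2) assms(2) by (rule summable_on_subset_banach)
  have c: "countable X'"
    by (rule countable_subset[OF assms(2)]) (use assms(1) in \<open>simp add: tame_kernel_def\<close>)
  show ?thesis unfolding tame_kernel_def
  proof (intro conjI c)
    show "\<exists>g h :: 'a \<Rightarrow> real. (\<forall>u\<in>X'. 0 < g u \<and> 0 \<le> h u) \<and> h summable_on X' \<and>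
        (\<forall>u\<in>X'. \<forall>v\<in>X'. norm (A u v) * g u \<le> h u * g v)"
      by (intro exI[of _ g] exI[of _ h] conjI hs ballI) (use gh assms(2) in \<open>blast+\<close>)
    show "\<exists>(lab :: 'a \<Rightarrow> nat) b R. finite R \<and> (\<forall>u\<in>X'. lab u \<le> b) \<and>
        (\<forall>u\<in>X'. \<forall>v\<in>X'. A u v \<noteq> 0 \<longrightarrow> u \<in> R \<or> lab u < lab v)"
      by (intro exI[of _ lab] exI[of _ b] exI[of _ R] conjI ballI lab) (use lab assms(2) in \<open>blast+\<close>)
  qed
qed

text \<open>
  Inserts \<open>c\<close> at place \<open>a\<close> into a tuple of length \<open>d\<close>; the value \<open>undefined\<close> makes the result an
  element of \<open>{0..<Suc d} \<rightarrow>\<^sub>E X\<close>.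
\<close>

definition put_at :: "nat \<Rightarrow> nat \<Rightarrow> 'x \<Rightarrow> (nat \<Rightarrow> 'x) \<Rightarrow> nat \<Rightarrow> 'x" where
  "put_at d a c v = (\<lambda>b. if b < a then v b else if b = a then c else if b < Suc d then v (b - 1) else undefined)"

text \<open>
  Laplace expansion along the column of \<open>c\<close>, which is a unit vector within the chosen points.
\<close>

lemma fredholm_minor_put_at:
  assumes a: "a \<le> d" and "\<And>b. b < d \<Longrightarrow> A (v b) c = 0" and cc: "A c c = 1"
  shows "fredholm_minor A (Suc d) (put_at d a c v) = fredholm_minor A d v"
proof -
  let ?u = "put_at d a c v"
  let ?M = "Matrix.mat (Suc d) (Suc d) (\<lambda>(i, j). A (?u i) (?u j))"
  have M: "?M \<in> carrier_mat (Suc d) (Suc d)" by auto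
  have col: "?M $$ (i, a) = (if i = a then 1 else 0)" if "i < Suc d" for i
    using that assms by (auto simp: put_at_def)
  have "fredholm_minor A (Suc d) ?u = (\<Sum>i<Suc d. ?M $$ (i, a) * cofactor ?M i a)"
    unfolding fredholm_minor_def using laplace_expansion_column[OF M, of a] a by simp
  also have "\<dots> = (\<Sum>i<Suc d. if i = a then cofactor ?M a a else 0)"
    by (rule sum.cong) (use col in auto)
  also have "\<dots> = cofactor ?M a a" using a by (simp add: sum.delta del: sum.lessThan_Suc)
  also have "\<dots> = fredholm_minor A d v"
  proof -
    have "mat_delete ?M a a = Matrix.mat d d (\<lambda>(i, j). A (v i) (v j))"
      by (rule eq_matI) (auto simp: mat_delete_def put_at_def)
    then show ?thesis by (simp add: cofactor_def fredholm_minor_def)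
  qed
  finally show ?thesis .
qed

text \<open>
  The column of \<open>c\<close> in \<open>I - A\<close> vanishes. For the series this means that it telescopes: tuples that
  contain \<open>c\<close> twice contribute nothing, and those that contain it once, at one of \<open>d + 1\<close> places,
  contribute the minor without \<open>c\<close>. Hence the term of order \<open>d + 1\<close> over \<open>X\<close> is the difference of the terms
  of orders \<open>d + 1\<close> and \<open>d\<close> over \<open>X - {c}\<close>.
\<close>

lemma fredholm_det_unit_column:
  assumes tame: "tame_kernel A X" and c: "c \<in> X"
    and col: "\<And>u. u \<in> X \<Longrightarrow> A u c = of_bool (u = c)"
  shows "fredholm_det A X = 0"
proof -
  define X' where "X' = X - {c}"
  have tame': "tame_kernel A X'" using tame_kernel_subset[OF tame] by (auto simp: X'_def)
  define I where "I d = infsum (fredholm_minor A d) (tuples d X')" for d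
  have I: "(fredholm_minor A d has_sum I d) (tuples d X')" for d
    unfolding I_def using fredholm_minor_summable[OF tame'] by (rule has_sum_infsum)
  have split: "infsum (fredholm_minor A (Suc d)) (tuples (Suc d) X) = I (Suc d) + of_nat (Suc d) * I d" for d
  proof -
    define P where "P = (tuples (Suc d) X)"
    define N where "N = (tuples (Suc d) X')"
    define E where "E a = {u \<in> P. u a = c \<and> (\<forall>b\<in>{0..<Suc d} - {a}. u b \<noteq> c)}" for a
    define f where "f = fredholm_minor A (Suc d)"
    have "(f has_sum I (Suc d)) N" unfolding f_def N_def by (rule I)
    then have N: "((\<lambda>u. if u \<in> N then f u else 0) has_sum I (Suc d)) P"
      by (rule has_sum_cong_neutral[THEN iffD1, rotated -1]) (auto simp: N_def P_def X'_def PiE_iff)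
    have Ea: "((\<lambda>u. if u \<in> E a then f u else 0) has_sum I d) P" if a: "a < Suc d" for a
    proof -
      have "(f has_sum I d) (E a) \<longleftrightarrow> (fredholm_minor A d has_sum I d) (tuples d X')"
      proof (rule has_sum_reindex_bij_witness[of _ "put_at d a c" "\<lambda>u. \<lambda>b\<in>{0..<d}. u (if b < a then b else Suc b)"])
        fix u assume u: "u \<in> E a"
        show "put_at d a c (\<lambda>b\<in>{0..<d}. u (if b < a then b else Suc b)) = u"
          using u a by (auto simp: put_at_def E_def P_def PiE_iff fun_eq_iff extensional_def)
        show *: "(\<lambda>b\<in>{0..<d}. u (if b < a then b else Suc b)) \<in> tuples d X'"
          using u a by (auto simp: E_def P_def PiE_iff X'_def)
        show "fredholm_minor A d (\<lambda>b\<in>{0..<d}. u (if b < a then b else Suc b)) = f u"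
        proof -
          have "fredholm_minor A d (\<lambda>b\<in>{0..<d}. u (if b < a then b else Suc b)) =
             f (put_at d a c (\<lambda>b\<in>{0..<d}. u (if b < a then b else Suc b)))"
            unfolding f_def using * a c col
            by (intro fredholm_minor_put_at[symmetric]) (auto simp: PiE_iff X'_def)
          also have "put_at d a c (\<lambda>b\<in>{0..<d}. u (if b < a then b else Suc b)) = u"
            using u a by (auto simp: put_at_def E_def P_def PiE_iff fun_eq_iff extensional_def)
          finally show ?thesis .
        qed
      next
        fix v assume v: "v \<in> tuples d X'"
        show "(\<lambda>b\<in>{0..<d}. put_at d a c v (if b < a then b else Suc b)) = v"
          using v a by (auto simp: put_at_def fun_eq_iff PiE_iff extensional_def)
        show "put_at d a c v \<in> E a"
          using v a c by (auto simp: put_at_def E_def P_def PiE_iff extensional_def X'_def)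
      qed auto
      then have "(f has_sum I d) (E a)" using I by blast
      then show ?thesis
        by (rule has_sum_cong_neutral[THEN iffD1, rotated -1]) (auto simp: E_def)
    qed
    have "((\<lambda>u. \<Sum>a<k. if u \<in> E a then f u else 0) has_sum (\<Sum>a<k. I d)) P" if "k \<le> Suc d" for k
      using that
    proof (induction k)
      case (Suc k)
      have "((\<lambda>u. \<Sum>a<k. if u \<in> E a then f u else 0) has_sum (\<Sum>a<k. I d)) P"
        by (rule Suc.IH[OF Suc_leD[OF Suc.prems]])
      from has_sum_add[OF this Ea[of k]] Suc.prems show ?case by (simp only: sum.lessThan_Suc)
    qed simp
    from this[of "Suc d"]
    have "((\<lambda>u. \<Sum>a<Suc d. if u \<in> E a then f u else 0) has_sum (\<Sum>a<Suc d. I d)) P" by simp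
    from has_sum_add[OF N this]
    have "((\<lambda>u. (if u \<in> N then f u else 0) + (\<Sum>a<Suc d. if u \<in> E a then f u else 0))
        has_sum (I (Suc d) + of_nat (Suc d) * I d)) P" by simp
    moreover have "(if u \<in> N then f u else 0) + (\<Sum>a<Suc d. if u \<in> E a then f u else 0) = f u"
      if u: "u \<in> P" for u
    proof (cases "\<exists>a<Suc d. u a = c")
      case False
      then have "u \<in> N" "\<And>a. a < Suc d \<Longrightarrow> u \<notin> E a"
        using u by (auto simp: N_def P_def X'_def PiE_iff E_def)
      then show ?thesis by simp
    next
      case True
      then obtain a where a: "a < Suc d" "u a = c" by blast
      then have nN: "u \<notin> N" by (auto simp: N_def X'_def PiE_iff)
      show ?thesis
      proof (cases "\<exists>b<Suc d. b \<noteq> a \<and> u b = c")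
        case True
        then have "f u = 0" unfolding f_def using a fredholm_minor_not_inj by metis
        then show ?thesis by (auto intro!: sum.neutral)
      next
        case False
        then have "u \<in> E b \<longleftrightarrow> b = a" if "b < Suc d" for b
          using a u that by (auto simp: E_def)
        then have "(\<Sum>b<Suc d. if u \<in> E b then f u else 0) = (\<Sum>b<Suc d. if b = a then f u else 0)"
          by (intro sum.cong) auto
        then show ?thesis using nN a by (simp add: sum.delta del: sum.lessThan_Suc)
      qed
    qed
    ultimately have "(f has_sum (I (Suc d) + of_nat (Suc d) * I d)) P"
      by (simp cong: has_sum_cong)
    then show ?thesis unfolding f_def P_def by (rule infsumI)
  qed
  have T: "fredholm_term A X (Suc d) = fredholm_term A X' (Suc d) - fredholm_term A X' d" for d
    unfolding fredholm_term_def split I_def[symmetric]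
    by (simp add: field_simps del: of_nat_Suc)
  have s: "summable (fredholm_term A X)" and s': "summable (fredholm_term A X')"
    using tame_fredholm_converges[OF tame] tame_fredholm_converges[OF tame']
    by (auto simp: fredholm_converges_def)
  have "fredholm_det A X = (\<Sum>d. fredholm_term A X (Suc d)) + 1"
    unfolding fredholm_det_def using suminf_split_head[OF s] by simp
  also have "(\<Sum>d. fredholm_term A X (Suc d)) = (\<Sum>d. fredholm_term A X' (Suc d)) - (\<Sum>d. fredholm_term A X' d)"
    unfolding T using s' by (intro suminf_diff[symmetric]) (auto simp: summable_Suc_iff)
  also have "(\<Sum>d. fredholm_term A X' (Suc d)) = (\<Sum>d. fredholm_term A X' d) - 1"
    using suminf_split_head[OF s'] by simp
  finally show ?thesis by simp
qed

section \<open>Difference operators and the hitting recursion\<close>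

text \<open>
  On \<open>f v = z powi (- v)\<close> the operators \<open>Uop p\<close> and \<open>Dop q\<close> act as multiplication by \<open>1 + p z\<close> and by
  \<open>(q - z) / z\<close>. On functions that vanish far to the left, \<open>Dop (q i)\<close> is the inverse of the kernel \<open>Q q i\<close>.
\<close>

definition Uop :: "complex \<Rightarrow> (int \<Rightarrow> complex) \<Rightarrow> int \<Rightarrow> complex" where
  "Uop p f x = f x + p * f (x - 1)"

definition Dop :: "complex \<Rightarrow> (int \<Rightarrow> complex) \<Rightarrow> int \<Rightarrow> complex" where
  "Dop q f x = q * f (x + 1) - f x"

definition Uall :: "(nat \<Rightarrow> complex) \<Rightarrow> nat \<Rightarrow> nat \<Rightarrow> (int \<Rightarrow> complex) \<Rightarrow> int \<Rightarrow> complex" where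
  "Uall p r t = fold (\<lambda>i. Uop (p i)) [Suc r..<Suc t]"

definition Dall :: "(nat \<Rightarrow> complex) \<Rightarrow> nat \<Rightarrow> (int \<Rightarrow> complex) \<Rightarrow> int \<Rightarrow> complex" where
  "Dall q l = fold (\<lambda>i. Dop (q i)) [1..<Suc l]"

lemma Dall_0 [simp]: "Dall q 0 f = f" by (simp add: Dall_def)

lemma Dall_Suc: "Dall q (Suc l) f = Dop (q (Suc l)) (Dall q l f)" by (simp add: Dall_def)

lemma Uall_refl [simp]: "Uall p t t f = f" by (simp add: Uall_def)

lemma Uall_step: "r < t \<Longrightarrow> Uall p r t f = Uall p (Suc r) t (Uop (p (Suc r)) f)"
  by (simp add: Uall_def upt_conv_Cons del: upt_Suc)

lemma Uop_linear: "Uop p (\<lambda>v. f v + s * g v) = (\<lambda>v. Uop p f v + s * Uop p g v)"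
  by (auto simp: Uop_def algebra_simps fun_eq_iff)

lemma Dop_linear: "Dop q (\<lambda>v. f v + s * g v) = (\<lambda>v. Dop q f v + s * Dop q g v)"
  by (auto simp: Dop_def algebra_simps fun_eq_iff)

lemma Uall_linear: "Uall p r t (\<lambda>v. f v + s * g v) = (\<lambda>v. Uall p r t f v + s * Uall p r t g v)"
proof -
  have "fold (\<lambda>i. Uop (p i)) xs (\<lambda>v. f v + s * g v) =
      (\<lambda>v. fold (\<lambda>i. Uop (p i)) xs f v + s * fold (\<lambda>i. Uop (p i)) xs g v)" for xs
    by (induction xs arbitrary: f g) (simp_all add: Uop_linear)
  then show ?thesis by (simp add: Uall_def)
qed

lemma Dall_linear: "Dall q l (\<lambda>v. f v + s * g v) = (\<lambda>v. Dall q l f v + s * Dall q l g v)"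
  by (induction l) (simp_all add: Dall_Suc Dop_linear)

lemma Uall_vanish:
  assumes "\<And>v. v \<le> c \<Longrightarrow> f v = 0" "v \<le> c"
  shows "Uall p r t f v = 0"
proof -
  have "fold (\<lambda>i. Uop (p i)) xs f v = 0" if "v \<le> c" "\<And>v. v \<le> c \<Longrightarrow> f v = 0" for xs v f
    using that by (induction xs arbitrary: f) (simp_all add: Uop_def)
  then show ?thesis using assms by (simp add: Uall_def)
qed

lemma Dall_vanish:
  assumes "\<And>v. v \<le> c \<Longrightarrow> f v = 0" "v \<le> c - int l"
  shows "Dall q l f v = 0"
  using assms(2) by (induction l arbitrary: v) (simp_all add: Dall_Suc Dop_def assms(1))

text \<open>
  The hitting expectation as a backward recursion in the level \<open>j\<close>: a walk at \<open>v\<close> that has not hit before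
  stops with payoff \<open>B (Suc j) v\<close> if \<open>v > y (Suc j)\<close>, and otherwise makes the geometric step with weights
  \<open>q powi (u - v)\<close>, without normalising factor; at level \<open>k\<close> it is stopped with payoff \<open>T\<close>.
  The cutoff \<open>c\<close> keeps the sum finite; it is taken below all \<open>y i\<close>, where the walk can no longer hit.
\<close>

function epi_fun :: "(nat \<Rightarrow> complex) \<Rightarrow> (nat \<Rightarrow> int) \<Rightarrow> int \<Rightarrow> (nat \<Rightarrow> int \<Rightarrow> complex) \<Rightarrow>
   nat \<Rightarrow> (int \<Rightarrow> complex) \<Rightarrow> nat \<Rightarrow> int \<Rightarrow> complex" where
  "epi_fun q y c B k T j v =
     (if k \<le> j then T v else if y (Suc j) < v then B (Suc j) v
      else (\<Sum>u\<in>{c<..<v}. q (Suc j) powi (u - v) * epi_fun q y c B k T (Suc j) u))"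
  by pat_completeness auto
termination by (relation "Wellfounded.measure (\<lambda>(q, y, c, B, k, T, j, v). k - j)") auto

declare epi_fun.simps [simp del]

lemma epi_fun_terminal: "k \<le> j \<Longrightarrow> epi_fun q y c B k T j = T"
  by (simp add: epi_fun.simps fun_eq_iff)

lemma level_induct [case_names terminal step]:
  assumes "\<And>j. k \<le> j \<Longrightarrow> P j" "\<And>j. j < k \<Longrightarrow> P (Suc j) \<Longrightarrow> P j"
  shows "P (j :: nat)"
proof (induction "k - j" arbitrary: j)
  case 0
  then show ?case using assms(1) by simp
next
  case (Suc m)
  then show ?case using assms(2)[of j] by simp
qed

lemma epi_fun_linear:
  "epi_fun q y c B k (\<lambda>v. T v + s * T' v) j v = epi_fun q y c B k T j v + s * epi_fun q y c (\<lambda>_ _. 0) k T' j v"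
proof (induction j arbitrary: v rule: level_induct[where k = k])
  case (terminal j)
  then show ?case by (simp add: epi_fun_terminal)
next
  case (step j)
  then show ?case
    by (subst (1 2 3) epi_fun.simps) (simp add: sum.distrib sum_distrib_left algebra_simps)
qed

text \<open>
  Absorbing the last level into the payoff. This exposes the only place at which \<open>y (Suc k)\<close> enters.
\<close>

lemma epi_fun_unroll_last:
  assumes "j \<le> k"
  shows "epi_fun q y c B (Suc k) T j v =
     epi_fun q y c B k (\<lambda>v. if y (Suc k) < v then B (Suc k) v
       else (\<Sum>u\<in>{c<..<v}. q (Suc k) powi (u - v) * T u)) j v"
  using assms
proof (induction j arbitrary: v rule: level_induct[where k = k])
  case (terminal j)
  then have "j = k" by simp
  then show ?case by (simp add: epi_fun_terminal epi_fun.simps[where j = k and k = "Suc k"])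
next
  case (step j)
  then show ?case
    by (subst (1 2) epi_fun.simps) (simp)
qed

lemma epi_fun_cong:
  assumes "\<And>i. j < i \<Longrightarrow> i \<le> k \<Longrightarrow> y i = y' i"
    and "\<And>i v. j < i \<Longrightarrow> i \<le> k \<Longrightarrow> B i v = B' i v"
  shows "epi_fun q y c B k T j v = epi_fun q y' c B' k T j v"
  using assms
proof (induction j arbitrary: v rule: level_induct[where k = k])
  case (terminal j)
  then show ?case by (simp add: epi_fun_terminal)
next
  case (step j)
  then show ?case
    by (subst (1 2) epi_fun.simps) simp
qed

lemma epi_fun_vanish:
  assumes "\<And>v. v \<le> c \<Longrightarrow> T v = 0" "\<And>i. j < i \<Longrightarrow> i \<le> k \<Longrightarrow> c \<le> y i" "v \<le> c"
  shows "epi_fun q y c B k T j v = 0"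
  using assms(2,3)
proof (induction j arbitrary: v rule: level_induct[where k = k])
  case (terminal j)
  then show ?case by (simp add: epi_fun_terminal assms)
next
  case (step j)
  then have "\<not> y (Suc j) < v" by (metis Suc_leI lessI order.trans linorder_not_less)
  then show ?case using step
    by (subst epi_fun.simps) (simp)
qed

text \<open>
  \<open>Q\<close> is a right inverse of \<open>Dop\<close>: only the summand \<open>u = x\<close> is new.
\<close>

lemma geometric_sum_step:
  fixes q :: complex
  assumes q: "q \<noteq> 0" and h: "\<And>v. v \<le> c \<Longrightarrow> h v = 0"
  shows "q * (\<Sum>u\<in>{c<..<x + 1}. q powi (u - (x + 1)) * h u) = (\<Sum>u\<in>{c<..<x}. q powi (u - x) * h u) + h x"
proof (cases "c < x")
  case True
  then have "{c<..<x + 1} = insert x {c<..<x}" by auto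
  then have "(\<Sum>u\<in>{c<..<x + 1}. q powi (u - x) * h u) = (\<Sum>u\<in>{c<..<x}. q powi (u - x) * h u) + h x"
    by simp
  moreover have "q * q powi (u - (x + 1)) = q powi (u - x)" for u
    using power_int_add_1'[of q "u - (x + 1)"] q by (simp add: algebra_simps)
  ultimately show ?thesis by (simp add: sum_distrib_left mult.assoc[symmetric])
next
  case False
  then show ?thesis using h by simp
qed

text \<open>
  \<open>Uop\<close> commutes with the translation invariant kernel \<open>Q\<close>.
\<close>

lemma geometric_sum_Uop:
  fixes q :: complex
  assumes h: "\<And>v. v \<le> c \<Longrightarrow> h v = 0"
  shows "(\<Sum>u\<in>{c<..<x}. q powi (u - x) * Uop p h u) =
    Uop p (\<lambda>x. \<Sum>u\<in>{c<..<x}. q powi (u - x) * h u) x"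
proof -
  have "(\<Sum>u\<in>{c<..<x}. q powi (u - x) * h (u - 1)) = (\<Sum>u\<in>{c - 1<..<x - 1}. q powi (u - (x - 1)) * h u)"
    by (rule sum.reindex_bij_witness[of _ "\<lambda>u. u + 1" "\<lambda>u. u - 1"]) (auto simp: algebra_simps)
  also have "\<dots> = (\<Sum>u\<in>{c<..<x - 1}. q powi (u - (x - 1)) * h u)"
    by (rule sum.mono_neutral_right) (auto simp: h)
  finally have "(\<Sum>u\<in>{c<..<x}. q powi (u - x) * h (u - 1)) = (\<Sum>u\<in>{c<..<x - 1}. q powi (u - (x - 1)) * h u)" .
  then show ?thesis by (simp add: Uop_def algebra_simps sum.distrib flip: sum_distrib_left)
qed

text \<open>
  The hitting function of a partially moved configuration: particles \<open>1..k\<close> have made their move, so walks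
  that hit them are paid with \<open>b1\<close>, the payoff without the factor \<open>1 + p z\<close>. A walk that passes level \<open>k\<close>
  meets particles that have not moved; \<open>Uop p\<close> takes it back by one time step, and from there on the
  payoff is \<open>b0\<close>. The minimum with \<open>n\<close> covers the labels \<open>n < k\<close>, for which all relevant particles have moved.
\<close>

definition epi_mid :: "(nat \<Rightarrow> complex) \<Rightarrow> (nat \<Rightarrow> int) \<Rightarrow> int \<Rightarrow> (nat \<Rightarrow> int \<Rightarrow> complex) \<Rightarrow> (nat \<Rightarrow> int \<Rightarrow> complex) \<Rightarrow>
   complex \<Rightarrow> nat \<Rightarrow> nat \<Rightarrow> int \<Rightarrow> complex" where
  "epi_mid q y c b0 b1 p n k =
     epi_fun q y c b1 (min k n) (Uop p (epi_fun q y c b0 n (\<lambda>_. 0) (min k n))) 0"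

text \<open>
  If \<open>y k\<close> increases by one, the only walks affected are those at position \<open>y k + 1\<close> at level \<open>k - 1\<close>: they
  used to stop and now continue. \<open>reach\<close> is the weight of getting there without hitting before,
  and \<open>jump\<close> is the payoff of stopping minus that of continuing.
\<close>

definition reach :: "(nat \<Rightarrow> complex) \<Rightarrow> (nat \<Rightarrow> int) \<Rightarrow> int \<Rightarrow> nat \<Rightarrow> int \<Rightarrow> complex" where
  "reach q y c k = epi_fun q y c (\<lambda>_ _. 0) (k - 1) (\<lambda>v. of_bool (v = y k + 1)) 0"

definition jump :: "(nat \<Rightarrow> complex) \<Rightarrow> (nat \<Rightarrow> int) \<Rightarrow> int \<Rightarrow> (nat \<Rightarrow> int \<Rightarrow> complex) \<Rightarrow> (nat \<Rightarrow> int \<Rightarrow> complex) \<Rightarrow>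
   complex \<Rightarrow> nat \<Rightarrow> nat \<Rightarrow> complex" where
  "jump q y c b0 b1 p n k = (if n < k then 0 else b1 k (y k + 1) -
     (\<Sum>u\<in>{c<..<y k + 1}. q k powi (u - (y k + 1)) * Uop p (epi_fun q y c b0 n (\<lambda>_. 0) k) u))"

text \<open>
  Both branches of the recursion are mapped by \<open>Dop\<close> to the function of the next level. For the stopping
  branch this holds from \<open>y k\<close> on, because such a position is above \<open>y (Suc k)\<close>, so that the walk stops
  at the next level as well; this is where strict decrease of \<open>y\<close> enters.
\<close>

lemma epi_fun_Dop:
  assumes qn: "\<And>i. i \<in> {1..n} \<Longrightarrow> q i \<noteq> 0"
    and c: "\<And>i. i \<in> {1..n} \<Longrightarrow> c \<le> y i"
    and y: "\<And>i j. 1 \<le> i \<Longrightarrow> i < j \<Longrightarrow> j \<le> n \<Longrightarrow> y j < y i"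
    and b: "\<And>j v. j \<in> {1..n} \<Longrightarrow> Dop (q j) (b j) v = (if j < n then b (Suc j) v else 0)"
    and k: "1 \<le> k" "k \<le> n"
  defines "H \<equiv> epi_fun q y c b n (\<lambda>_. 0)"
  defines "g \<equiv> \<lambda>x. \<Sum>u\<in>{c<..<x}. q k powi (u - x) * H k u"
  shows "H (k - 1) v = (if y k < v then b k v else g v)"
    and "Dop (q k) g v = H k v"
    and "y k \<le> v \<Longrightarrow> Dop (q k) (b k) v = H k v"
proof -
  show "H (k - 1) v = (if y k < v then b k v else g v)"
    using k unfolding H_def g_def by (subst epi_fun.simps) auto
  have "H k v = 0" if "v \<le> c" for v
    unfolding H_def using that c by (intro epi_fun_vanish) auto
  then show "Dop (q k) g v = H k v"
    unfolding Dop_def g_def using qn[of k] k by (subst geometric_sum_step) auto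
  show "Dop (q k) (b k) v = H k v" if "y k \<le> v"
  proof (cases "k = n")
    case True
    then show ?thesis using b[of k] k by (simp add: H_def epi_fun_terminal)
  next
    case False
    then have "y (Suc k) < v" using y[of k "Suc k"] k that by simp
    then show ?thesis using False k b[of k] by (simp add: H_def epi_fun.simps[of _ _ _ _ _ _ k])
  qed
qed

text \<open>
  The rank one identity. At level \<open>k - 1\<close> the two sides differ by the commutator of \<open>Uop p\<close> with the
  indicator of \<open>{v. y k < v}\<close>, applied to \<open>f = b0 k - Q H\<close>, the difference of the payoffs of stopping
  and of continuing. The commutator is the point mass at \<open>y k + 1\<close> with coefficient \<open>- p * f (y k)\<close>.
  Since \<open>Dop (q k) f\<close> vanishes at \<open>y k\<close>, one has \<open>q k * f (y k + 1) = f (y k)\<close>, so \<open>jump\<close>, which is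
  \<open>f (y k + 1) + p * f (y k)\<close>, equals \<open>(1 + p * q k) * f (y k + 1)\<close>. This gives the Bernoulli weight.
\<close>

lemma epi_mid_step:
  assumes qn: "\<And>i. i \<in> {1..n} \<Longrightarrow> q i \<noteq> 0"
    and c: "\<And>i. i \<in> {1..n} \<Longrightarrow> c \<le> y i"
    and y: "\<And>i j. 1 \<le> i \<Longrightarrow> i < j \<Longrightarrow> j \<le> n \<Longrightarrow> y j < y i"
    and b: "\<And>j v. j \<in> {1..n} \<Longrightarrow> Dop (q j) (b0 j) v = (if j < n then b0 (Suc j) v else 0)"
    and b1: "\<And>j v. j \<in> {1..n} \<Longrightarrow> b1 j v = Uop p (b0 j) v"
    and k: "1 \<le> k" and nz: "1 + p * q k \<noteq> 0"
  shows "epi_mid q y c b0 b1 p n (k - 1) v =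
      epi_mid q y c b0 b1 p n k v + p * q k / (1 + p * q k) * (reach q y c k v * - jump q y c b0 b1 p n k)" (is ?before)
    and "epi_mid q (y(k := y k + 1)) c b0 b1 p n k v =
      epi_mid q y c b0 b1 p n k v + reach q y c k v * - jump q y c b0 b1 p n k" (is ?moved)
proof -
  let ?y' = "y(k := y k + 1)"
  define H where "H = epi_fun q y c b0 n (\<lambda>_. 0)"
  define D where "D = jump q y c b0 b1 p n k"
  have "?before \<and> ?moved"
  proof (cases "n < k")
    case True
    then have "epi_fun q ?y' c b n T j v = epi_fun q y c b n T j v" for b T j v
      by (intro epi_fun_cong) auto
    then show ?thesis using True unfolding D_def jump_def epi_mid_def by (simp add: epi_fun_terminal min_absorb2)
  next
    case False
    then have kn: "k \<le> n" by simp
    define g where "g = (\<lambda>x. \<Sum>u\<in>{c<..<x}. q k powi (u - x) * H k u)"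
    have drift: "H (k - 1) x = (if y k < x then b0 k x else g x)" "Dop (q k) g x = H k x"
      "y k \<le> x \<Longrightarrow> Dop (q k) (b0 k) x = H k x" for x
      using epi_fun_Dop[of n q c y b0 k x, OF qn c y b k kn] unfolding H_def g_def by auto
    have H0: "H k v = 0" if "v \<le> c" for v
      unfolding H_def using that c k by (intro epi_fun_vanish) auto
    have Ug: "(\<Sum>u\<in>{c<..<x}. q k powi (u - x) * Uop p (H k) u) = Uop p g x" for x
      unfolding g_def by (rule geometric_sum_Uop) (rule H0)
    \<comment> \<open>The function at level \<open>k - 1\<close> after the move of particle \<open>k\<close>, for the position \<open>z\<close> of that particle.\<close>
    define br where "br z = (\<lambda>v. if z < v then b1 k v else Uop p g v)" for z
    have unroll: "epi_fun q z c b1 k (Uop p (H k)) 0 = epi_fun q z c b1 (k - 1) (br (z k)) 0" for z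
    proof -
      obtain i where i: "k = Suc i" using k by (cases k) auto
      show ?thesis unfolding br_def Ug[symmetric] i by (rule ext) (simp add: epi_fun_unroll_last)
    qed
    have D: "D = Uop p (b0 k) (y k + 1) - Uop p g (y k + 1)"
      using kn k unfolding D_def jump_def H_def[symmetric] Ug by (simp add: b1)
    have qf: "q k * (b0 k (y k + 1) - g (y k + 1)) = b0 k (y k) - g (y k)"
      using drift(2)[of "y k"] drift(3)[of "y k"] by (simp add: Dop_def algebra_simps)
    have "D = (b0 k (y k + 1) - g (y k + 1)) + p * (b0 k (y k) - g (y k))"
      unfolding D Uop_def by (simp add: algebra_simps)
    also have "\<dots> = (1 + p * q k) * (b0 k (y k + 1) - g (y k + 1))"
      unfolding qf[symmetric] by (simp add: algebra_simps)
    finally have "p * q k / (1 + p * q k) * D = p * (q k * (b0 k (y k + 1) - g (y k + 1)))"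
      using nz by simp
    then have "p * q k / (1 + p * q k) * D = p * (b0 k (y k) - g (y k))" unfolding qf .
    moreover have "Uop p (H (k - 1)) x = br (y k) x - of_bool (x = y k + 1) * (p * (b0 k (y k) - g (y k)))" for x
    proof -
      have Hk: "H (k - 1) = (\<lambda>x. if y k < x then b0 k x else g x)" using drift(1) by (rule ext)
      have b1k: "b1 k x = b0 k x + p * b0 k (x - 1)" for x using b1[of k x] k kn by (simp add: Uop_def)
      consider "x \<le> y k" | "x = y k + 1" | "x > y k + 1" by linarith
      then show ?thesis
        unfolding Hk Uop_def br_def b1k by cases (simp_all add: right_diff_distrib)
    qed
    ultimately have 1: "Uop p (H (k - 1)) = (\<lambda>x. br (y k) x + (- (p * q k / (1 + p * q k) * D)) * of_bool (x = y k + 1))"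
      by (auto simp: fun_eq_iff)
    have 2: "br (y k + 1) = (\<lambda>x. br (y k) x + (- D) * of_bool (x = y k + 1))"
    proof
      fix x
      consider "x \<le> y k" | "x = y k + 1" | "x > y k + 1" by linarith
      then show "br (y k + 1) x = br (y k) x + (- D) * of_bool (x = y k + 1)"
        using k kn by cases (simp_all add: br_def D b1)
    qed
    have "epi_mid q y c b0 b1 p n (k - 1) v = epi_fun q y c b1 (k - 1) (Uop p (H (k - 1))) 0 v"
      using kn k by (simp add: epi_mid_def H_def min_absorb1)
    also have "\<dots> = epi_fun q y c b1 (k - 1) (br (y k)) 0 v + p * q k / (1 + p * q k) * (reach q y c k v * - D)"
      unfolding 1 epi_fun_linear reach_def by simp
    finally have 3: "epi_mid q y c b0 b1 p n (k - 1) v = \<dots>" .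
    have 4: "epi_mid q y c b0 b1 p n k v = epi_fun q y c b1 (k - 1) (br (y k)) 0 v"
      using kn unroll[of y] by (simp add: epi_mid_def min_absorb1 H_def)
    have "epi_fun q ?y' c b0 n (\<lambda>_. 0) k = H k"
      unfolding H_def by (rule ext, rule epi_fun_cong) auto
    then have "epi_mid q ?y' c b0 b1 p n k v = epi_fun q ?y' c b1 (k - 1) (br (y k + 1)) 0 v"
      using kn unroll[of ?y'] by (simp add: epi_mid_def min_absorb1)
    also have "\<dots> = epi_fun q y c b1 (k - 1) (br (y k + 1)) 0 v"
      using k by (intro epi_fun_cong) auto
    also have "\<dots> = epi_fun q y c b1 (k - 1) (br (y k)) 0 v + reach q y c k v * - D"
      unfolding 2 epi_fun_linear reach_def by simp
    finally show ?thesis using 3 4 by (simp add: D_def)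
  qed
  then show ?before ?moved by blast+
qed

text \<open>
  A walk that has not hit at level \<open>k - 2\<close> is at most at \<open>y (k - 1) = y k + 1\<close>, and its next step goes
  strictly down.
\<close>

lemma reach_blocked:
  assumes "2 \<le> k" "y k = y (k - 1) - 1"
  shows "reach q y c k v = 0"
proof -
  obtain i where i: "k = Suc (Suc i)" using assms(1) by (metis add_2_eq_Suc le_Suc_ex)
  have "epi_fun q y c (\<lambda>_ _. 0) (Suc i) (\<lambda>v. of_bool (v = y k + 1)) 0 v =
      epi_fun q y c (\<lambda>_ _. 0) i (\<lambda>v. if y (Suc i) < v then 0
        else (\<Sum>u\<in>{c<..<v}. q (Suc i) powi (u - v) * of_bool (u = y k + 1))) 0 v"
    by (simp add: epi_fun_unroll_last)
  also have "(\<lambda>v. if y (Suc i) < v then 0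
        else (\<Sum>u\<in>{c<..<v}. q (Suc i) powi (u - v) * of_bool (u = y k + 1))) = (\<lambda>v. 0 + 0 * 0)"
    using assms(2) by (auto simp: fun_eq_iff i intro!: sum.neutral)
  also have "epi_fun q y c (\<lambda>_ _. 0) i (\<lambda>v. 0 + 0 * 0) 0 v = 0"
  proof -
    have "epi_fun q y c (\<lambda>_ _. 0) i (\<lambda>v. 0) j v = 0" for j v
    proof (induction j arbitrary: v rule: level_induct[where k = i])
      case (terminal j)
      then show ?case by (simp add: epi_fun_terminal)
    next
      case (step j)
      then show ?case by (subst epi_fun.simps) simp
    qed
    then show ?thesis by simp
  qed
  finally show ?thesis by (simp add: reach_def i)
qed

text \<open>
  Below \<open>y l\<close> only the continuing branch is seen by each of the operators \<open>Dop\<close>, so they peel off one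
  level after the other.
\<close>

lemma Dall_epi_fun_below:
  assumes qn: "\<And>i. i \<in> {1..n} \<Longrightarrow> q i \<noteq> 0"
    and c: "\<And>i. i \<in> {1..n} \<Longrightarrow> c \<le> y i"
    and y: "\<And>i j. 1 \<le> i \<Longrightarrow> i < j \<Longrightarrow> j \<le> N \<Longrightarrow> y j < y i" and n: "n \<le> N"
    and b: "\<And>j v. j \<in> {1..n} \<Longrightarrow> Dop (q j) (b j) v = (if j < n then b (Suc j) v else 0)"
    and l: "l \<le> N" "l = 0 \<or> x < y l"
  shows "Dall q l (epi_fun q y c b n (\<lambda>_. 0) 0) x = epi_fun q y c b n (\<lambda>_. 0) l x"
  using l
proof (induction l arbitrary: x)
  case 0
  then show ?case by simp
next
  case (Suc l)
  let ?H = "epi_fun q y c b n (\<lambda>_. 0)"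
  have x: "x < y (Suc l)" using Suc by simp
  have "l = 0 \<or> x + 1 < y l"
  proof (cases "l = 0")
    case False
    then show ?thesis using y[of l "Suc l"] x Suc.prems by auto
  qed simp
  then have "Dall q (Suc l) (?H 0) x = Dop (q (Suc l)) (?H l) x"
    using Suc.IH[of x] Suc.IH[of "x + 1"] Suc.prems by (auto simp: Dall_Suc Dop_def)
  also have "\<dots> = ?H (Suc l) x"
  proof (cases "Suc l \<le> n")
    case True
    note drift = epi_fun_Dop[of n q c y b "Suc l", OF qn c y b]
    have "Dop (q (Suc l)) (?H l) x =
       Dop (q (Suc l)) (\<lambda>x. \<Sum>u\<in>{c<..<x}. q (Suc l) powi (u - x) * ?H (Suc l) u) x"
      unfolding Dop_def using x True n drift(1)[of x] drift(1)[of "x + 1"] by auto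
    then show ?thesis using True n drift(2)[of x] by simp
  next
    case False
    then show ?thesis by (simp add: epi_fun_terminal Dop_def)
  qed
  finally show ?case .
qed

text \<open>
  Here \<open>R j v\<close> stands for \<open>Q_range q j n v (y n)\<close>. If the payoff of stopping is what the kernel \<open>Q\<close> gives anyway,
  it does not matter when the walk stops, and the hitting function is \<open>R\<close>. The operators \<open>Dop\<close> then
  remove one factor \<open>Q\<close> each, until the last one turns \<open>R (n - 1)\<close> into the point mass at \<open>y n\<close>.
\<close>

lemma Dall_epi_fun_column:
  assumes qn: "\<And>i. i \<in> {1..n} \<Longrightarrow> q i \<noteq> 0"
    and c: "\<And>i. i \<in> {1..n} \<Longrightarrow> c < y i"
    and y: "\<And>i j. 1 \<le> i \<Longrightarrow> i < j \<Longrightarrow> j \<le> n \<Longrightarrow> y j < y i" and n: "1 \<le> n"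
    and b: "\<And>j v. j \<in> {1..n} \<Longrightarrow> Dop (q j) (b j) v = (if j < n then b (Suc j) v else 0)"
    and bn: "b n (y n) = 1"
    and bR: "\<And>j v. j < n \<Longrightarrow> y n < v \<Longrightarrow> b (Suc j) v = R j v"
    and R0: "\<And>j v. j < n \<Longrightarrow> v \<le> y n \<Longrightarrow> R j v = 0"
    and R: "\<And>j v. j < n - 1 \<Longrightarrow> R j v = (\<Sum>u\<in>{c<..<v}. q (Suc j) powi (u - v) * R (Suc j) u)"
  shows "j < n \<Longrightarrow> epi_fun q y c b n (\<lambda>_. 0) j v = R j v"
    and "j < n \<Longrightarrow> Dall q j (epi_fun q y c b n (\<lambda>_. 0) 0) v = R j v"
    and "Dall q n (epi_fun q y c b n (\<lambda>_. 0) 0) v = of_bool (v = y n)"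
proof -
  let ?H = "epi_fun q y c b n (\<lambda>_. 0)"
  have yn: "y n \<le> y i" if "i \<in> {1..n}" for i
    using y[of i n] that by (cases "i = n") auto
  show HR: "?H j v = R j v" if "j < n" for j v
    using that
  proof (induction j arbitrary: v rule: level_induct[where k = n])
    case (step j)
    show ?case
    proof (cases "y (Suc j) < v")
      case True
      then have "y n < v" using yn[of "Suc j"] step by auto
      then show ?thesis using True step bR[of j v] by (subst epi_fun.simps) simp
    next
      case False
      show ?thesis
      proof (cases "Suc j < n")
        case True
        then show ?thesis using step False R[of j v] by (subst epi_fun.simps) simp
      next
        case notless: False
        then have "n = Suc j" using step by simp
        then show ?thesis using False R0[of j v] by (subst epi_fun.simps) (simp add: epi_fun_terminal)
      qed
    qed
  qed simp
  have drop: "Dop (q (Suc j)) (?H j) x = (if Suc j < n then R (Suc j) x else of_bool (x = y n))"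
    if j: "j < n" for j x
  proof -
    have Sj: "1 \<le> Suc j" "Suc j \<le> n" using j by auto
    define g where "g = (\<lambda>x. \<Sum>u\<in>{c<..<x}. q (Suc j) powi (u - x) * ?H (Suc j) u)"
    have drift: "?H j v = (if y (Suc j) < v then b (Suc j) v else g v)"
       "Dop (q (Suc j)) g v = ?H (Suc j) v"
       "y (Suc j) \<le> v \<Longrightarrow> Dop (q (Suc j)) (b (Suc j)) v = ?H (Suc j) v" for v
      using epi_fun_Dop[of n q c y b "Suc j" v, OF qn less_imp_le[OF c] y b Sj] unfolding g_def by auto
    have HS: "?H (Suc j) x = (if Suc j < n then R (Suc j) x else 0)"
      using HR by (simp add: epi_fun_terminal)
    consider "x < y (Suc j)" | "x = y (Suc j)" | "x > y (Suc j)" by linarith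
    then show ?thesis
    proof cases
      case 1
      then have "Dop (q (Suc j)) (?H j) x = Dop (q (Suc j)) g x" by (simp add: Dop_def drift(1))
      then show ?thesis using drift(2) HS 1 Sj by (auto simp: not_less)
    next
      case 3
      then have "Dop (q (Suc j)) (?H j) x = Dop (q (Suc j)) (b (Suc j)) x" by (simp add: Dop_def drift(1))
      then show ?thesis using drift(3)[of x] HS 3 Sj by (auto simp: not_less)
    next
      case 2
      then have "Dop (q (Suc j)) (?H j) x = Dop (q (Suc j)) (b (Suc j)) x + b (Suc j) x - g x"
        by (simp add: Dop_def drift(1))
      also have "\<dots> = ?H (Suc j) x + (b (Suc j) x - g x)" using drift(3)[of x] 2 by simp
      also have "b (Suc j) x - g x = (if Suc j < n then 0 else 1)"
      proof (cases "Suc j < n")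
        case True
        then have "g x = R j x" unfolding g_def using R[of j x] HR by simp
        moreover have "y n < x" using 2 y[of "Suc j" n] True by simp
        ultimately show ?thesis using bR[of j x] True by simp
      next
        case False
        then have "n = Suc j" using j by simp
        then show ?thesis using 2 bn by (simp add: g_def epi_fun_terminal)
      qed
      finally show ?thesis using HS 2 j by (auto simp: not_less le_Suc_eq)
    qed
  qed
  have DR: "Dall q j (?H 0) = R j" if "j < n" for j
    using that
  proof (induction j)
    case 0
    then show ?case using HR by (simp add: fun_eq_iff)
  next
    case (Suc j)
    then have "Dall q j (?H 0) = ?H j" using HR[of j] by (intro ext) (simp del: epi_fun.simps)
    then have "Dall q (Suc j) (?H 0) = Dop (q (Suc j)) (?H j)" by (simp only: Dall_Suc)
    then show ?case using drop[of j] Suc.prems by (simp add: fun_eq_iff)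
  qed
  then show "j < n \<Longrightarrow> Dall q j (?H 0) v = R j v" by simp
  obtain m where m: "n = Suc m" using n by (cases n) auto
  have "Dall q m (?H 0) = ?H m" using DR[of m] HR[of m] m by (intro ext) simp
  then have "Dall q n (?H 0) = Dop (q n) (?H m)" by (simp only: m Dall_Suc)
  then show "Dall q n (?H 0) v = of_bool (v = y n)"
    using drop[of m] m by simp
qed

section \<open>Contour integrals as difference operators\<close>

lemma ccw_contourD:
  assumes "ccw_contour \<Gamma> A B"
  shows "valid_path \<Gamma>" "path \<Gamma>" "pathfinish \<Gamma> = pathstart \<Gamma>"
    "a \<in> A \<Longrightarrow> winding_number \<Gamma> a = 1" "a \<in> B \<Longrightarrow> winding_number \<Gamma> a = 0"
    "a \<in> A \<union> B \<Longrightarrow> a \<notin> path_image \<Gamma>"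
proof -
  show *: "valid_path \<Gamma>" "path \<Gamma>" "pathfinish \<Gamma> = pathstart \<Gamma>"
    using assms by (auto simp: ccw_contour_def valid_path_imp_path)
  show "a \<in> A \<Longrightarrow> winding_number \<Gamma> a = 1" using assms by (auto simp: ccw_contour_def)
  show "winding_number \<Gamma> a = 0" if "a \<in> B"
    by (rule winding_number_zero_in_outside) (use * that assms in \<open>auto simp: ccw_contour_def\<close>)
  show "a \<in> A \<union> B \<Longrightarrow> a \<notin> path_image \<Gamma>"
    using assms inside_no_overlap[of "path_image \<Gamma>"] outside_no_overlap[of "path_image \<Gamma>"]
    unfolding ccw_contour_def by blast
qed

text \<open>
  The coefficient of \<open>z ^ d\<close> in \<open>P\<close>, as a contour integral. Only its values at \<open>P = 1\<close> and its behaviour under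
  multiplication of \<open>P\<close> by linear factors are used.
\<close>

definition taylor_int :: "(real \<Rightarrow> complex) \<Rightarrow> (complex \<Rightarrow> complex) \<Rightarrow> int \<Rightarrow> complex" where
  "taylor_int \<Gamma> P d = contour_integral \<Gamma> (\<lambda>z. 1 / (2 * pi * \<i> * z) * (P z / z powi d))"

lemma taylor_int_one:
  assumes \<Gamma>: "ccw_contour \<Gamma> {0} {}"
  shows "taylor_int \<Gamma> (\<lambda>_. 1) d = of_bool (d = 0)"
proof (cases "d = 0")
  case True
  have "taylor_int \<Gamma> (\<lambda>_. 1) d = contour_integral \<Gamma> (\<lambda>z. 1 / (2 * pi * \<i>) * (1 / (z - 0)))"
    unfolding taylor_int_def True by (simp add: field_simps)
  also have "\<dots> = 1 / (2 * pi * \<i>) * contour_integral \<Gamma> (\<lambda>z. 1 / (z - 0))"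
    using ccw_contourD(1,6)[OF \<Gamma>]
    by (intro contour_integral_lmul contour_integrable_holomorphic_simple[where S = "- {0}"])
       (auto intro!: holomorphic_intros)
  also have "\<dots> = winding_number \<Gamma> 0"
    using ccw_contourD(1,6)[OF \<Gamma>] by (subst winding_number_valid_path) auto
  also have "\<dots> = 1" using ccw_contourD(4)[OF \<Gamma>] by simp
  finally show ?thesis using True by simp
next
  case False
  have "((\<lambda>z. 1 / (2 * pi * \<i> * z) * (1 / z powi d)) has_contour_integral 0) \<Gamma>"
  proof (rule Cauchy_theorem_primitive[where S = "- {0}" and f = "\<lambda>z. 1 / (2 * pi * \<i>) * (z powi (- d) / of_int (- d))"])
    fix z :: complex assume z: "z \<in> - {0}"
    have "((\<lambda>z. 1 / (2 * pi * \<i>) * (z powi (- d) / of_int (- d))) has_field_derivative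
        1 / (2 * pi * \<i>) * (of_int (- d) * z powi (- d - 1) * 1 / of_int (- d))) (at z within - {0})"
      using z by (intro DERIV_cmult DERIV_cdivide DERIV_power_int DERIV_ident) simp
    also have "1 / (2 * pi * \<i>) * (of_int (- d) * z powi (- d - 1) * 1 / of_int (- d)) =
        1 / (2 * pi * \<i> * z) * (1 / z powi d)"
      using z False by (simp add: power_int_diff power_int_minus field_simps)
    finally show "((\<lambda>z. 1 / (2 * pi * \<i>) * (z powi (- d) / of_int (- d))) has_field_derivative
        1 / (2 * pi * \<i> * z) * (1 / z powi d)) (at z within - {0})" .
  qed (use ccw_contourD(1,3,6)[OF \<Gamma>] in auto)
  then show ?thesis using False by (simp add: taylor_int_def contour_integral_unique)
qed

lemma taylor_int_linear:
  assumes \<Gamma>: "ccw_contour \<Gamma> {0} {}" and P: "P holomorphic_on UNIV" "P' holomorphic_on UNIV"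
  shows "taylor_int \<Gamma> (\<lambda>z. a * P z + b * P' z) d = a * taylor_int \<Gamma> P d + b * taylor_int \<Gamma> P' d"
proof -
  define f where "f P = (\<lambda>z. 1 / (2 * pi * \<i> * z) * (P z / z powi d))" for P
  have I: "f P contour_integrable_on \<Gamma>" if "P holomorphic_on UNIV" for P
    using ccw_contourD(1,6)[OF \<Gamma>] that unfolding f_def
    by (intro contour_integrable_holomorphic_simple[where S = "- {0}"])
       (auto intro!: holomorphic_intros intro: holomorphic_on_subset)
  have "taylor_int \<Gamma> (\<lambda>z. a * P z + b * P' z) d = contour_integral \<Gamma> (\<lambda>z. a * f P z + b * f P' z)"
    unfolding taylor_int_def f_def by (simp add: algebra_simps add_divide_distrib)
  also have "\<dots> = a * contour_integral \<Gamma> (f P) + b * contour_integral \<Gamma> (f P')"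
    using I P by (simp add: contour_integral_add contour_integral_lmul contour_integrable_lmul)
  finally show ?thesis unfolding taylor_int_def f_def .
qed

lemma taylor_int_shift:
  assumes \<Gamma>: "ccw_contour \<Gamma> {0} {}"
  shows "taylor_int \<Gamma> (\<lambda>z. z * P z) d = taylor_int \<Gamma> P (d - 1)"
  unfolding taylor_int_def
proof (rule contour_integral_cong[OF refl])
  fix z assume "z \<in> path_image \<Gamma>"
  then have "z \<noteq> 0" using ccw_contourD(6)[OF \<Gamma>, of 0] by auto
  then show "1 / (2 * pi * \<i> * z) * (z * P z / z powi d) = 1 / (2 * pi * \<i> * z) * (P z / z powi (d - 1))"
    by (simp add: power_int_diff)
qed

lemma S_ker_eq_taylor_int:
  "S_ker \<Gamma> p q 1 l r t x y =
     taylor_int \<Gamma> (\<lambda>z. (\<Prod>i=1..l. of_real (q i) - z) * (\<Prod>i=Suc r..t. 1 + of_real (p i) * z)) (x - y + int l)"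
  by (simp add: S_ker_def taylor_int_def)

lemma S_ker_time_step:
  assumes \<Gamma>: "ccw_contour \<Gamma> {0} {}" and r: "r < t"
  shows "S_ker \<Gamma> p q 1 0 r t x y =
    S_ker \<Gamma> p q 1 0 (Suc r) t x y + of_real (p (Suc r)) * S_ker \<Gamma> p q 1 0 (Suc r) t x (y + 1)"
proof -
  let ?P = "\<lambda>z :: complex. (\<Prod>i=Suc (Suc r)..t. 1 + of_real (p i) * z)"
  have h: "?P holomorphic_on UNIV" "(\<lambda>z. z * ?P z) holomorphic_on UNIV" by (auto intro!: holomorphic_intros)
  have "(\<Prod>i=Suc r..t. 1 + of_real (p i) * z) = 1 * ?P z + of_real (p (Suc r)) * (z * ?P z)" for z
    using r by (simp add: prod.atLeast_Suc_atMost algebra_simps)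
  then show ?thesis
    using taylor_int_linear[OF \<Gamma> h, of 1 "of_real (p (Suc r))" "x - y"] taylor_int_shift[OF \<Gamma>, of ?P "x - y"]
    unfolding S_ker_eq_taylor_int by (simp only: diff_diff_eq) (simp add: diff_diff_eq)
qed

lemma S_ker_level_step:
  assumes \<Gamma>: "ccw_contour \<Gamma> {0} {}"
  shows "S_ker \<Gamma> p q 1 (Suc l) r t x y =
    of_real (q (Suc l)) * S_ker \<Gamma> p q 1 l r t (x + 1) y - S_ker \<Gamma> p q 1 l r t x y"
proof -
  let ?P = "\<lambda>z :: complex. (\<Prod>i=1..l. of_real (q i) - z) * (\<Prod>i=Suc r..t. 1 + of_real (p i) * z)"
  have h: "?P holomorphic_on UNIV" "(\<lambda>z. z * ?P z) holomorphic_on UNIV" by (auto intro!: holomorphic_intros)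
  have "(\<Prod>i=1..Suc l. of_real (q i) - z) * (\<Prod>i=Suc r..t. 1 + of_real (p i) * z) =
      of_real (q (Suc l)) * ?P z + (-1) * (z * ?P z)" for z
    by (simp add: algebra_simps)
  then show ?thesis
    unfolding S_ker_eq_taylor_int
    by (simp only: taylor_int_linear[OF \<Gamma> h] taylor_int_shift[OF \<Gamma>]) (simp add: algebra_simps)
qed

text \<open>
  Each linear factor of the integrand is one difference operator: the factors \<open>1 + p z\<close> are accounted for by
  \<open>S_ker_time_step\<close>, the factors \<open>q - z\<close> by \<open>S_ker_level_step\<close>, and without factors the kernel is the identity.
  As \<open>S_ker\<close> has finite range, \<open>f\<close> is arbitrary.
\<close>

lemma S_ker_has_sum:
  assumes \<Gamma>: "ccw_contour \<Gamma> {0} {}" and r: "r \<le> t"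
  shows "((\<lambda>v. S_ker \<Gamma> p q 1 l r t x v * f v) has_sum
     Dall (\<lambda>i. of_real (q i)) l (Uall (\<lambda>i. of_real (p i)) r t f) x) UNIV"
proof (induction l arbitrary: x)
  case 0
  from r have "((\<lambda>v. S_ker \<Gamma> p q 1 0 r t x v * f v) has_sum Uall (\<lambda>i. of_real (p i)) r t f x) UNIV"
  proof (induction r arbitrary: f x rule: inc_induct)
    case base
    have "S_ker \<Gamma> p q 1 0 t t x v = of_bool (v = x)" for v
      unfolding S_ker_eq_taylor_int using taylor_int_one[OF \<Gamma>, of "x - v"] by auto
    then have "((\<lambda>v. S_ker \<Gamma> p q 1 0 t t x v * f v) has_sum (\<Sum>v\<in>{x}. f v)) UNIV"
      by (intro has_sum_finite_neutralI[where B = "{x}"]) auto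
    then show ?case by simp
  next
    case (step r)
    let ?S = "\<lambda>v. S_ker \<Gamma> p q 1 0 (Suc r) t x v" and ?O = "Uall (\<lambda>i. of_real (p i)) (Suc r) t"
    let ?p = "of_real (p (Suc r)) :: complex"
    have "((\<lambda>v. ?S (v + 1) * f v) has_sum ?O (\<lambda>v. f (v - 1)) x) UNIV \<longleftrightarrow>
        ((\<lambda>v. ?S v * f (v - 1)) has_sum ?O (\<lambda>v. f (v - 1)) x) UNIV"
      by (rule has_sum_reindex_bij_witness[of _ "\<lambda>v. v - 1" "\<lambda>v. v + 1"]) auto
    then have "((\<lambda>v. ?S (v + 1) * f v) has_sum ?O (\<lambda>v. f (v - 1)) x) UNIV"
      by (rule iffD2) (rule step.IH)
    from has_sum_add[OF step.IH[of x f] has_sum_cmult_right[OF this, of ?p]]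
    have "((\<lambda>v. ?S v * f v + ?p * (?S (v + 1) * f v)) has_sum ?O f x + ?p * ?O (\<lambda>v. f (v - 1)) x) UNIV" .
    moreover have "?O f x + ?p * ?O (\<lambda>v. f (v - 1)) x = Uall (\<lambda>i. of_real (p i)) r t f x"
      using step by (simp add: Uall_step Uop_def[abs_def] Uall_linear)
    ultimately show ?case
      unfolding S_ker_time_step[OF \<Gamma> \<open>r < t\<close>] by (simp add: algebra_simps)
  qed
  then show ?case by simp
next
  case (Suc l)
  let ?q = "of_real (q (Suc l)) :: complex" and ?T = "Dall (\<lambda>i. of_real (q i)) l (Uall (\<lambda>i. of_real (p i)) r t f)"
  have "((\<lambda>v. ?q * (S_ker \<Gamma> p q 1 l r t (x + 1) v * f v) + (- 1) * (S_ker \<Gamma> p q 1 l r t x v * f v))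
      has_sum ?q * ?T (x + 1) + (- 1) * ?T x) UNIV"
    by (intro has_sum_add has_sum_cmult_right Suc)
  then show ?case
    unfolding S_ker_level_step[OF \<Gamma>] by (simp add: Dall_Suc Dop_def algebra_simps)
qed

definition bar_integrand :: "(nat \<Rightarrow> real) \<Rightarrow> (nat \<Rightarrow> real) \<Rightarrow> nat \<Rightarrow> nat \<Rightarrow> nat \<Rightarrow> nat \<Rightarrow> int \<Rightarrow> complex \<Rightarrow> complex" where
  "bar_integrand p q n r t j e = (\<lambda>z. 1 / (2 * pi * \<i> * z) *
     (z powi e / ((\<Prod>l=j..n. of_real (q l) - z) * (\<Prod>l=Suc r..t. 1 + of_real (p l) * z))))"

text \<open>
  \<open>Sbar_ker\<close> as a function of its first space variable, without the normalising product of the \<open>q l - 1\<close>, which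
  cancels against the normalisation of the walk.
\<close>

definition bar_fun :: "(real \<Rightarrow> complex) \<Rightarrow> (nat \<Rightarrow> real) \<Rightarrow> (nat \<Rightarrow> real) \<Rightarrow> nat \<Rightarrow> nat \<Rightarrow> nat \<Rightarrow> int \<Rightarrow> nat \<Rightarrow> int \<Rightarrow> complex" where
  "bar_fun \<Gamma> p q n r t x' j v =
    - contour_integral \<Gamma> (bar_integrand p q n r t j (x' - v + int n - int j + 1))"

lemma Sbar_ker_eq_bar_fun:
  "Sbar_ker \<Gamma> p q j n r t v x' = (\<Prod>l=j..n. of_real (q l) - 1) * bar_fun \<Gamma> p q n r t x' j v"
  by (simp add: Sbar_ker_def bar_fun_def bar_integrand_def)

locale q_contour =
  fixes \<Gamma> :: "real \<Rightarrow> complex" and p q :: "nat \<Rightarrow> real" and N t :: nat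
  assumes contour: "ccw_contour \<Gamma> ((\<lambda>k. of_real (q k)) ` {1..N})
           (insert 0 ((\<lambda>l. - inverse (of_real (p l))) ` {1..t}))"
    and p_pos: "\<And>l. l \<in> {1..t} \<Longrightarrow> p l > 0"
    and q_gt1: "\<And>k. k \<in> {1..N} \<Longrightarrow> q k > 1"
begin

lemma time_pole_eq:
  assumes "l \<in> {1..t}" "1 + of_real (p l) * z = 0"
  shows "z = - inverse (of_real (p l) :: complex)"
proof -
  have "of_real (p l) * z = - 1" using assms(2) by (simp add: add_eq_0_iff)
  moreover have "of_real (p l) \<noteq> (0 :: complex)" using p_pos[OF assms(1)] by simp
  ultimately show ?thesis by (metis inverse_minus_eq inverse_unique minus_mult_right minus_equation_iff)
qed

lemma on_contour:
  assumes "z \<in> path_image \<Gamma>"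
  shows "z \<noteq> 0" "k \<in> {1..N} \<Longrightarrow> of_real (q k) - z \<noteq> 0" "l \<in> {1..t} \<Longrightarrow> 1 + of_real (p l) * z \<noteq> 0"
proof -
  show "z \<noteq> 0" using assms ccw_contourD(6)[OF contour, of 0] by auto
  show "k \<in> {1..N} \<Longrightarrow> of_real (q k) - z \<noteq> 0"
    using assms ccw_contourD(6)[OF contour, of "of_real (q k)"] by auto
  show "1 + of_real (p l) * z \<noteq> 0" if l: "l \<in> {1..t}"
  proof
    assume "1 + of_real (p l) * z = 0"
    then have "z = - inverse (of_real (p l))" by (rule time_pole_eq[OF l])
    then show False using assms l ccw_contourD(6)[OF contour, of z] by auto
  qed
qed

lemma time_poles:
  assumes "l \<in> {1..t}" "1 + of_real (p l) * z = (0 :: complex)"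
  shows "z \<in> (\<lambda>l. - inverse (of_real (p l))) ` {1..t}"
proof -
  show ?thesis using time_pole_eq[OF assms] assms(1) by blast
qed

abbreviation "bar n r \<equiv> bar_fun \<Gamma> p q n r t"

lemma bar_integrand_integrable:
  assumes "1 \<le> j" "n \<le> N"
  shows "bar_integrand p q n r t j e contour_integrable_on \<Gamma>"
  unfolding bar_integrand_def
proof (rule contour_integrable_holomorphic_simple)
  let ?pts = "insert 0 ((\<lambda>l. - inverse (of_real (p l))) ` {1..t}) \<union> (\<lambda>k. of_real (q k)) ` {1..N} :: complex set"
  show "open (- ?pts)" by (intro open_Compl finite_imp_closed) auto
  show "valid_path \<Gamma>" using ccw_contourD[OF contour] by simp
  show "path_image \<Gamma> \<subseteq> - ?pts" using ccw_contourD(6)[OF contour] by blast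
  have "(\<Prod>l=j..n. of_real (q l) - z) \<noteq> 0" "(\<Prod>l=Suc r..t. 1 + of_real (p l) * z) \<noteq> 0" if "z \<in> - ?pts" for z
    using that assms time_poles[of _ z] by (force simp: prod_zero_iff)+
  then show "(\<lambda>z. 1 / (2 * pi * \<i> * z) * (z powi e
         / ((\<Prod>l=j..n. of_real (q l) - z) * (\<Prod>l=Suc r..t. 1 + of_real (p l) * z)))) holomorphic_on - ?pts"
    by (intro holomorphic_intros) auto
qed

text \<open>
  All poles of the integrand are outside the contour.
\<close>

lemma no_q_pole_integral:
  "contour_integral \<Gamma> (\<lambda>z. 1 / (2 * pi * \<i> * z) * (z powi e / (\<Prod>l=Suc r..t. 1 + of_real (p l) * z))) = 0"
proof -
  let ?pts = "insert 0 ((\<lambda>l. - inverse (of_real (p l))) ` {1..t}) :: complex set"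
  let ?f = "\<lambda>z :: complex. 1 / (2 * pi * \<i> * z) * (z powi e / (\<Prod>l=Suc r..t. 1 + of_real (p l) * z))"
  have "(\<Prod>l=Suc r..t. 1 + of_real (p l) * z) \<noteq> 0" if "z \<in> - ?pts" for z
    using that time_poles[of _ z] by (force simp: prod_zero_iff)
  then have "?f holomorphic_on UNIV - ?pts"
    by (intro holomorphic_intros) auto
  then have "contour_integral \<Gamma> ?f = 2 * pi * \<i> * (\<Sum>z\<in>?pts. winding_number \<Gamma> z * residue ?f z)"
    using ccw_contourD(1,3,6)[OF contour] by (intro Residue_theorem[where S = UNIV]) auto
  also have "\<dots> = 0" using ccw_contourD(5)[OF contour] by (intro mult_eq_0_iff[THEN iffD2] disjI2 sum.neutral) auto
  finally show ?thesis .
qed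

text \<open>
  Multiplication of the integrand by \<open>(q j - z) / z\<close> removes one factor of the denominator; when the last
  factor is removed, no pole is left inside.
\<close>

lemma bar_fun_Dop:
  assumes "j \<in> {1..n}" "n \<le> N"
  shows "Dop (of_real (q j)) (bar n r x' j) v = (if j < n then bar n r x' (Suc j) v else 0)"
proof -
  let ?e = "x' - v + int n - int j"
  let ?F = "\<lambda>j e. bar_integrand p q n r t j e"
  have "Dop (of_real (q j)) (bar n r x' j) v =
      - (of_real (q j) * contour_integral \<Gamma> (?F j ?e) - contour_integral \<Gamma> (?F j (?e + 1)))"
    by (simp add: Dop_def bar_fun_def algebra_simps)
  also have "of_real (q j) * contour_integral \<Gamma> (?F j ?e) - contour_integral \<Gamma> (?F j (?e + 1)) =
      contour_integral \<Gamma> (\<lambda>z. of_real (q j) * ?F j ?e z - ?F j (?e + 1) z)"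
    using assms bar_integrand_integrable[of j n]
    by (simp add: contour_integral_diff contour_integral_lmul contour_integrable_lmul)
  also have "\<dots> = contour_integral \<Gamma> (?F (Suc j) ?e)"
  proof (rule contour_integral_cong[OF refl])
    fix z assume z: "z \<in> path_image \<Gamma>"
    have "of_real (q j) - z \<noteq> 0" "z \<noteq> 0" using on_contour[OF z] assms by auto
    moreover have "(\<Prod>l=j..n. of_real (q l) - z) = (of_real (q j) - z) * (\<Prod>l=Suc j..n. of_real (q l) - z)"
      using assms by (subst prod.atLeast_Suc_atMost) auto
    moreover have "z powi (?e + 1) = z powi ?e * z"
      using \<open>z \<noteq> 0\<close> by (intro power_int_add_1) simp
    moreover have "q * (a * (x / ((q - z) * b * d))) - a * (x * z / ((q - z) * b * d)) = a * (x / (b * d))"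
      if "q - z \<noteq> 0" for q a b d x z :: complex
    proof -
      have "q * (a * (x / ((q - z) * b * d))) - a * (x * z / ((q - z) * b * d)) = a * ((q - z) * x / ((q - z) * (b * d)))"
        by (simp add: algebra_simps diff_divide_distrib)
      then show ?thesis using that by simp
    qed
    ultimately show "of_real (q j) * ?F j ?e z - ?F j (?e + 1) z = ?F (Suc j) ?e z"
      unfolding bar_integrand_def by presburger
  qed
  also have "- \<dots> = (if j < n then bar n r x' (Suc j) v else 0)"
  proof (cases "j < n")
    case True
    have "x' - v + int n - int (Suc j) + 1 = ?e" by simp
    then show ?thesis using True by (simp only: bar_fun_def if_True)
  next
    case False
    then show ?thesis using assms no_q_pole_integral[of ?e r] by (simp add: bar_integrand_def)
  qed
  finally show ?thesis by simp
qed

lemma bar_fun_Uop: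
  assumes "j \<in> {1..n}" "n \<le> N" "r < t"
  shows "bar n (Suc r) x' j v = Uop (of_real (p (Suc r))) (bar n r x' j) v"
proof -
  let ?e = "x' - v + int n - int j + 1"
  let ?F = "\<lambda>r e. bar_integrand p q n r t j e"
  have "Uop (of_real (p (Suc r))) (bar n r x' j) v =
      - (contour_integral \<Gamma> (?F r ?e) + of_real (p (Suc r)) * contour_integral \<Gamma> (?F r (?e + 1)))"
    by (simp add: Uop_def bar_fun_def algebra_simps)
  also have "contour_integral \<Gamma> (?F r ?e) + of_real (p (Suc r)) * contour_integral \<Gamma> (?F r (?e + 1)) =
      contour_integral \<Gamma> (\<lambda>z. ?F r ?e z + of_real (p (Suc r)) * ?F r (?e + 1) z)"
    using assms bar_integrand_integrable[of j n]
    by (simp add: contour_integral_add contour_integral_lmul contour_integrable_lmul)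
  also have "\<dots> = contour_integral \<Gamma> (?F (Suc r) ?e)"
  proof (rule contour_integral_cong[OF refl])
    fix z assume z: "z \<in> path_image \<Gamma>"
    have "1 + of_real (p (Suc r)) * z \<noteq> 0" "z \<noteq> 0" using on_contour[OF z] assms by auto
    moreover have "(\<Prod>l=Suc r..t. 1 + of_real (p l) * z) = (1 + of_real (p (Suc r)) * z) * (\<Prod>l=Suc (Suc r)..t. 1 + of_real (p l) * z)"
      using assms by (subst prod.atLeast_Suc_atMost) auto
    moreover have "z powi (?e + 1) = z powi ?e * z"
      using \<open>z \<noteq> 0\<close> by (intro power_int_add_1) simp
    moreover have "a * (x / (b * ((1 + p * z) * d))) + p * (a * (x * z / (b * ((1 + p * z) * d)))) = a * (x / (b * d))"
      if "1 + p * z \<noteq> 0" for p a b d x z :: complex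
    proof -
      have "a * (x / (b * ((1 + p * z) * d))) + p * (a * (x * z / (b * ((1 + p * z) * d)))) = a * ((1 + p * z) * x / ((1 + p * z) * (b * d)))"
        by (simp add: algebra_simps add_divide_distrib)
      then show ?thesis using that by simp
    qed
    ultimately show "?F r ?e z + of_real (p (Suc r)) * ?F r (?e + 1) z = ?F (Suc r) ?e z"
      unfolding bar_integrand_def by presburger
  qed
  finally show ?thesis by (simp only: bar_fun_def[of _ _ _ _ "Suc r"])
qed

end

section \<open>Iterated geometric kernels, decay, and the case without time factors\<close>

lemma Q_range_refl: "Q_range q n n = kId"
  by (simp add: Q_range_def)

lemma Q_range_step: "l < n \<Longrightarrow> Q_range q l n = Q q (Suc l) \<circ>\<^sub>K Q_range q (Suc l) n"
  by (simp add: Q_range_def upt_conv_Cons del: upt_Suc)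

lemma Q_range_below: "l \<le> n \<Longrightarrow> x < z \<Longrightarrow> Q_range q l n x z = 0"
proof (induction arbitrary: x rule: inc_induct)
  case base
  then show ?case by (simp add: Q_range_refl kId_def)
next
  case (step l)
  have "Q q (Suc l) x y * Q_range q (Suc l) n y z = 0" for y
    using step.IH[of y] step.prems by (cases "y < x") (auto simp: Q_def)
  then show ?case unfolding Q_range_step[OF \<open>l < n\<close>] kcomp_def by (intro infsum_0)
qed

lemma Q_range_sum:
  assumes "l < n"
  shows "Q_range q l n x z = (\<Sum>u\<in>{z - 1<..<x}. of_real (q (Suc l)) powi (u - x) * Q_range q (Suc l) n u z)"
proof -
  have "Q_range q l n x z = (\<Sum>\<^sub>\<infinity>u\<in>UNIV. Q q (Suc l) x u * Q_range q (Suc l) n u z)"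
    by (simp add: Q_range_step[OF assms] kcomp_def)
  also have "\<dots> = (\<Sum>\<^sub>\<infinity>u\<in>{z - 1<..<x}. Q q (Suc l) x u * Q_range q (Suc l) n u z)"
    by (rule infsum_cong_neutral) (use assms in \<open>auto simp: Q_def not_less Q_range_below\<close>)
  also have "\<dots> = (\<Sum>u\<in>{z - 1<..<x}. of_real (q (Suc l)) powi (u - x) * Q_range q (Suc l) n u z)"
    by (simp add: Q_def)
  finally show ?thesis .
qed

lemma Q_range_not_above: "l < n \<Longrightarrow> x \<le> z \<Longrightarrow> Q_range q l n x z = 0"
  by (simp add: Q_range_sum)

text \<open>
  This recursion in the first variable determines both the decay of \<open>Q_range\<close> and, below, its relation to
  \<open>bar_fun\<close>.
\<close>

lemma Q_range_Dop:
  assumes "l < n" "q (Suc l) \<noteq> 0"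
  shows "Dop (of_real (q (Suc l))) (\<lambda>x. Q_range q l n x z) v = Q_range q (Suc l) n v z"
  unfolding Dop_def Q_range_sum[OF assms(1)]
  by (subst geometric_sum_step) (use assms Q_range_below[of "Suc l" n] in auto)

text \<open>
  By induction on the distance from the diagonal: solving \<open>Q_range_Dop\<close> for the value at \<open>x + 1\<close> divides by
  \<open>q (Suc l) > \<rho>\<close>. The constant \<open>C'\<close> is the fixed point of the resulting recursion for the constants.
\<close>

lemma Q_range_decay:
  assumes \<rho>: "\<rho> > 0" and q: "\<And>k. k \<in> {Suc l..n} \<Longrightarrow> q k > \<rho>" and l: "l \<le> n"
  shows "\<exists>C\<ge>0. \<forall>x z. norm (Q_range q l n x z) \<le> C * \<rho> powi (z - x)"
  using l q
proof (induction rule: inc_induct)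
  case base
  have "norm (Q_range q n n x z) \<le> 1 * \<rho> powi (z - x)" for x z
    using \<rho> by (auto simp: Q_range_refl kId_def)
  then show ?case by (intro exI[of _ 1]) auto
next
  case (step l)
  then obtain C where C: "C \<ge> 0" "\<And>x z. norm (Q_range q (Suc l) n x z) \<le> C * \<rho> powi (z - x)" by auto
  define r where "r = q (Suc l)"
  have r: "r > \<rho>" using step by (simp add: r_def)
  \<comment> \<open>Solves \<open>(C' + C) / r = C' / \<rho>\<close>.\<close>
  define C' where "C' = C * \<rho> / (r - \<rho>)"
  have C': "C' \<ge> 0" using C \<rho> r by (simp add: C'_def)
  have CC: "(C' + C) / r = C' / \<rho>"
    using r \<rho> by (simp add: C'_def divide_simps) (simp add: algebra_simps)
  have "norm (Q_range q l n x z) \<le> C' * \<rho> powi (z - x)" for x z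
  proof (cases "z \<le> x")
    case True
    then show ?thesis
    proof (induction x rule: int_ge_induct)
      case base
      then show ?case using step.hyps C' \<rho> by (simp add: Q_range_not_above)
    next
      case (step x)
      have "of_real r * Q_range q l n (x + 1) z = Q_range q l n x z + Q_range q (Suc l) n x z"
        using Q_range_Dop[of l n q z x] \<open>l < n\<close> r \<rho> by (simp add: Dop_def r_def algebra_simps)
      then have "r * norm (Q_range q l n (x + 1) z) = norm (Q_range q l n x z + Q_range q (Suc l) n x z)"
        using r \<rho> by (metis abs_of_pos norm_mult norm_of_real order.strict_trans)
      also have "\<dots> \<le> (C' + C) * \<rho> powi (z - x)"
        using step.IH C(2)[of x z] by (intro order.trans[OF norm_triangle_ineq]) (simp add: algebra_simps)
      finally have "norm (Q_range q l n (x + 1) z) \<le> (C' + C) / r * \<rho> powi (z - x)"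
        using r \<rho> by (simp add: field_simps)
      also have "\<dots> = C' * \<rho> powi (z - (x + 1))"
        unfolding CC using \<rho> by (simp add: power_int_diff power_int_add field_simps)
      finally show ?case .
    qed
  next
    case False
    then show ?thesis using C' \<rho> step.hyps by (simp add: Q_range_not_above)
  qed
  then show ?case using C' by blast
qed

text \<open>
  For \<open>\<rho> > 1\<close> this is exponential decay to the left; \<open>b\<close> only marks the half line on which the bound is required.
\<close>

definition decays :: "real \<Rightarrow> int \<Rightarrow> (int \<Rightarrow> complex) \<Rightarrow> bool" where
  "decays \<rho> b f \<longleftrightarrow> (\<exists>C. \<forall>x\<le>b. norm (f x) \<le> C * \<rho> powi x)"

lemma decays_0 [simp]: "decays \<rho> b (\<lambda>_. 0)"
  unfolding decays_def by (intro exI[of _ 0]) simp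

lemma decays_add:
  assumes "decays \<rho> b f" "decays \<rho> b g"
  shows "decays \<rho> b (\<lambda>x. f x + g x)"
proof -
  obtain C C' where "\<And>x. x \<le> b \<Longrightarrow> norm (f x) \<le> C * \<rho> powi x" "\<And>x. x \<le> b \<Longrightarrow> norm (g x) \<le> C' * \<rho> powi x"
    using assms unfolding decays_def by blast
  then have "norm (f x + g x) \<le> (C + C') * \<rho> powi x" if "x \<le> b" for x
    using that by (intro order.trans[OF norm_triangle_ineq]) (simp add: distrib_right add_mono)
  then show ?thesis unfolding decays_def by blast
qed

lemma decays_cmult:
  assumes "decays \<rho> b f"
  shows "decays \<rho> b (\<lambda>x. c * f x)"
proof -
  obtain C where "\<And>x. x \<le> b \<Longrightarrow> norm (f x) \<le> C * \<rho> powi x"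
    using assms unfolding decays_def by blast
  then have "norm (c * f x) \<le> (norm c * C) * \<rho> powi x" if "x \<le> b" for x
    using that by (simp add: norm_mult mult.assoc mult_left_mono)
  then show ?thesis unfolding decays_def by blast
qed

lemma decays_sum:
  assumes "\<And>i. i \<in> A \<Longrightarrow> decays \<rho> b (f i)"
  shows "decays \<rho> b (\<lambda>x. \<Sum>i\<in>A. f i x)"
  using assms by (induction A rule: infinite_finite_induct) (auto intro: decays_add)

lemma decays_Uop: "(\<And>v. decays \<rho> b (\<lambda>x. f x v)) \<Longrightarrow> decays \<rho> b (\<lambda>x. Uop p (f x) v)"
  by (simp add: Uop_def decays_add decays_cmult)

lemma decays_Dop: "(\<And>v. decays \<rho> b (\<lambda>x. f x v)) \<Longrightarrow> decays \<rho> b (\<lambda>x. Dop q (f x) v)"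
  using decays_add[OF decays_cmult[of \<rho> b _ q] decays_cmult[of \<rho> b _ "- 1"]] by (simp add: Dop_def)

lemma decays_Uall:
  assumes "\<And>v. decays \<rho> b (\<lambda>x. f x v)"
  shows "decays \<rho> b (\<lambda>x. Uall p r t (f x) v)"
proof -
  have "decays \<rho> b (\<lambda>x. fold (\<lambda>i. Uop (p i)) xs (f x) v)" if "\<And>v. decays \<rho> b (\<lambda>x. f x v)" for xs f
    using that by (induction xs arbitrary: f) (simp_all add: decays_Uop)
  then show ?thesis using assms by (simp add: Uall_def)
qed

lemma decays_Dall:
  assumes "\<And>v. decays \<rho> b (\<lambda>x. f x v)"
  shows "decays \<rho> b (\<lambda>x. Dall q l (f x) v)"
proof (induction l arbitrary: v)
  case (Suc l)
  then show ?case using decays_Dop[of \<rho> b "\<lambda>x. Dall q l (f x)"] by (simp add: Dall_Suc)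
qed (simp add: assms)

lemma decays_epi_fun:
  assumes "\<And>v. decays \<rho> b (\<lambda>x. T x v)" "\<And>i v. j < i \<Longrightarrow> i \<le> k \<Longrightarrow> decays \<rho> b (\<lambda>x. B x i v)"
  shows "decays \<rho> b (\<lambda>x. epi_fun q y c (B x) k (T x) j v)"
  using assms(2)
proof (induction j arbitrary: v rule: level_induct[where k = k])
  case (terminal j)
  then show ?case by (simp add: epi_fun_terminal assms(1))
next
  case (step j)
  show ?case
  proof (cases "y (Suc j) < v")
    case True
    then show ?thesis using step by (subst epi_fun.simps) simp
  next
    case False
    have "decays \<rho> b (\<lambda>x. \<Sum>u\<in>{c<..<v}. q (Suc j) powi (u - v) * epi_fun q y c (B x) k (T x) (Suc j) u)"
      using step by (intro decays_sum decays_cmult) auto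
    then show ?thesis using False step by (subst epi_fun.simps) simp
  qed
qed

text \<open>
  The recursion is solved to the left by dividing by \<open>q > \<rho>\<close>, so the decay rate of the inhomogeneity \<open>g\<close> is
  passed on to \<open>f\<close> without knowledge of the residues behind \<open>f\<close>.
\<close>

lemma decays_recursion:
  fixes f g :: "int \<Rightarrow> complex"
  assumes \<rho>: "0 < \<rho>" "\<rho> < q" and g: "decays \<rho> b g"
    and rec: "\<And>x. of_real q * f (x - 1) = f x + g x"
  shows "decays \<rho> b f"
proof -
  obtain C0 where C0: "\<And>x. x \<le> b \<Longrightarrow> norm (g x) \<le> C0 * \<rho> powi x" using g unfolding decays_def by blast
  define C where "C = max (norm (f b) / \<rho> powi b) (C0 * \<rho> / (q - \<rho>))"
  have "C0 * \<rho> \<le> C * (q - \<rho>)"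
    using \<rho> by (simp add: C_def pos_divide_le_eq[symmetric])
  then have "(C + C0) * \<rho> \<le> C * q" by (simp add: algebra_simps)
  then have CC: "(C + C0) / q \<le> C / \<rho>" using \<rho> by (simp add: divide_simps)
  have "norm (f x) \<le> C * \<rho> powi x" if "x \<le> b" for x
    using that
  proof (induction x rule: int_le_induct)
    case base
    have "norm (f b) / \<rho> powi b \<le> C" by (simp add: C_def)
    then show ?case using \<rho> by (simp add: pos_divide_le_eq)
  next
    case (step x)
    have "q * norm (f (x - 1)) = norm (f x + g x)"
      unfolding rec[symmetric] using \<rho> by (simp add: norm_mult)
    also have "\<dots> \<le> (C + C0) * \<rho> powi x"
      using step C0[of x] by (intro order.trans[OF norm_triangle_ineq]) (simp add: algebra_simps)
    finally have "norm (f (x - 1)) \<le> (C + C0) / q * \<rho> powi x" using \<rho> by (simp add: field_simps)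
    also have "\<dots> \<le> C / \<rho> * \<rho> powi x" using CC \<rho> by (intro mult_right_mono) auto
    also have "\<dots> = C * \<rho> powi (x - 1)" using \<rho> by (simp add: power_int_diff)
    finally show ?case .
  qed
  then show ?thesis unfolding decays_def by blast
qed

context q_contour begin

text \<open>
  \<open>bar_fun\<close> depends on \<open>x' - v\<close> only, so \<open>bar_fun_Dop\<close> is also a recursion in \<open>x'\<close>.
\<close>

lemma bar_fun_decays:
  assumes \<rho>: "0 < \<rho>" "\<And>k. k \<in> {1..N} \<Longrightarrow> \<rho> < q k" and j: "1 \<le> j" "j \<le> n" "n \<le> N"
  shows "decays \<rho> b (\<lambda>x'. bar n r x' j v)"
  using j(2,1)
proof (induction arbitrary: v rule: inc_induct)
  have shift: "bar n r (x' - 1) j v = bar n r x' j (v + 1)" for x' j v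
    by (simp add: bar_fun_def)
  {
    case base
    have n: "n \<in> {1..N}" using base j by simp
    show ?case
    proof (rule decays_recursion[OF \<rho>(1) \<rho>(2)[OF n] decays_0])
      show "of_real (q n) * bar n r (x' - 1) n v = bar n r x' n v + 0" for x'
        using bar_fun_Dop[of n n r x' v] n unfolding shift by (simp add: Dop_def)
    qed
  next
    case (step j)
    have n: "j \<in> {1..N}" using step j by simp
    have "decays \<rho> b (\<lambda>x'. bar n r x' (Suc j) v)" by (rule step.IH) simp
    then show ?case
    proof (rule decays_recursion[OF \<rho>(1) \<rho>(2)[OF n]])
      show "of_real (q j) * bar n r (x' - 1) j v = bar n r x' j v + bar n r x' (Suc j) v" for x'
        using bar_fun_Dop[of j n r x' v] n step.hyps j unfolding shift by (simp add: Dop_def algebra_simps)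
    qed
  }
qed

text \<open>
  The integrals behind \<open>bar_fun\<close> without time factors. For polynomial integrands the contour may be replaced
  by a large circle.
\<close>

definition q_moment :: "nat \<Rightarrow> nat \<Rightarrow> nat \<Rightarrow> complex" where
  "q_moment n k j = contour_integral \<Gamma> (\<lambda>z. z ^ k / (\<Prod>i=j..n. of_real (q i) - z))"

lemma q_moment_integrable:
  assumes "1 \<le> j" "n \<le> N"
  shows "(\<lambda>z. z ^ k / (\<Prod>i=j..n. of_real (q i) - z)) contour_integrable_on \<Gamma>"
proof (rule contour_integrable_holomorphic_simple)
  let ?pts = "(\<lambda>k. of_real (q k)) ` {1..N} :: complex set"
  show "open (- ?pts)" by (intro open_Compl finite_imp_closed) auto
  show "valid_path \<Gamma>" using ccw_contourD[OF contour] by simp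
  show "path_image \<Gamma> \<subseteq> - ?pts" using ccw_contourD(6)[OF contour] by blast
  have "(\<Prod>l=j..n. of_real (q l) - z) \<noteq> 0" if "z \<in> - ?pts" for z
    using that assms by (force simp: prod_zero_iff)
  then show "(\<lambda>z. z ^ k / (\<Prod>i=j..n. of_real (q i) - z)) holomorphic_on - ?pts"
    by (intro holomorphic_intros) auto
qed

lemma q_moment_simple:
  assumes "1 \<le> n" "n \<le> N"
  shows "q_moment n 0 n = - (2 * pi * \<i>)"
proof -
  have "((\<lambda>w. (- 1) / (w - of_real (q n))) has_contour_integral 2 * pi * \<i> * winding_number \<Gamma> (of_real (q n)) * (- 1)) \<Gamma>"
    using ccw_contourD(1,3,6)[OF contour] assms
    by (intro Cauchy_integral_formula_convex_simple[where S = UNIV]) auto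
  also have "(\<lambda>w :: complex. (- 1) / (w - of_real (q n))) = (\<lambda>z. z ^ 0 / (\<Prod>i=n..n. of_real (q i) - z))"
  proof (rule ext)
    fix w :: complex
    show "(- 1) / (w - of_real (q n)) = w ^ 0 / (\<Prod>i=n..n. of_real (q i) - w)"
      using minus_divide_divide[of 1 "of_real (q n) - w"] by simp
  qed
  finally show ?thesis
    using ccw_contourD(4)[OF contour, of "of_real (q n)"] assms
    unfolding q_moment_def by (simp add: contour_integral_unique)
qed

text \<open>
  The integrand decays at least as \<open>1 / z\<^sup>2\<close>, so the integral over a circle of radius \<open>R\<close> around \<open>0\<close>, which has the same
  residues inside, is of order \<open>1 / R\<close>.
\<close>

lemma q_moment_zero:
  assumes j: "1 \<le> j" "j < n" "n \<le> N"
  shows "q_moment n 0 j = 0"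
proof -
  define f where "f z = z ^ 0 / (\<Prod>i=j..n. of_real (q i) - z)" for z :: complex
  define pts where "pts = ((\<lambda>i. of_real (q i)) ` {j..n} :: complex set)"
  define M where "M = (\<Sum>i=j..n. q i)"
  have q0: "q i > 1" if "i \<in> {j..n}" for i using that q_gt1[of i] j by auto
  have qM: "q i \<le> M" if "i \<in> {j..n}" for i
    unfolding M_def
  proof (rule member_le_sum[OF that])
    show "0 \<le> q k" if "k \<in> {j..n} - {i}" for k using q0[of k] that by simp
  qed simp
  have M0: "M > 1" using q0[of j] qM[of j] j by auto
  have nz: "(\<Prod>i=j..n. of_real (q i) - z) \<noteq> 0" if "z \<notin> pts" for z
    using that by (auto simp: prod_zero_iff pts_def)
  then have hol: "f holomorphic_on UNIV - pts"
    unfolding f_def by (intro holomorphic_intros) auto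
  have "contour_integral \<Gamma> f = 2 * pi * \<i> * (\<Sum>z\<in>pts. winding_number \<Gamma> z * residue f z)"
    using hol ccw_contourD(1,3)[OF contour] ccw_contourD(6)[OF contour] j
    by (intro Residue_theorem[where S = UNIV]) (auto simp: pts_def)
  also have "(\<Sum>z\<in>pts. winding_number \<Gamma> z * residue f z) = (\<Sum>z\<in>pts. residue f z)"
    using ccw_contourD(4)[OF contour] j by (intro sum.cong) (auto simp: pts_def)
  finally have \<Gamma>f: "contour_integral \<Gamma> f = 2 * pi * \<i> * (\<Sum>z\<in>pts. residue f z)" .
  have bound: "norm (contour_integral \<Gamma> f) \<le> 4 * pi / s" if s: "s \<ge> M" for s
  proof -
    define R where "R = M + s"
    have R: "R > 0" "R \<le> 2 * s" "s > 0" using s M0 by (auto simp: R_def)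
    have far: "norm (of_real (q i) - z) \<ge> s" if "norm z = R" "i \<in> {j..n}" for z :: complex and i
    proof -
      have "norm z - norm (of_real (q i) :: complex) \<le> norm (of_real (q i) - z)"
        by (metis norm_minus_commute norm_triangle_ineq2)
      then show ?thesis using that qM[of i] q0[of i] by (simp add: R_def)
    qed
    have img: "path_image (circlepath 0 R) \<subseteq> UNIV - pts"
    proof -
      have "z \<notin> pts" if "norm z = R" for z
      proof
        assume "z \<in> pts"
        then obtain i where "i \<in> {j..n}" "z = of_real (q i)" by (auto simp: pts_def)
        then show False using far[OF that, of i] R by simp
      qed
      then show ?thesis using R by (auto simp: path_image_circlepath sphere_def)
    qed
    have "contour_integral (circlepath 0 R) f = 2 * pi * \<i> * (\<Sum>z\<in>pts. winding_number (circlepath 0 R) z * residue f z)"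
      using hol img by (intro Residue_theorem[where S = UNIV]) (auto simp: pts_def)
    also have "(\<Sum>z\<in>pts. winding_number (circlepath 0 R) z * residue f z) = (\<Sum>z\<in>pts. residue f z)"
    proof (rule sum.cong[OF refl])
      fix z assume "z \<in> pts"
      then obtain i where i: "i \<in> {j..n}" "z = of_real (q i)" by (auto simp: pts_def)
      then have "norm (z - 0) < R" using qM[of i] q0[of i] R s by (simp add: R_def)
      then show "winding_number (circlepath 0 R) z * residue f z = residue f z"
        by (simp add: winding_number_circlepath)
    qed
    finally have eq: "contour_integral (circlepath 0 R) f = contour_integral \<Gamma> f" using \<Gamma>f by simp
    have "f contour_integrable_on circlepath 0 R"
      using hol img by (intro contour_integrable_holomorphic_simple[where S = "UNIV - pts"])
        (auto simp: pts_def intro!: open_Diff finite_imp_closed)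
    then have "(f has_contour_integral contour_integral \<Gamma> f) (circlepath 0 R)"
      using eq has_contour_integral_integral by metis
    then have "norm (contour_integral \<Gamma> f) \<le> 1 / s\<^sup>2 * (2 * pi * R)"
    proof (rule has_contour_integral_bound_circlepath)
      fix z :: complex assume "norm (z - 0) = R"
      then have z: "norm z = R" by simp
      have "s ^ card {j..n} \<le> (\<Prod>i=j..n. norm (of_real (q i) - z))"
        unfolding prod_constant[symmetric] using far[OF z] R by (intro prod_mono) auto
      moreover have "s\<^sup>2 \<le> s ^ card {j..n}"
        using s M0 j by (intro power_increasing) auto
      ultimately have "s\<^sup>2 \<le> norm (\<Prod>i=j..n. of_real (q i) - z)" by (simp add: prod_norm)
      then show "norm (f z) \<le> 1 / s\<^sup>2"
        using R by (simp add: f_def norm_divide frac_le)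
    qed (use R in auto)
    also have "\<dots> \<le> 1 / s\<^sup>2 * (2 * pi * (2 * s))" using R by (intro mult_left_mono) auto
    also have "\<dots> = 4 * pi / s" using R by (simp add: power2_eq_square)
    finally show ?thesis .
  qed
  have "contour_integral \<Gamma> f = 0"
  proof (rule ccontr)
    assume "contour_integral \<Gamma> f \<noteq> 0"
    then have e: "norm (contour_integral \<Gamma> f) > 0" (is "?e > 0") by simp
    \<comment> \<open>Large enough to make the bound smaller than the integral itself.\<close>
    define s where "s = M + 4 * pi / ?e"
    have "s > 4 * pi / ?e" "s \<ge> M" using M0 e by (auto simp: s_def)
    then have "4 * pi / s < ?e" using e M0 by (simp add: field_simps)
    then show False using bound[OF \<open>s \<ge> M\<close>] by simp
  qed
  then show ?thesis by (simp add: q_moment_def f_def[abs_def])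
qed

lemma q_moment_Suc:
  assumes j: "1 \<le> j" "j < n" "n \<le> N"
  shows "q_moment n (Suc k) j = of_real (q j) * q_moment n k j - q_moment n k (Suc j)"
proof -
  define f where "f k j z = z ^ k / (\<Prod>i=j..n. of_real (q i) - z)" for k j and z :: complex
  have int: "f k j contour_integrable_on \<Gamma>" if "1 \<le> j" for k j
    unfolding f_def using that assms by (intro q_moment_integrable)
  have "contour_integral \<Gamma> (f (Suc k) j) = contour_integral \<Gamma> (\<lambda>z. of_real (q j) * f k j z - f k (Suc j) z)"
  proof (rule contour_integral_cong[OF refl])
    fix z assume z: "z \<in> path_image \<Gamma>"
    have nz: "of_real (q j) - z \<noteq> 0" using on_contour[OF z] j by auto
    have P: "(\<Prod>l=j..n. of_real (q l) - z) = (of_real (q j) - z) * (\<Prod>l=Suc j..n. of_real (q l) - z)"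
      using j by (subst prod.atLeast_Suc_atMost) auto
    have "q * (x / ((q - z) * d)) - x / d = z * x / ((q - z) * d)" if "q - z \<noteq> 0" for q d x z :: complex
    proof -
      have "x / d = (q - z) * x / ((q - z) * d)" using that by simp
      then show ?thesis by (simp add: algebra_simps diff_divide_distrib)
    qed
    from this[OF nz, of "z ^ k"] show "f (Suc k) j z = of_real (q j) * f k j z - f k (Suc j) z"
      unfolding f_def P by simp
  qed
  also have "\<dots> = of_real (q j) * contour_integral \<Gamma> (f k j) - contour_integral \<Gamma> (f k (Suc j))"
    using int j by (simp add: contour_integral_diff contour_integral_lmul contour_integrable_lmul)
  finally show ?thesis by (simp add: q_moment_def f_def[abs_def])
qed

lemma q_moment_eq:
  assumes "1 \<le> j" "j \<le> n" "n \<le> N" "k \<le> n - j"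
  shows "q_moment n k j = (if k = n - j then - ((- 1) ^ k * (2 * pi * \<i>)) else 0)"
  using assms
proof (induction k arbitrary: j)
  case 0
  then show ?case using q_moment_simple[of n] q_moment_zero[of j n] by (cases "j = n") auto
next
  case (Suc k)
  have j: "1 \<le> j" "j < n" "n \<le> N" "k \<le> n - Suc j" "k \<noteq> n - j"
    using Suc.prems(1,2,3,4) by linarith+
  have d: "n - j = Suc (n - Suc j)" using j(2) by (rule Suc_diff_Suc[symmetric])
  have m0: "q_moment n k j = 0" 
  proof -
    have "j \<le> n" "k \<le> n - j" using j(2,4) by simp_all
    from Suc.IH[OF j(1) this(1) j(3) this(2)] show ?thesis using j(5) by (simp only: if_False)
  qed
  have m1: "q_moment n k (Suc j) = (if Suc k = n - j then - ((- 1) ^ k * (2 * pi * \<i>)) else 0)"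
  proof -
    have "1 \<le> Suc j" "Suc j \<le> n" using j(2) by simp_all
    from Suc.IH[OF this j(3,4)] show ?thesis unfolding d by (simp only: nat.inject)
  qed
  have "r * 0 - (if P then - ((- 1) ^ k * c) else 0) = (if P then - ((- 1) ^ Suc k * c) else 0)"
    for P and r c :: complex by simp
  then show ?case unfolding q_moment_Suc[OF j(1-3)] m0 m1 .
qed

lemma bar_fun_diagonal:
  assumes "1 \<le> j" "j \<le> n" "n \<le> N"
  shows "bar n t x j x = (- 1) ^ (n - j)"
proof -
  have "contour_integral \<Gamma> (bar_integrand p q n t t j (x - x + int n - int j + 1)) =
     contour_integral \<Gamma> (\<lambda>z. 1 / (2 * pi * \<i>) * (z ^ (n - j) / (\<Prod>i=j..n. of_real (q i) - z)))"
  proof (rule contour_integral_cong[OF refl])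
    fix z assume z: "z \<in> path_image \<Gamma>"
    have "z \<noteq> 0" using on_contour(1)[OF z] .
    moreover have "z powi (x - x + int n - int j + 1) = z ^ (n - j) * z"
    proof -
      have "x - x + int n - int j + 1 = int (Suc (n - j))" using assms by simp
      then show ?thesis by (simp only: power_int_of_nat power_Suc2)
    qed
    ultimately show "bar_integrand p q n t t j (x - x + int n - int j + 1) z =
        1 / (2 * pi * \<i>) * (z ^ (n - j) / (\<Prod>i=j..n. of_real (q i) - z))"
      by (simp add: bar_integrand_def)
  qed
  also have "\<dots> = 1 / (2 * pi * \<i>) * q_moment n (n - j) j"
    unfolding q_moment_def using assms by (intro contour_integral_lmul q_moment_integrable) auto
  also have "\<dots> = - ((- 1) ^ (n - j))" using q_moment_eq[of j n "n - j"] assms by simp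
  finally show ?thesis by (simp add: bar_fun_def)
qed

text \<open>
  To the left of \<open>v\<close> the integrand has no residue at infinity, so the residues at the \<open>q i\<close> and at \<open>0\<close> cancel, and
  the latter gives \<open>Q_range\<close>. The proof compares recursions instead: both sides satisfy the same recursion in \<open>v\<close>,
  and their values at \<open>v = x + 1\<close> are obtained from the diagonal.
\<close>

lemma bar_fun_eq_Q_range:
  assumes j: "1 \<le> j" "j \<le> n" "n \<le> N" and v: "x < v"
  shows "bar n t x j v = Q_range q (j - 1) n v x"
  using j(2,1) v
proof (induction arbitrary: v rule: inc_induct)
  have up: "bar n t x j v = Q_range q (j - 1) n v x"
    if jj: "1 \<le> j" "j \<le> n" and v: "x + 1 \<le> v"
      and base: "bar n t x j (x + 1) = Q_range q (j - 1) n (x + 1) x"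
      and step: "\<And>v. x < v \<Longrightarrow> Dop (of_real (q j)) (bar n t x j) v = Q_range q j n v x" for j v
    using v
  proof (induction v rule: int_ge_induct)
    case base
    then show ?case using \<open>bar n t x j (x + 1) = _\<close> .
  next
    case (step v)
    have "q j \<noteq> 0" using q_gt1[of j] jj \<open>n \<le> N\<close> by auto
    moreover have "Dop (of_real (q j)) (bar n t x j) v = Dop (of_real (q j)) (\<lambda>v. Q_range q (j - 1) n v x) v"
      using Q_range_Dop[of "j - 1" n q x v] that(5)[of v] step jj \<open>q j \<noteq> 0\<close> by simp
    ultimately show ?case using step.IH by (simp add: Dop_def)
  qed
  {
    case base
    have "q n > 1" using base j q_gt1 by auto
    then have "of_real (q n) * bar n t x n (x + 1) = 1"
      using bar_fun_Dop[of n n t x x] bar_fun_diagonal[of n n x] base j by (simp add: Dop_def)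
    moreover have "of_real (q n) * Q_range q (n - 1) n (x + 1) x = 1"
      using Q_range_Dop[of "n - 1" n q x x] \<open>q n > 1\<close> base
      by (simp add: Dop_def Q_range_not_above Q_range_refl kId_def)
    ultimately have eq: "bar n t x n (x + 1) = Q_range q (n - 1) n (x + 1) x"
      using \<open>q n > 1\<close> by (metis mult_cancel_left zero_neq_one mult_zero_left)
    show ?case
    proof (rule up[OF _ _ _ eq])
      fix v assume "x < v"
      then show "Dop (of_real (q n)) (bar n t x n) v = Q_range q n n v x"
        using base j bar_fun_Dop[of n n t x v] by (simp add: Q_range_refl kId_def)
    qed (use base j in auto)
  next
    case (step j)
    have "q j > 1" using step j q_gt1 by auto
    have "Suc (n - Suc j) = n - j" using step by simp
    then have "(- 1 :: complex) ^ (n - j) = - ((- 1) ^ (n - Suc j))" by (metis power_Suc mult_minus1)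
    then have "of_real (q j) * bar n t x j (x + 1) = 0"
      using bar_fun_Dop[of j n t x x] bar_fun_diagonal[of j n x] bar_fun_diagonal[of "Suc j" n x] step j
      by (simp add: Dop_def algebra_simps)
    then have "bar n t x j (x + 1) = 0" using \<open>q j > 1\<close> by simp
    moreover have "of_real (q j) * Q_range q (j - 1) n (x + 1) x = 0"
      using Q_range_Dop[of "j - 1" n q x x] \<open>q j > 1\<close> step
      by (simp add: Dop_def Q_range_not_above)
    then have "Q_range q (j - 1) n (x + 1) x = 0" using \<open>q j > 1\<close> by simp
    ultimately have eq: "bar n t x j (x + 1) = Q_range q (j - 1) n (x + 1) x" by simp
    show ?case
    proof (rule up[OF _ _ _ eq])
      fix v assume "x < v"
      then show "Dop (of_real (q j)) (bar n t x j) v = Q_range q j n v x"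
        using step j bar_fun_Dop[of j n t x v] by simp
    qed (use step j in auto)
  }
qed

end

section \<open>The random walk expectation\<close>

abbreviation "expect \<equiv> measure_pmf.expectation"

text \<open>
  Adding the bound makes the function nonnegative and reduces the claim to the tower property of nonnegative
  integrals.
\<close>

lemma expectation_bind_pmf_bounded_real:
  fixes f :: "'b \<Rightarrow> real"
  assumes f: "\<And>x. \<bar>f x\<bar> \<le> C"
  shows "expect (bind_pmf M K) f =
    expect M (\<lambda>x. expect (K x) f)"
proof -
  have pos: "0 \<le> f x + C" for x using f[of x] by linarith
  have int: "integrable (measure_pmf P) f" for P :: "'b pmf"
    using f by (intro measure_pmf.integrable_const_bound[where B = C]) auto
  have int': "integrable (measure_pmf P) (\<lambda>x. f x + C)" for P :: "'b pmf"
    using int by simp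
  have E: "expect P (\<lambda>x. f x + C) = expect P f + C" for P :: "'b pmf"
    using int by simp
  have Kb: "\<bar>expect (K x) f\<bar> \<le> C" for x
  proof -
    have "expect (K x) f \<le> C" "- C \<le> expect (K x) f"
      using f int by (auto intro!: measure_pmf.integral_le_const measure_pmf.integral_ge_const simp: abs_le_iff minus_le_iff)
    then show ?thesis by simp
  qed
  then have intK: "integrable (measure_pmf M) (\<lambda>x. expect (K x) f)"
    by (intro measure_pmf.integrable_const_bound[where B = C]) auto
  have "expect (bind_pmf M K) (\<lambda>x. f x + C) =
      enn2real (\<integral>\<^sup>+ x. \<integral>\<^sup>+ y. ennreal (f y + C) \<partial>K x \<partial>M)"
    using pos by (subst integral_eq_nn_integral) auto
  also have "(\<integral>\<^sup>+ x. \<integral>\<^sup>+ y. ennreal (f y + C) \<partial>K x \<partial>M) = (\<integral>\<^sup>+ x. ennreal (expect (K x) f + C) \<partial>M)"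
    using int' pos by (subst nn_integral_eq_integral) (auto simp: E)
  also have "enn2real \<dots> = expect M (\<lambda>x. expect (K x) f + C)"
  proof (rule integral_eq_nn_integral[symmetric])
    have "0 \<le> expect (K x) f + C" for x using Kb[of x] by linarith
    then show "AE x in M. 0 \<le> expect (K x) f + C" by simp
  qed simp
  also have "\<dots> = expect M (\<lambda>x. expect (K x) f) + C"
    using intK by simp
  finally show ?thesis unfolding E by simp
qed

lemma expectation_bind_pmf_bounded:
  fixes f :: "'b \<Rightarrow> complex"
  assumes f: "\<And>x. norm (f x) \<le> C"
  shows "expect (bind_pmf M K) f =
    expect M (\<lambda>x. expect (K x) f)"
proof -
  have int: "integrable (measure_pmf P) f" for P :: "'b pmf"
    using f by (intro measure_pmf.integrable_const_bound[where B = C]) auto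
  have "norm (expect (K x) f) \<le> C" for x
    using f by (intro order.trans[OF integral_norm_bound] measure_pmf.integral_le_const) (auto simp: int)
  then have intK: "integrable (measure_pmf M) (\<lambda>x. expect (K x) f)"
    by (intro measure_pmf.integrable_const_bound[where B = C]) auto
  have "\<bar>Re (f x)\<bar> \<le> C" "\<bar>Im (f x)\<bar> \<le> C" for x
    using f[of x] abs_Re_le_cmod abs_Im_le_cmod order.trans by blast+
  then show ?thesis
    using expectation_bind_pmf_bounded_real[of "\<lambda>x. Re (f x)" C M K]
      expectation_bind_pmf_bounded_real[of "\<lambda>x. Im (f x)" C M K]
    by (intro complex_eqI) (simp_all add: int intK)
qed

lemma set_pmf_geom_step: "b > 1 \<Longrightarrow> set_pmf (geom_step b x) \<subseteq> {..<x}"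
  by (auto simp: set_pmf_eq pmf_geom_step)

lemma walk_le_start:
  assumes "\<And>k. k \<in> {1..n} \<Longrightarrow> q k > 1" "S \<in> set_pmf (walk q x n)" "i \<le> n"
  shows "S i \<le> x"
  using assms
proof (induction n arbitrary: S i)
  case 0
  then show ?case by simp
next
  case (Suc n)
  from Suc.prems(2) obtain S' v where S': "S' \<in> set_pmf (walk q x n)"
    "v \<in> set_pmf (geom_step (q (Suc n)) (S' n))" "S = S'(Suc n := v)" by auto
  have le: "S' j \<le> x" if "j \<le> n" for j using Suc.IH[OF _ S'(1) that] Suc.prems(1) by auto
  have "v < S' n" using S'(2) set_pmf_geom_step[of "q (Suc n)"] Suc.prems(1)[of "Suc n"] by auto
  then show ?case using le[of n] le[of i] S'(3) Suc.prems(3) by (auto simp: le_Suc_eq)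
qed

lemma hit_props:
  "hit y n S \<le> n" "hit y n S < n \<Longrightarrow> y (Suc (hit y n S)) < S (hit y n S)"
  "i < hit y n S \<Longrightarrow> S i \<le> y (Suc i)"
proof -
  let ?P = "\<lambda>m. m \<le> n \<and> (m = n \<or> S m > y (Suc m))"
  have "?P (hit y n S)" unfolding hit_def by (rule LeastI[of ?P n]) simp
  then show *: "hit y n S \<le> n" and "hit y n S < n \<Longrightarrow> y (Suc (hit y n S)) < S (hit y n S)" by auto
  show "i < hit y n S \<Longrightarrow> S i \<le> y (Suc i)"
    using not_less_Least[of i ?P] * unfolding hit_def by auto
qed

lemma hit_eqI:
  assumes "m \<le> n" "m = n \<or> S m > y (Suc m)" "\<And>i. i < m \<Longrightarrow> S i \<le> y (Suc i)"
  shows "hit y n S = m"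
  unfolding hit_def by (rule Least_equality) (use assms in \<open>force simp: not_le[symmetric]\<close>)+

text \<open>
  Appending one position to the path changes the hitting index only if nothing has been hit before.
\<close>

lemma hit_Suc:
  "hit y (Suc m) (S(Suc m := v)) =
     (if hit y m S < m then hit y m S else if y (Suc m) < S m then m else Suc m)"
proof (cases "hit y m S < m")
  case True
  then show ?thesis
    using hit_props[where y = y and n = m and S = S] by (intro hit_eqI) auto
next
  case False
  then have "hit y m S = m" using hit_props(1)[of y m S] by simp
  then show ?thesis
    using hit_props(3)[where y = y and n = m and S = S] by (intro hit_eqI) (auto simp: less_Suc_eq split: if_splits)
qed

text \<open>
  Optional stopping: stopped at the hitting index, the function \<open>H = epi_fun \<dots>\<close>, multiplied by the remaining
  normalising factors \<open>q l - 1\<close>, is a martingale along the walk. At level \<open>n\<close> it is the stopped payoff,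
  at level \<open>0\<close> it is deterministic.
\<close>

lemma expectation_walk_hit:
  fixes q :: "nat \<Rightarrow> real" and B :: "nat \<Rightarrow> int \<Rightarrow> complex"
  assumes q: "\<And>k. k \<in> {1..n} \<Longrightarrow> q k > 1" and c: "\<And>i. i \<in> {1..n} \<Longrightarrow> c \<le> y i"
  defines "w \<equiv> \<lambda>j. \<Prod>l=Suc j..n. complex_of_real (q l) - 1"
  shows "expect (walk q x n)
      (\<lambda>S. let \<tau> = hit y n S in w \<tau> * B (Suc \<tau>) (S \<tau>) * of_bool (\<tau> < n)) =
    w 0 * epi_fun (\<lambda>i. of_real (q i)) y c B n (\<lambda>_. 0) 0 x"
proof -
  define H where "H = epi_fun (\<lambda>i. complex_of_real (q i)) y c B n (\<lambda>_. 0)"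
  define g where "g j v = (if c < v \<and> v \<le> x then w j * B (Suc j) v else 0)" for j v
  define h where "h j v = (if c < v \<and> v \<le> x then w j * H j v else 0)" for j v
  have H0: "H j v = 0" if "v \<le> c" for j v
    unfolding H_def using that c by (intro epi_fun_vanish) auto
  \<comment> \<open>\<open>g\<close> and \<open>h\<close> are restricted to the range that the walk visits with nonzero payoff; this makes them
    bounded, as the tower property requires.\<close>
  define \<Psi> where "\<Psi> m S = (if hit y m S < m then g (hit y m S) (S (hit y m S)) else h m (S m))" for m S
  define C where "C = (\<Sum>j\<le>n. \<Sum>v\<in>{c<..x}. norm (g j v) + norm (h j v))"
  have C: "norm (g j v) \<le> C" "norm (h j v) \<le> C" if "j \<le> n" for j v
  proof -
    have "norm (g j v) + norm (h j v) \<le> C"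
    proof (cases "c < v \<and> v \<le> x")
      case True
      then have "norm (g j v) + norm (h j v) \<le> (\<Sum>v\<in>{c<..x}. norm (g j v) + norm (h j v))"
        by (intro member_le_sum[of v _ "\<lambda>v. norm (g j v) + norm (h j v)"]) auto
      also have "\<dots> \<le> C" unfolding C_def
        using that by (intro member_le_sum[of j _ "\<lambda>j. \<Sum>v\<in>{c<..x}. norm (g j v) + norm (h j v)"])
          (auto intro!: sum_nonneg)
      finally show ?thesis .
    next
      case False
      then have "g j v = 0" "h j v = 0" by (auto simp: g_def h_def)
      then have "norm (g j v) + norm (h j v) = 0" by simp
      also have "0 \<le> C" unfolding C_def by (intro sum_nonneg) auto
      finally show ?thesis .
    qed
    then show "norm (g j v) \<le> C" "norm (h j v) \<le> C"
      using norm_ge_zero[of "g j v"] norm_ge_zero[of "h j v"] by linarith+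
  qed
  have \<Psi>C: "norm (\<Psi> m S) \<le> C" if "m \<le> n" for m S
    using C that by (simp add: \<Psi>_def)
  have step: "expect (geom_step (q (Suc m)) (S m)) (\<lambda>v. \<Psi> (Suc m) (S(Suc m := v))) = \<Psi> m S"
    if m: "m < n" and S: "S \<in> set_pmf (walk q x m)" for m S
  proof -
    have Sx: "S i \<le> x" if "i \<le> m" for i
      using walk_le_start[OF _ S that] q m by auto
    have qm: "q (Suc m) > 1" using q m by auto
    consider "hit y m S < m" | "hit y m S = m" "y (Suc m) < S m" | "hit y m S = m" "S m \<le> y (Suc m)"
      using hit_props(1)[of y m S] by linarith
    then show ?thesis
    proof cases
      case 1
      then show ?thesis by (simp add: \<Psi>_def hit_Suc)
    next
      case 2
      have "H m (S m) = B (Suc m) (S m)" unfolding H_def using 2 m by (subst epi_fun.simps) simp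
      then show ?thesis using 2 by (simp add: \<Psi>_def hit_Suc g_def h_def)
    next
      case 3
      have "expect (geom_step (q (Suc m)) (S m)) (\<lambda>v. \<Psi> (Suc m) (S(Suc m := v))) =
        expect (geom_step (q (Suc m)) (S m)) (h (Suc m))"
        using 3 by (simp add: \<Psi>_def hit_Suc)
      also have "\<dots> = (\<Sum>v\<in>{c<..<S m}. pmf (geom_step (q (Suc m)) (S m)) v *\<^sub>R h (Suc m) v)"
        using set_pmf_geom_step[OF qm] by (intro integral_measure_pmf) (auto simp: h_def split: if_splits)
      also have "\<dots> = (\<Sum>v\<in>{c<..<S m}. w m * (of_real (q (Suc m)) powi (v - S m) * H (Suc m) v))"
      proof (rule sum.cong[OF refl])
        fix v assume v: "v \<in> {c<..<S m}"
        have "w m = (of_real (q (Suc m)) - 1) * w (Suc m)"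
          unfolding w_def using m by (subst prod.atLeast_Suc_atMost) auto
        then show "pmf (geom_step (q (Suc m)) (S m)) v *\<^sub>R h (Suc m) v =
            w m * (of_real (q (Suc m)) powi (v - S m) * H (Suc m) v)"
          using v Sx[of m] qm by (simp add: pmf_geom_step h_def scaleR_conv_of_real of_real_power_int)
      qed
      also have "\<dots> = w m * H m (S m)"
        unfolding H_def using 3 m by (subst (2) epi_fun.simps) (simp add: sum_distrib_left)
      also have "\<dots> = h m (S m)" using Sx[of m] H0 by (simp add: h_def)
      finally show ?thesis using 3 by (simp add: \<Psi>_def)
    qed
  qed
  have mart: "expect (walk q x m) (\<Psi> m) = \<Psi> 0 (\<lambda>_. x)" if "m \<le> n" for m
    using that
  proof (induction m)
    case 0
    then show ?case by simp
  next
    case (Suc m)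
    have "expect (walk q x (Suc m)) (\<Psi> (Suc m)) =
        expect (walk q x m)
          (\<lambda>S. expect (geom_step (q (Suc m)) (S m)) (\<lambda>v. \<Psi> (Suc m) (S(Suc m := v))))"
      unfolding walk.simps using \<Psi>C Suc.prems
      by (subst expectation_bind_pmf_bounded[where C = C]) auto
    also have "\<dots> = expect (walk q x m) (\<Psi> m)"
      using step Suc.prems by (intro integral_cong_AE) (auto simp: AE_measure_pmf_iff)
    finally show ?case using Suc by simp
  qed
  have "expect (walk q x n)
      (\<lambda>S. let \<tau> = hit y n S in w \<tau> * B (Suc \<tau>) (S \<tau>) * of_bool (\<tau> < n)) =
    expect (walk q x n) (\<Psi> n)"
  proof (rule integral_cong_AE)
    have "(let \<tau> = hit y n S in w \<tau> * B (Suc \<tau>) (S \<tau>) * of_bool (\<tau> < n)) = \<Psi> n S"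
      if "S \<in> set_pmf (walk q x n)" for S
    proof (cases "hit y n S < n")
      case True
      have "S (hit y n S) \<le> x" using walk_le_start[OF _ that hit_props(1)] q by auto
      moreover have "c < S (hit y n S)" using hit_props(2)[OF True] c[of "Suc (hit y n S)"] True by auto
      ultimately show ?thesis using True by (simp add: \<Psi>_def g_def Let_def)
    next
      case False
      then show ?thesis by (simp add: \<Psi>_def h_def H_def epi_fun_terminal)
    qed
    then show "AE S in walk q x n. (let \<tau> = hit y n S in w \<tau> * B (Suc \<tau>) (S \<tau>) * of_bool (\<tau> < n)) = \<Psi> n S"
      by (simp add: AE_measure_pmf_iff)
  qed auto
  also have "\<dots> = h 0 x" using mart[of n] by (simp add: \<Psi>_def)
  also have "\<dots> = w 0 * H 0 x" using H0[of x] by (simp add: h_def)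
  finally show ?thesis unfolding H_def .
qed

context q_contour begin

text \<open>
  The factors \<open>q l - 1\<close> in \<open>Sbar_ker\<close> are those that the walk after the hitting index would have used, so the
  division in \<open>Sbar_epi\<close> removes all of them.
\<close>

lemma Sbar_epi_eq_epi_fun:
  assumes n: "n \<le> N" and c: "\<And>i. i \<in> {1..n} \<Longrightarrow> c \<le> y i"
  shows "Sbar_epi \<Gamma> p q y n r t x x' = epi_fun (\<lambda>i. of_real (q i)) y c (bar n r x') n (\<lambda>_. 0) 0 x"
proof -
  have q: "q k > 1" if "k \<in> {1..n}" for k using q_gt1 n that by auto
  have nz: "(\<Prod>l=1..n. complex_of_real (q l) - 1) \<noteq> 0"
    using q by (force simp: prod_zero_iff)
  show ?thesis
    using expectation_walk_hit[of n q c y x "bar n r x'", OF q c] nz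
    unfolding Sbar_epi_def Sbar_ker_eq_bar_fun by (simp add: field_simps)
qed

end

section \<open>Tameness of the cut kernel\<close>

lemma summable_geometric_half_line:
  fixes \<mu> :: real and N :: nat
  assumes \<mu>: "\<mu> > 1"
  shows "(\<lambda>u. M * \<mu> powi snd u * of_bool (snd u \<le> b)) summable_on ({1..N} \<times> (UNIV :: int set))"
proof -
  have g: "(\<lambda>k. \<mu> powi b * (1 / \<mu>) ^ k) summable_on (UNIV :: nat set)"
    using \<mu> by (intro summable_on_cmult_right norm_summable_imp_summable_on) (simp add: summable_geometric norm_power)
  have "(\<lambda>x. \<mu> powi x * of_bool (x \<le> b)) summable_on {..b} \<longleftrightarrow> (\<lambda>k. \<mu> powi b * (1 / \<mu>) ^ k) summable_on (UNIV :: nat set)"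
    using \<mu> by (intro summable_on_reindex_bij_witness[of _ "\<lambda>k. b - int k" "\<lambda>x. nat (b - x)"])
      (auto simp: power_int_diff power_one_over field_simps nat_diff_distrib power_int_of_nat[symmetric] simp del: power_int_of_nat)
  then have s: "(\<lambda>x. \<mu> powi x * of_bool (x \<le> b)) summable_on UNIV"
    using g by (subst summable_on_cong_neutral[of "{..b}" UNIV]) auto
  have "(\<lambda>u. norm (M * \<mu> powi snd u * of_bool (snd u \<le> b))) summable_on ({1..N} \<times> (UNIV :: int set))"
  proof (rule Infinite_Sum.abs_summable_on_Sigma_iff[where f = "\<lambda>u. M * \<mu> powi snd u * of_bool (snd u \<le> b)"
        and A = "{1..N}" and B = "\<lambda>_. UNIV", THEN iffD2],
      intro conjI ballI)
    show "(\<lambda>y. norm (M * \<mu> powi snd (x, y) * of_bool (snd (x, y) \<le> b))) summable_on UNIV" for x :: nat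
      using summable_on_cmult_right[OF s, of "\<bar>M\<bar>"] \<mu> by (simp add: abs_mult mult.assoc power_int_abs)
  qed simp
  then show ?thesis by (rule abs_summable_summable)
qed

text \<open>
  With \<open>\<mu> > 1\<close> such that \<open>\<rho> = \<mu> ^ Suc N\<close> is below all \<open>q k\<close>, the conjugating weight at \<open>(l, x)\<close> is
  \<open>\<mu> powi ((Suc N - l) * x)\<close>. Its rate decreases with the label, which gives decay along the rows of the part
  \<open>- Q_range\<close>, where the label increases; and it stays below \<open>\<rho>\<close>, so the decay of \<open>F\<close> in the second
  variable survives. The rows of \<open>F\<close> are confined to the finite range \<open>{c<..b}\<close>, which provides the exceptional
  rows.
\<close>

lemma tame_kernel_cut:
  fixes F :: "nat \<times> int \<Rightarrow> nat \<times> int \<Rightarrow> complex"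
  assumes q: "\<And>k. k \<in> {1..N} \<Longrightarrow> q k > (1 :: real)"
    and ch: "\<And>l x. norm (ch (l, x)) \<le> 1" "\<And>l x. b < x \<Longrightarrow> ch (l, x) = 0"
    and X: "X \<subseteq> {1..N} \<times> UNIV"
    and F0: "\<And>l x n x'. l \<in> {1..N} \<Longrightarrow> n \<in> {1..N} \<Longrightarrow> x \<le> c \<Longrightarrow> F (l, x) (n, x') = 0"
    and Fd: "\<And>l x n \<rho>. l \<in> {1..N} \<Longrightarrow> n \<in> {1..N} \<Longrightarrow> \<rho> > 0 \<Longrightarrow> (\<And>k. k \<in> {1..N} \<Longrightarrow> \<rho> < q k) \<Longrightarrow>
      decays \<rho> b (\<lambda>x'. F (l, x) (n, x'))"
    and b: "b \<ge> 0"
  shows "tame_kernel (cut_ker ch (\<lambda>(l, x) (n, x'). - Q_range q l n x x' * of_bool (n > l) + F (l, x) (n, x'))) X"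
proof -
  define K where "K = (\<lambda>(l, x) (n, x'). - Q_range q l n x x' * of_bool (n > l) + F (l, x) (n, x'))"
  define q0 where "q0 = Min (insert 2 (q ` {1..N}))"
  have q0: "q0 > 1" using q by (auto simp: q0_def)
  define \<rho> where "\<rho> = (1 + q0) / 2"
  have \<rho>: "1 < \<rho>" "\<rho> < q0" using q0 by (auto simp: \<rho>_def)
  have \<rho>q: "\<rho> < q k" if "k \<in> {1..N}" for k
  proof -
    have "q0 \<le> q k" unfolding q0_def using that by (intro Min_le) auto
    then show ?thesis using \<rho> by simp
  qed
  define \<mu> where "\<mu> = root (Suc N) \<rho>"
  have \<mu>1: "\<mu> > 1" using \<rho> by (simp add: \<mu>_def)
  have \<mu>\<rho>: "\<rho> powi z = \<mu> powi (int (Suc N) * z)" for z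
  proof -
    have "\<rho> = \<mu> ^ Suc N" using \<rho> by (simp add: \<mu>_def del: power_Suc)
    then show ?thesis by (metis power_int_mult power_int_of_nat)
  qed
  have mono: "\<mu> powi i \<le> \<mu> powi j" if "i \<le> j" for i j using \<mu>1 that by (intro power_int_increasing) auto
  have "\<exists>CQ\<ge>0. \<forall>x z. norm (Q_range q l n x z) \<le> CQ * \<rho> powi (z - x)" if "l \<in> {1..N}" "n \<in> {1..N}" "l < n" for l n
    using \<rho> \<rho>q that by (intro Q_range_decay) auto
  then obtain CQ where CQ: "\<And>l n. l \<in> {1..N} \<Longrightarrow> n \<in> {1..N} \<Longrightarrow> l < n \<Longrightarrow> 0 \<le> CQ l n"
    "\<And>l n x z. l \<in> {1..N} \<Longrightarrow> n \<in> {1..N} \<Longrightarrow> l < n \<Longrightarrow> norm (Q_range q l n x z) \<le> CQ l n * \<rho> powi (z - x)"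
    by metis
  have ex: "\<exists>C. \<forall>x'\<le>b. norm (F (l, x) (n, x')) \<le> C * \<rho> powi x'" if "l \<in> {1..N}" "n \<in> {1..N}" for l x n
    using Fd[OF that, of \<rho> x] \<rho> \<rho>q by (simp add: decays_def)
  define CF where "CF l x n = (SOME C. \<forall>x'\<le>b. norm (F (l, x) (n, x')) \<le> C * \<rho> powi x')" for l x n
  have CF: "\<And>l x n x'. l \<in> {1..N} \<Longrightarrow> n \<in> {1..N} \<Longrightarrow> x' \<le> b \<Longrightarrow> norm (F (l, x) (n, x')) \<le> CF l x n * \<rho> powi x'"
    using someI_ex[OF ex] unfolding CF_def by blast
  define C1 where "C1 = (\<Sum>l\<in>{1..N}. \<Sum>n\<in>{1..N}. \<bar>CQ l n\<bar>)"
  define C2 where "C2 = (\<Sum>l\<in>{1..N}. \<Sum>n\<in>{1..N}. \<Sum>x\<in>{c<..b}. \<bar>CF l x n\<bar>)"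
  have C1: "CQ l n \<le> C1" if "l \<in> {1..N}" "n \<in> {1..N}" for l n
  proof -
    have "\<bar>CQ l n\<bar> \<le> (\<Sum>n\<in>{1..N}. \<bar>CQ l n\<bar>)" using that by (intro member_le_sum) auto
    also have "\<dots> \<le> C1" unfolding C1_def using that by (intro member_le_sum) (auto intro: sum_nonneg)
    finally show ?thesis by simp
  qed
  have C2: "CF l x n \<le> C2" if "l \<in> {1..N}" "n \<in> {1..N}" "c < x" "x \<le> b" for l n x
  proof -
    have "\<bar>CF l x n\<bar> \<le> (\<Sum>x\<in>{c<..b}. \<bar>CF l x n\<bar>)" using that by (intro member_le_sum) auto
    also have "\<dots> \<le> (\<Sum>n\<in>{1..N}. \<Sum>x\<in>{c<..b}. \<bar>CF l x n\<bar>)" using that by (intro member_le_sum) (auto intro: sum_nonneg)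
    also have "\<dots> \<le> C2" unfolding C2_def using that by (intro member_le_sum) (auto intro!: sum_nonneg)
    finally show ?thesis by simp
  qed
  have C0: "0 \<le> C1" "0 \<le> C2" by (auto simp: C1_def C2_def intro!: sum_nonneg)
  \<comment> \<open>An upper bound for what remains of the exponents of \<open>\<mu>\<close> in both parts.\<close>
  define e where "e = 2 * int N * b"
  define M where "M = (C1 + C2) * \<mu> powi e"
  define g where "g u = \<mu> powi ((int (Suc N) - int (fst u)) * snd u)" for u :: "nat \<times> int"
  define h where "h u = M * \<mu> powi snd u * of_bool (snd u \<le> b)" for u :: "nat \<times> int"
  have bound: "norm (cut_ker ch K u v) * g u \<le> h u * g v" if u: "u \<in> X" and v: "v \<in> X" for u v
  proof -
    obtain l x n x' where uv: "u = (l, x)" "v = (n, x')" by fastforce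
    have ln: "l \<in> {1..N}" "n \<in> {1..N}" using u v uv X by auto
    have hg: "0 \<le> h u * g v" using C0 \<mu>1 by (simp add: h_def g_def M_def)
    show ?thesis
    proof (cases "x \<le> b \<and> x' \<le> b")
      case False
      then have "cut_ker ch K u v = 0" using ch(2) by (auto simp: uv cut_ker_def not_le)
      then show ?thesis using hg by simp
    next
      case True
      define d where "d = e + x + (int (Suc N) - int n) * x'"
      define y where "y = norm (Q_range q l n x x' * of_bool (n > l))"
      have "norm (cut_ker ch K u v) \<le> norm (K u v)"
      proof -
        have "norm (ch u) * norm (K u v) * norm (ch v) \<le> 1 * norm (K u v) * 1"
          using ch(1) uv by (intro mult_mono) auto
        then show ?thesis by (simp add: cut_ker_def norm_mult)
      qed
      also have "\<dots> \<le> y + norm (F u v)"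
        unfolding K_def y_def uv by (simp, metis norm_minus_commute norm_triangle_ineq4 norm_minus_cancel diff_minus_eq_add add.commute uminus_add_conv_diff norm_mult)
      finally have "norm (cut_ker ch K u v) * g u \<le> y * g u + norm (F u v) * g u"
        using \<mu>1 by (simp add: g_def distrib_right[symmetric])
      also have "y * g u \<le> C1 * \<mu> powi d"
      proof (cases "l < n \<and> x' < x")
        case True
        then have "int n * x' \<le> int n * x" by (intro mult_left_mono) auto
        moreover have "(int n - int l - 1) * x \<le> (int n - int l - 1) * b"
          using \<open>l < n \<and> x' < x\<close> \<open>x \<le> b \<and> x' \<le> b\<close> by (intro mult_left_mono) auto
        moreover have "(int n - int l - 1) * b \<le> e" unfolding e_def using b ln by (intro mult_right_mono) auto
        ultimately have ex: "int (Suc N) * (x' - x) + (int (Suc N) - int l) * x \<le> d"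
          unfolding d_def by (simp add: algebra_simps)
        have "y * g u \<le> (CQ l n * \<rho> powi (x' - x)) * g u"
          using CQ(2)[OF ln, of x x'] True \<mu>1 by (intro mult_right_mono) (auto simp: y_def g_def)
        also have "\<dots> = CQ l n * \<mu> powi (int (Suc N) * (x' - x) + (int (Suc N) - int l) * x)"
          using \<mu>1 by (simp add: \<mu>\<rho> g_def uv power_int_add)
        also have "\<dots> \<le> C1 * \<mu> powi d"
          using C1[OF ln] mono[OF ex] C0 \<mu>1 by (intro mult_mono) auto
        finally show ?thesis .
      next
        case False
        then have "y = 0" using Q_range_not_above[of l n x x' q] by (auto simp: y_def)
        then show ?thesis using C0 \<mu>1 by simp
      qed
      also have "norm (F u v) * g u \<le> C2 * \<mu> powi d"
      proof (cases "c < x")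
        case cx: True
        have "int n * x' \<le> int n * b" "int n * b \<le> int N * b"
          using True ln b by (auto intro!: mult_left_mono mult_right_mono)
        moreover have "(int N - int l) * x \<le> (int N - int l) * b" "(int N - int l) * b \<le> int N * b"
          using True ln b by (auto intro!: mult_left_mono mult_right_mono)
        ultimately have ex: "int (Suc N) * x' + (int (Suc N) - int l) * x \<le> d"
          unfolding d_def e_def by (simp add: algebra_simps)
        have "norm (F u v) * g u \<le> (CF l x n * \<rho> powi x') * g u"
          using CF[OF ln, of x' x] True \<mu>1 by (intro mult_right_mono) (auto simp: uv g_def)
        also have "\<dots> = CF l x n * \<mu> powi (int (Suc N) * x' + (int (Suc N) - int l) * x)"
          using \<mu>1 by (simp add: \<mu>\<rho> g_def uv power_int_add)
        also have "\<dots> \<le> C2 * \<mu> powi d"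
          using C2[OF ln cx] True mono[OF ex] C0 \<mu>1 by (intro mult_mono) auto
        finally show ?thesis .
      next
        case False
        then have "F u v = 0" using F0[OF ln] by (simp add: uv)
        then show ?thesis using C0 \<mu>1 by simp
      qed
      also have "C1 * \<mu> powi d + C2 * \<mu> powi d = h u * g v"
      proof -
        have "\<mu> powi (e + x + z) = \<mu> powi e * \<mu> powi x * \<mu> powi z" for z
          using \<mu>1 by (simp add: power_int_add)
        then have "C1 * \<mu> powi (e + x + z) + C2 * \<mu> powi (e + x + z) = M * \<mu> powi x * \<mu> powi z" for z
          unfolding M_def by (simp only:) (simp only: distrib_right mult.assoc)
        then show ?thesis using True by (simp add: h_def g_def uv d_def)
      qed
      finally show ?thesis by simp
    qed
  qed
  show ?thesis
    unfolding tame_kernel_def K_def[symmetric]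
  proof (intro conjI)
    show "countable X" by (rule countable_subset[OF X]) auto
    have "h summable_on X" unfolding h_def
      by (rule summable_on_subset_banach[OF summable_geometric_half_line[OF \<mu>1] X])
    moreover have "0 < g u \<and> 0 \<le> h u" for u using C0 \<mu>1 by (simp add: g_def h_def M_def)
    ultimately show "\<exists>g h. (\<forall>u\<in>X. 0 < g u \<and> 0 \<le> h u) \<and> h summable_on X \<and>
        (\<forall>u\<in>X. \<forall>v\<in>X. norm (cut_ker ch K u v) * g u \<le> h u * g v)"
      using bound by (intro exI[of _ g] exI[of _ h]) auto
    have "u \<in> {1..N} \<times> {c<..b} \<or> fst u < fst v"
      if uv: "u \<in> X" "v \<in> X" "cut_ker ch K u v \<noteq> 0" for u v
    proof (rule ccontr)
      assume neg: "\<not> ?thesis"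
      obtain l x n x' where uv': "u = (l, x)" "v = (n, x')" by fastforce
      have ln: "l \<in> {1..N}" "n \<in> {1..N}" using uv uv' X by auto
      have "x \<le> b" using uv(3) ch(2)[of x l] by (auto simp: uv' cut_ker_def not_le[symmetric])
      then have "x \<le> c" "\<not> l < n" using neg ln by (auto simp: uv')
      then show False using uv(3) F0[OF ln] by (simp add: uv' cut_ker_def K_def)
    qed
    then show "\<exists>(lab :: nat \<times> int \<Rightarrow> nat) b R. finite R \<and> (\<forall>u\<in>X. lab u \<le> b) \<and>
        (\<forall>u\<in>X. \<forall>v\<in>X. cut_ker ch K u v \<noteq> 0 \<longrightarrow> u \<in> R \<or> lab u < lab v)"
      using X by (intro exI[of _ fst] exI[of _ N] exI[of _ "{1..N} \<times> {c<..b}"]) auto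
  qed
qed

section \<open>Kernels of partially moved configurations\<close>

context q_contour begin

abbreviation "qc \<equiv> \<lambda>i. complex_of_real (q i)"
abbreviation "pc \<equiv> \<lambda>i. complex_of_real (p i)"

abbreviation epi_from :: "(nat \<Rightarrow> int) \<Rightarrow> int \<Rightarrow> nat \<Rightarrow> nat \<Rightarrow> int \<Rightarrow> nat \<Rightarrow> int \<Rightarrow> complex" where
  "epi_from y c r n x' \<equiv> epi_fun qc y c (bar n r x') n (\<lambda>_. 0)"

abbreviation epi_between :: "(nat \<Rightarrow> int) \<Rightarrow> int \<Rightarrow> nat \<Rightarrow> nat \<Rightarrow> nat \<Rightarrow> int \<Rightarrow> int \<Rightarrow> complex" where
  "epi_between y c r k n x' \<equiv>
     epi_mid qc y c (bar n r x') (bar n (Suc r) x') (pc (Suc r)) n k"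

abbreviation jump_between :: "(nat \<Rightarrow> int) \<Rightarrow> int \<Rightarrow> nat \<Rightarrow> nat \<Rightarrow> nat \<Rightarrow> int \<Rightarrow> complex" where
  "jump_between y c r k n x' \<equiv>
     jump qc y c (bar n r x') (bar n (Suc r) x') (pc (Suc r)) n k"

text \<open>
  The kernel of the theorem for a system that starts from \<open>y\<close> at time \<open>r\<close>, with all integrals written as
  difference operators.
\<close>

definition K_from :: "(nat \<Rightarrow> int) \<Rightarrow> int \<Rightarrow> nat \<Rightarrow> nat \<times> int \<Rightarrow> nat \<times> int \<Rightarrow> complex" where
  "K_from y c r = (\<lambda>(l, x) (n, x'). - Q_range q l n x x' * of_bool (n > l) +
     Dall qc l (Uall pc r t (epi_from y c r n x' 0)) x)"

text \<open>
  The kernel when particles \<open>1..k\<close> are already at time \<open>r + 1\<close>. The outer operators contain only the times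
  after \<open>r + 1\<close>; the missing \<open>Uop\<close> sits inside \<open>epi_mid\<close>, at level \<open>k\<close>.
\<close>

definition K_mid :: "(nat \<Rightarrow> int) \<Rightarrow> int \<Rightarrow> nat \<Rightarrow> nat \<Rightarrow> nat \<times> int \<Rightarrow> nat \<times> int \<Rightarrow> complex" where
  "K_mid y c r k = (\<lambda>(l, x) (n, x'). - Q_range q l n x x' * of_bool (n > l) +
     Dall qc l (Uall pc (Suc r) t(epi_between y c r k n x')) x)"

text \<open>
  The operator \<open>Uop\<close> at level \<open>0\<close> is the innermost of the outer operators of \<open>K_from\<close>.
\<close>

lemma K_mid_0: "r < t \<Longrightarrow> K_mid y c r 0 = K_from y c r"
  by (simp add: K_mid_def K_from_def fun_eq_iff epi_mid_def epi_fun_terminal Uall_step)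

lemma K_mid_last:
  assumes "n \<le> k"
  shows "K_mid y c r k (l, x) (n, x') = K_from y c (Suc r) (l, x) (n, x')"
proof -
  have "Uop (pc (Suc r)) (\<lambda>_. 0) = (\<lambda>_. 0)" by (simp add: Uop_def fun_eq_iff)
  then show ?thesis using assms by (simp add: K_mid_def K_from_def epi_mid_def epi_fun_terminal min_absorb2)
qed

lemma K_ker_eq_K_from:
  assumes \<Gamma>0: "ccw_contour \<Gamma>0 {0} {}" and n: "n \<le> N" and c: "\<And>i. i \<in> {1..N} \<Longrightarrow> c \<le> y i"
  shows "K_ker \<Gamma>0 \<Gamma> p q y t (l, x) (n, x') = K_from y c 0 (l, x) (n, x')"
proof -
  have "(S_ker \<Gamma>0 p q 1 l 0 t \<circ>\<^sub>K Sbar_epi \<Gamma> p q y n 0 t) x x' =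
      Dall qc l (Uall pc 0 t (epi_from y c 0 n x' 0)) x"
  proof -
    have "Sbar_epi \<Gamma> p q y n 0 t v x' = epi_from y c 0 n x' 0 v" for v
      using n c by (intro Sbar_epi_eq_epi_fun) auto
    then show ?thesis
      unfolding kcomp_def by (simp only:) (rule infsumI[OF S_ker_has_sum[OF \<Gamma>0 le0]])
  qed
  then show ?thesis by (simp add: K_ker_def K_from_def)
qed

lemma bernoulli_weight_nz:
  assumes "r < t" "k \<in> {1..N}"
  shows "1 + pc (Suc r) * qc k \<noteq> 0"
proof -
  have "p (Suc r) > 0" "q k > 1" using p_pos q_gt1 assms by auto
  then have "1 + p (Suc r) * q k > 0" by (intro add_pos_pos mult_pos_pos) auto
  then have "complex_of_real (1 + p (Suc r) * q k) \<noteq> 0" by (simp only: of_real_eq_0_iff)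
  then show ?thesis by simp
qed

lemma epi_between_step:
  assumes r: "r < t" and k: "k \<in> {1..N}" and n: "n \<in> {1..N}"
    and c: "\<And>i. i \<in> {1..N} \<Longrightarrow> c \<le> y i"
    and y: "\<And>i j. 1 \<le> i \<Longrightarrow> i < j \<Longrightarrow> j \<le> N \<Longrightarrow> y j < y i"
  shows "epi_between y c r (k - 1) n x' v = epi_between y c r k n x' v +
      pc (Suc r) * qc k / (1 + pc (Suc r) * qc k) * (reach qc y c k v * - jump_between y c r k n x')" (is ?before)
    and "epi_between (y(k := y k + 1)) c r k n x' v =
      epi_between y c r k n x' v + reach qc y c k v * - jump_between y c r k n x'" (is ?moved)
proof -
  have qn: "qc i \<noteq> 0" if "i \<in> {1..n}" for i using q_gt1[of i] that n by auto
  have c': "c \<le> y i" if "i \<in> {1..n}" for i using c[of i] that n by auto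
  have y': "y j < y i" if "1 \<le> i" "i < j" "j \<le> n" for i j using y[of i j] that n by auto
  have b0: "Dop (qc j) (bar n r x' j) v = (if j < n then bar n r x' (Suc j) v else 0)"
    if "j \<in> {1..n}" for j v using bar_fun_Dop[of j n r] n that by auto
  have b1: "bar n (Suc r) x' j v = Uop (pc (Suc r)) (bar n r x' j) v"
    if "j \<in> {1..n}" for j v using bar_fun_Uop[of j n r] n r that by auto
  have k1: "1 \<le> k" using k by simp
  note step = epi_mid_step[of n qc c y "bar n r x'" "bar n (Suc r) x'" "pc (Suc r)" k v,
      OF qn c' y' b0 b1 k1 bernoulli_weight_nz[OF r k]]
  show ?before by (rule step(1))
  show ?moved by (rule step(2))
qed

end

locale cut_q_contour = q_contour +
  fixes ch :: "nat \<times> int \<Rightarrow> complex" and X :: "(nat \<times> int) set" and b :: int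
  assumes ch_le: "norm (ch (l, x)) \<le> 1" and ch_0: "b < x \<Longrightarrow> ch (l, x) = 0"
    and X: "X \<subseteq> {1..N} \<times> UNIV" and b_nonneg: "0 \<le> b"
begin

abbreviation "det_from y c r \<equiv> fredholm_det (cut_ker ch (K_from y c r)) X"
abbreviation "det_mid y c r k \<equiv> fredholm_det (cut_ker ch (K_mid y c r k)) X"

lemma tame_cut:
  assumes G0: "\<And>n x' v. n \<in> {1..N} \<Longrightarrow> v \<le> c \<Longrightarrow> G n x' v = 0"
    and Gd: "\<And>n v \<rho>. n \<in> {1..N} \<Longrightarrow> \<rho> > 0 \<Longrightarrow> (\<And>k. k \<in> {1..N} \<Longrightarrow> \<rho> < q k) \<Longrightarrow>
      decays \<rho> b (\<lambda>x'. G n x' v)"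
  shows "tame_kernel (cut_ker ch (\<lambda>(l, x) (n, x'). - Q_range q l n x x' * of_bool (n > l) +
    Dall qc l (Uall pc r t (G n x')) x)) X"
proof -
  define F where "F = (\<lambda>(l, x) (n, x'). Dall qc l (Uall pc r t (G n x')) x)"
  have "tame_kernel (cut_ker ch (\<lambda>(l, x) (n, x'). - Q_range q l n x x' * of_bool (n > l) + F (l, x) (n, x'))) X"
  proof (rule tame_kernel_cut[where N = N and b = b and c = "c - int N"])
    fix l x n x' assume ln: "l \<in> {1..N}" "n \<in> {1..N}" "x \<le> c - int N"
    have "Uall pc r t (G n x') v = 0" if "v \<le> c" for v
      using G0[OF ln(2)] that by (rule Uall_vanish)
    then show "F (l, x) (n, x') = 0" unfolding F_def using ln by (auto intro!: Dall_vanish[where c = c])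
  next
    fix l x n \<rho> assume "n \<in> {1..N}" "\<rho> > 0" "\<And>k. k \<in> {1..N} \<Longrightarrow> \<rho> < q k"
    then show "decays \<rho> b (\<lambda>x'. F (l, x) (n, x'))"
      unfolding F_def prod.case by (intro decays_Dall decays_Uall Gd)
  qed (use q_gt1 ch_le ch_0 X b_nonneg in auto)
  then show ?thesis by (simp add: F_def)
qed

lemma tame_K_from:
  assumes c: "\<And>i. i \<in> {1..N} \<Longrightarrow> c \<le> y i"
  shows "tame_kernel (cut_ker ch (K_from y c r)) X"
  unfolding K_from_def
proof (rule tame_cut)
  show "epi_from y c r n x' 0 v = 0" if "n \<in> {1..N}" "v \<le> c" for n x' v
    using that c by (intro epi_fun_vanish) auto
  show "decays \<rho> b (\<lambda>x'. epi_from y c r n x' 0 v)"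
    if "n \<in> {1..N}" "\<rho> > 0" "\<And>k. k \<in> {1..N} \<Longrightarrow> \<rho> < q k" for n v \<rho>
    by (intro decays_epi_fun bar_fun_decays decays_0) (use that in auto)
qed

lemma tame_K_mid:
  assumes c: "\<And>i. i \<in> {1..N} \<Longrightarrow> c \<le> y i"
  shows "tame_kernel (cut_ker ch (K_mid y c r k)) X"
  unfolding K_mid_def
proof (rule tame_cut)
  fix n x' v assume n: "n \<in> {1..N}" and v: "v \<le> c"
  have "epi_from y c r n x' (min k n) v = 0" if "v \<le> c" for v
    using that c n by (intro epi_fun_vanish) auto
  then have "Uop (pc (Suc r)) (epi_from y c r n x' (min k n)) v = 0" if "v \<le> c" for v
    using that by (simp add: Uop_def)
  then show "epi_between y c r k n x' v = 0"
    unfolding epi_mid_def using v c n by (intro epi_fun_vanish) auto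
next
  show "decays \<rho> b (\<lambda>x'. epi_between y c r k n x' v)"
    if "n \<in> {1..N}" "\<rho> > 0" "\<And>k. k \<in> {1..N} \<Longrightarrow> \<rho> < q k" for n v \<rho>
    unfolding epi_mid_def by (intro decays_epi_fun decays_Uop bar_fun_decays decays_0) (use that in auto)
qed

text \<open>
  By \<open>epi_between_step\<close> the three kernels lie on a line of rank one; its direction is the product of
  \<open>reach\<close>, a function of the row, and \<open>jump\<close>, a function of the column.
\<close>

lemma fredholm_det_increment:
  assumes r: "r < t" and k: "k \<in> {1..N}" and c: "\<And>i. i \<in> {1..N} \<Longrightarrow> c \<le> y i"
    and y: "\<And>i j. 1 \<le> i \<Longrightarrow> i < j \<Longrightarrow> j \<le> N \<Longrightarrow> y j < y i"
  defines "a \<equiv> pc (Suc r) * qc k / (1 + pc (Suc r) * qc k)"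
  shows "det_mid y c r (k - 1) =
    (1 - a) * det_mid y c r k +
    a * det_mid (y(k := y k + 1)) c r k"
proof -
  let ?y' = "y(k := y k + 1)"
  let ?R = "reach qc y c k"
  define J where "J n x' = - jump_between y c r k n x'" for n x'
  define x where "x u = ch u * Dall qc (fst u) (Uall pc (Suc r) t ?R) (snd u)" for u
  define w where "w v = J (fst v) (snd v) * ch v" for v
  have G: "epi_between y c r (k - 1) n x' = (\<lambda>v. epi_between y c r k n x' v + (a * J n x') * ?R v)" (is ?G)
    "epi_between ?y' c r k n x' = (\<lambda>v. epi_between y c r k n x' v + J n x' * ?R v)" (is ?G')
    if n: "n \<in> {1..N}" for n x'
  proof -
    note step = epi_between_step[of r k n c y x', OF r k n c y]
    show ?G by (rule ext, subst step(1)) (auto simp: J_def a_def algebra_simps)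
    show ?G' by (rule ext, subst step(2)) (auto simp: J_def algebra_simps)
  qed
  show ?thesis
  proof (rule fredholm_det_rank_one_affine[where x = x and w = w])
    show "tame_kernel (cut_ker ch (K_mid y c r k)) X" by (rule tame_K_mid[OF c])
    show "tame_kernel (cut_ker ch (K_mid ?y' c r k)) X"
    proof (rule tame_K_mid)
      show "c \<le> ?y' i" if "i \<in> {1..N}" for i using c[OF that] by auto
    qed
    fix u v assume "u \<in> X" "v \<in> X"
    then obtain l xx n xx' where uv: "u = (l, xx)" "v = (n, xx')" "n \<in> {1..N}" using X by (cases u, cases v) auto
    show "cut_ker ch (K_mid ?y' c r k) u v = cut_ker ch (K_mid y c r k) u v + x u * w v"
      unfolding uv cut_ker_def K_mid_def prod.case G[OF uv(3)] Uall_linear Dall_linear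
      by (simp add: x_def w_def algebra_simps)
    show "cut_ker ch (K_mid y c r (k - 1)) u v = cut_ker ch (K_mid y c r k) u v + a * (x u * w v)"
      unfolding uv cut_ker_def K_mid_def prod.case G[OF uv(3)] Uall_linear Dall_linear
      by (simp add: x_def w_def algebra_simps)
  qed
qed

lemma K_mid_blocked:
  assumes r: "r < t" and k: "k \<in> {2..N}" and c: "\<And>i. i \<in> {1..N} \<Longrightarrow> c \<le> y i"
    and y: "\<And>i j. 1 \<le> i \<Longrightarrow> i < j \<Longrightarrow> j \<le> N \<Longrightarrow> y j < y i" and yk: "y k = y (k - 1) - 1"
    and n: "n \<in> {1..N}"
  shows "K_mid (y(k := y k + 1)) c r k (l, x) (n, x') = K_mid y c r k (l, x) (n, x')"
proof -
  have k1: "k \<in> {1..N}" "2 \<le> k" using k by simp_all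
  have "epi_between (y(k := y k + 1)) c r k n x' v = epi_between y c r k n x' v" for v
    using epi_between_step(2)[of r k n c y x' v, OF r k1(1) n c y]
      reach_blocked[where q = qc and c = c and v = v, OF k1(2) yk] by simp
  then show ?thesis unfolding K_mid_def by (simp cong: if_cong) presburger
qed

end

section \<open>The final determinant and the moves of a single particle\<close>

lemma chi_bound:
  obtains b :: int where "0 \<le> b" "\<And>l x. b < x \<Longrightarrow> chi m \<kappa> s (l, x) = 0" "\<And>l x. norm (chi m \<kappa> s (l, x)) \<le> 1"
proof
  let ?b = "Max (insert 0 ((\<lambda>i. \<lceil>s i\<rceil>) ` {1..m}))"
  show "0 \<le> ?b" by (intro Max_ge) auto
  show "chi m \<kappa> s (l, x) = 0" if x: "?b < x" for l x
  proof -
    have "\<not> real_of_int x < s i" if "i \<in> {1..m}" for i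
    proof -
      have "\<lceil>s i\<rceil> \<le> ?b" using that by (intro Max_ge) auto
      then show ?thesis using x by linarith
    qed
    then show ?thesis by (auto simp: chi_def)
  qed
  show "norm (chi m \<kappa> s (l, x)) \<le> 1" for l x by (simp add: chi_def)
qed

context q_contour begin

text \<open>
  A particle \<open>\<kappa> i\<close> with \<open>y (\<kappa> i) < s i\<close> is called violating here. If there is none, all rows lie below the
  curve, and \<open>Dall_epi_fun_below\<close> shows that \<open>K_from\<close> is strictly upper triangular. Otherwise let \<open>n\<close> be the
  last violating label. The column of \<open>(n, y n)\<close> is a unit vector: rows with label at most \<open>n\<close> are given by
  \<open>Dall_epi_fun_column\<close>, and rows with larger label lie below the curve since \<open>n\<close> is the last one.
\<close>

lemma fredholm_det_final:
  assumes \<kappa>: "strict_mono_on {1..m} \<kappa>" "\<kappa> ` {1..m} \<subseteq> {1..N}"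
    and c: "\<And>i. i \<in> {1..N} \<Longrightarrow> c < y i"
    and y: "\<And>i j. 1 \<le> i \<Longrightarrow> i < j \<Longrightarrow> j \<le> N \<Longrightarrow> y j < y i"
  shows "fredholm_det (cut_ker (chi m \<kappa> s) (K_from y c t)) (\<kappa> ` {1..m} \<times> UNIV) =
    of_bool (\<forall>i\<in>{1..m}. s i \<le> real_of_int (y (\<kappa> i)))"
proof -
  let ?X = "\<kappa> ` {1..m} \<times> UNIV :: (nat \<times> int) set"
  let ?H = "\<lambda>n x'. epi_fun qc y c (bar n t x') n (\<lambda>_. 0)"
  have qn: "qc i \<noteq> 0" if "i \<in> {1..n}" "n \<in> {1..N}" for i n using q_gt1[of i] that by auto
  have cn: "c < y i" if "i \<in> {1..n}" "n \<in> {1..N}" for i n using c[of i] that by auto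
  have yn: "y j < y i" if "1 \<le> i" "i < j" "j \<le> n" "n \<in> {1..N}" for i j n using y[of i j] that by auto
  have Brec: "Dop (qc j) (bar n t x' j) v = (if j < n then bar n t x' (Suc j) v else 0)"
    if "j \<in> {1..n}" "n \<in> {1..N}" for j n x' v
    using bar_fun_Dop[of j n t] that by auto
  have below: "Dall qc l (?H n x' 0) x = ?H n x' l x"
    if "n \<in> {1..N}" "l \<in> {1..N}" "x < y l" for n l x x'
  proof (rule Dall_epi_fun_below)
    show "y j < y i" if "1 \<le> i" "i < j" "j \<le> N" for i j using y that by blast
    show "c \<le> y i" if "i \<in> {1..n}" for i using cn[OF that \<open>n \<in> {1..N}\<close>] by simp
  qed (use that qn Brec in auto)
  have chi_1: "\<exists>i\<in>{1..m}. fst u = \<kappa> i \<and> real_of_int (snd u) < s i" if "chi m \<kappa> s u \<noteq> 0" for u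
    using that by (cases u) (auto simp: chi_def)
  show ?thesis
  proof (cases "\<forall>i\<in>{1..m}. s i \<le> real_of_int (y (\<kappa> i))")
    case True
    have "fredholm_det (cut_ker (chi m \<kappa> s) (K_from y c t)) ?X = 1"
    proof (rule fredholm_det_upper[of _ fst N])
      show "fst u \<le> N" if "u \<in> ?X" for u using that \<kappa>(2) by auto
      fix u v assume uv: "u \<in> ?X" "v \<in> ?X" "cut_ker (chi m \<kappa> s) (K_from y c t) u v \<noteq> 0"
      obtain l x n x' where uv': "u = (l, x)" "v = (n, x')" by (cases u, cases v)
      have ln: "l \<in> {1..N}" "n \<in> {1..N}" using uv uv' \<kappa>(2) by auto
      have "chi m \<kappa> s (l, x) \<noteq> 0" using uv(3) by (simp add: cut_ker_def uv')
      then obtain i where i: "i \<in> {1..m}" "l = \<kappa> i" "real_of_int x < s i" using chi_1[of "(l, x)"] by auto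
      then have xl: "x < y l" using True by force
      show "fst u < fst v"
      proof (rule ccontr)
        assume "\<not> fst u < fst v"
        then have "n \<le> l" by (simp add: uv')
        then have "K_from y c t (l, x) (n, x') = 0"
          using below[OF ln(2,1) xl, of x'] by (simp add: K_from_def epi_fun_terminal)
        then show False using uv(3) by (simp add: cut_ker_def uv')
      qed
    qed
    then show ?thesis using True by simp
  next
    case False
    define V where "V = {i \<in> {1..m}. real_of_int (y (\<kappa> i)) < s i}"
    have "finite V" by (simp add: V_def)
    moreover have "V \<noteq> {}"
    proof -
      obtain i where "i \<in> {1..m}" "\<not> s i \<le> real_of_int (y (\<kappa> i))" using False by blast
      then have "i \<in> V" by (simp add: V_def)
      then show ?thesis by blast
    qed
    ultimately obtain i0 where i0: "i0 \<in> V" "\<And>i. i \<in> V \<Longrightarrow> i \<le> i0"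
      using Max_in[of V] Max_ge[of V] by blast
    then have i0': "i0 \<in> {1..m}" "real_of_int (y (\<kappa> i0)) < s i0" by (simp_all add: V_def)
    define n where "n = \<kappa> i0"
    have n: "n \<in> {1..N}" "n \<in> \<kappa> ` {1..m}" using i0' \<kappa>(2) unfolding n_def by blast+
    have not_viol: "s i \<le> real_of_int (y (\<kappa> i))" if "i \<in> {1..m}" "n < \<kappa> i" for i
    proof (rule ccontr)
      assume "\<not> ?thesis"
      then have "i \<le> i0" using that i0(2)[of i] by (simp add: V_def)
      then have "\<kappa> i \<le> n" unfolding n_def using \<kappa>(1) that i0'(1)
        by (cases "i = i0") (auto simp: monotone_on_def intro: less_imp_le)
      then show False using that by simp
    qed
    define c0 where "c0 = (n, y n)"
    obtain b where b: "0 \<le> b" "\<And>l x. b < x \<Longrightarrow> chi m \<kappa> s (l, x) = 0" "\<And>l x. norm (chi m \<kappa> s (l, x)) \<le> 1"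
      using chi_bound[of m \<kappa> s] by blast
    interpret cut_q_contour \<Gamma> p q N t "chi m \<kappa> s" ?X b
      by unfold_locales (use b \<kappa>(2) in auto)
    have "fredholm_det (cut_ker (chi m \<kappa> s) (K_from y c t)) ?X = 0"
    proof (rule fredholm_det_unit_column[of _ _ c0])
      show "tame_kernel (cut_ker (chi m \<kappa> s) (K_from y c t)) ?X"
        using c by (intro tame_K_from) (auto intro: less_imp_le)
      show "c0 \<in> ?X" using n by (auto simp: c0_def)
      have chi_c0: "chi m \<kappa> s c0 = 1" using i0' by (auto simp: chi_def c0_def n_def)
      have n1: "1 \<le> n" using n by simp
      have Rn: "Q_range q j n v (y n) = (\<Sum>u\<in>{c<..<v}. qc (Suc j) powi (u - v) * Q_range q (Suc j) n u (y n))"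
        if "j < n - 1" for j v
      proof -
        have "Q_range q j n v (y n) = (\<Sum>u\<in>{y n - 1<..<v}. qc (Suc j) powi (u - v) * Q_range q (Suc j) n u (y n))"
          using that by (intro Q_range_sum) auto
        also have "\<dots> = (\<Sum>u\<in>{c<..<v}. qc (Suc j) powi (u - v) * Q_range q (Suc j) n u (y n))"
        proof (rule sum.mono_neutral_left)
          show "{y n - 1<..<v} \<subseteq> {c<..<v}" using c[of n] n by auto
        qed (use that Q_range_below[of "Suc j" n _ "y n" q] in auto)
        finally show ?thesis .
      qed
      have diag: "bar n t (y n) n (y n) = 1" using bar_fun_diagonal[of n n] n by simp
      have above: "bar n t (y n) (Suc j) v = Q_range q j n v (y n)" if "j < n" "y n < v" for j v
        using bar_fun_eq_Q_range[of "Suc j" n "y n" v] n that by simp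
      have zero: "Q_range q j n v (y n) = 0" if "j < n" "v \<le> y n" for j v
        using that by (rule Q_range_not_above)
      note column = Dall_epi_fun_column[of n qc c y "bar n t (y n)" "\<lambda>j v. Q_range q j n v (y n)",
          OF qn[OF _ n(1)] cn[OF _ n(1)] yn[OF _ _ _ n(1)] n1 Brec[OF _ n(1)] diag above zero Rn]
      fix u assume u: "u \<in> ?X"
      obtain l x where ul: "u = (l, x)" by (cases u)
      have l: "l \<in> {1..N}" using u ul \<kappa>(2) by auto
      show "cut_ker (chi m \<kappa> s) (K_from y c t) u c0 = of_bool (u = c0)"
      proof (cases "chi m \<kappa> s u = 0")
        case True
        then show ?thesis using chi_c0 by (auto simp: cut_ker_def)
      next
        case False
        then have chi_u: "chi m \<kappa> s u = 1" by (auto simp: chi_def split: prod.splits)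
        obtain i where i: "i \<in> {1..m}" "l = \<kappa> i" "real_of_int x < s i" using chi_1[OF False] ul by auto
        have "K_from y c t (l, x) (n, y n) = of_bool (l = n \<and> x = y n)"
        proof -
          consider "l < n" | "l = n" | "n < l" by linarith
          then show ?thesis
          proof cases
            case 1
            then show ?thesis using column(2)[of l x] by (simp add: K_from_def)
          next
            case 2
            then show ?thesis using column(3)[of x] by (simp add: K_from_def)
          next
            case 3
            then have "x < y l" using not_viol[of i] i by force
            then show ?thesis using 3 below[OF n(1) l, of x "y n"] by (simp add: K_from_def epi_fun_terminal)
          qed
        qed
        then show ?thesis using chi_c0 chi_u by (simp add: cut_ker_def ul c0_def)
      qed
    qed
    then show ?thesis using False by simp
  qed
qed

end

definition move :: "(nat \<Rightarrow> int) \<Rightarrow> nat \<Rightarrow> int \<Rightarrow> nat \<Rightarrow> int" where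
  "move y k w = y(k := if k = 1 then y k + w else min (y (k - 1) - 1) (y k + w))"

text \<open>
  The bound \<open>c\<close> is the cutoff of \<open>epi_fun\<close>. Particles never move to the left, so one cutoff serves for all times.
\<close>

definition ordered_above :: "nat \<Rightarrow> int \<Rightarrow> (nat \<Rightarrow> int) \<Rightarrow> bool" where
  "ordered_above N c y \<longleftrightarrow> (\<forall>i\<in>{1..N}. c < y i) \<and> (\<forall>i j. 1 \<le> i \<longrightarrow> i < j \<longrightarrow> j \<le> N \<longrightarrow> y j < y i)"

lemma ordered_above_move:
  assumes y: "ordered_above N c y" and k: "k \<in> {1..N}" and w: "0 \<le> w"
  shows "ordered_above N c (move y k w)"
proof -
  have up: "y k \<le> move y k w k"
  proof (cases "k = 1")
    case False
    then have "1 \<le> k - 1" "k - 1 < k" "k \<le> N" using k by auto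
    then have "y k < y (k - 1)" using y unfolding ordered_above_def by blast
    then show ?thesis using w by (simp add: move_def)
  qed (use w in \<open>simp add: move_def\<close>)
  have down: "move y k w k < y i" if "1 \<le> i" "i < k" for i
  proof -
    have "y (k - 1) \<le> y i"
    proof (cases "i = k - 1")
      case False
      then have "i < k - 1" "k - 1 \<le> N" using that k by auto
      then have "y (k - 1) < y i" using y that(1) unfolding ordered_above_def by blast
      then show ?thesis by simp
    qed simp
    then show ?thesis using that by (simp add: move_def)
  qed
  have other: "move y k w i = y i" if "i \<noteq> k" for i using that by (simp add: move_def)
  have "c < move y k w i" if "i \<in> {1..N}" for i
  proof -
    have "c < y i" using y that unfolding ordered_above_def by blast
    then show ?thesis using up other[of i] by (cases "i = k") auto
  qed
  moreover have "move y k w j < move y k w i" if ij: "1 \<le> i" "i < j" "j \<le> N" for i j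
  proof -
    have lt: "y j < y i" using y ij unfolding ordered_above_def by blast
    consider "i = k" | "j = k" | "i \<noteq> k" "j \<noteq> k" by blast
    then show ?thesis
    proof cases
      case 1
      then show ?thesis using other[of j] ij up lt by simp
    next
      case 2
      then show ?thesis using other[of i] ij down[of i] by simp
    qed (use other[of i] other[of j] lt in auto)
  qed
  ultimately show ?thesis by (auto simp: ordered_above_def)
qed

definition jump_weight :: "(nat \<Rightarrow> real) \<Rightarrow> (nat \<Rightarrow> real) \<Rightarrow> nat \<Rightarrow> nat \<Rightarrow> int \<Rightarrow> real" where
  "jump_weight p q r k w = (if w = 1 then p r * q k / (1 + p r * q k) else 1 / (1 + p r * q k))"

context cut_q_contour begin

text \<open>
  An unblocked particle moves with the Bernoulli weights of \<open>fredholm_det_increment\<close>. A blocked particle stays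
  in both cases, and by \<open>K_mid_blocked\<close> the kernel of the virtual position \<open>y k + 1\<close> is that of \<open>y\<close>.
\<close>

lemma fredholm_det_move:
  assumes r: "r < t" and k: "k \<in> {1..N}" and y: "ordered_above N c y"
  shows "det_mid y c r (k - 1) =
    (\<Sum>w\<in>{0, 1}. of_real (jump_weight p q (Suc r) k w) * det_mid (move y k w) c r k)"
proof -
  define a where "a = pc (Suc r) * qc k / (1 + pc (Suc r) * qc k)"
  have cy: "c \<le> y i" if "i \<in> {1..N}" for i using y that by (auto simp: ordered_above_def intro: less_imp_le)
  have yy: "y j < y i" if "1 \<le> i" "i < j" "j \<le> N" for i j using y that by (auto simp: ordered_above_def)
  have "p (Suc r) > 0" using p_pos r by auto
  moreover have "q k > 1" using q_gt1 k by auto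
  ultimately have pq: "1 + p (Suc r) * q k > 0" by (intro add_pos_pos mult_pos_pos) auto
  have w1: "of_real (jump_weight p q (Suc r) k 1) = a" by (simp add: jump_weight_def a_def)
  have "jump_weight p q (Suc r) k 0 = 1 - jump_weight p q (Suc r) k 1"
    using pq by (simp add: jump_weight_def field_simps)
  then have w0: "of_real (jump_weight p q (Suc r) k 0) = 1 - a" using w1 by simp
  have u0: "move y k 0 = y"
  proof (cases "k = 1")
    case False
    then have "y k < y (k - 1)" using yy[of "k - 1" k] k by auto
    then show ?thesis by (simp add: move_def)
  qed (simp add: move_def)
  have "det_mid (move y k 1) c r k = det_mid (y(k := y k + 1)) c r k"
  proof (cases "2 \<le> k \<and> y k = y (k - 1) - 1")
    case True
    then have k2: "k \<in> {2..N}" and yk: "y k = y (k - 1) - 1" using k by auto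
    have "move y k 1 = y" using True by (intro ext) (auto simp: move_def)
    moreover have "det_mid (y(k := y k + 1)) c r k = det_mid y c r k"
    proof (rule fredholm_cong)
      fix u v assume "u \<in> X" "v \<in> X"
      then obtain l x n x' where uv: "u = (l, x)" "v = (n, x')" "n \<in> {1..N}" using X by (cases u, cases v) auto
      show "cut_ker ch (K_mid (y(k := y k + 1)) c r k) u v = cut_ker ch (K_mid y c r k) u v"
        using K_mid_blocked[OF r k2 cy yy yk uv(3)] by (simp add: cut_ker_def uv)
    qed
    ultimately show ?thesis by simp
  next
    case False
    have "move y k 1 = y(k := y k + 1)"
    proof (cases "k = 1")
      case nk: False
      then have "y k < y (k - 1)" using yy[of "k - 1" k] k by auto
      then show ?thesis using nk False k by (auto simp: move_def)
    qed (simp add: move_def)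
    then show ?thesis by simp
  qed
  then show ?thesis
    using fredholm_det_increment[OF r k cy yy] w0 w1 u0 by (simp add: a_def)
qed

text \<open>
  All elementary moves in one sequence: the index \<open>i = r * N + k\<close> means that particles \<open>1..k\<close> have made the move of
  time \<open>r + 1\<close>.
\<close>

definition step_det :: "int \<Rightarrow> (nat \<Rightarrow> int) \<Rightarrow> nat \<Rightarrow> complex" where
  "step_det c y i = (if i mod N = 0 then det_from y c (i div N)
     else det_mid y c (i div N) (i mod N))"

lemma step_det_average:
  assumes i: "i < t * N" and y: "ordered_above N c y"
  shows "step_det c y i = (\<Sum>w\<in>{0, 1}. of_real (jump_weight p q (Suc (i div N)) (Suc (i mod N)) w) * step_det c (move y (Suc (i mod N)) w) (Suc i))"
proof -
  have N: "N > 0" using i by (cases N) auto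
  have r: "i div N < t" using i N by (simp add: less_mult_imp_div_less)
  have k: "Suc (i mod N) \<in> {1..N}" using N by (simp add: Suc_leI)
  have now: "step_det c y i = det_mid y c (i div N) (i mod N)"
    using K_mid_0[OF r] by (simp add: step_det_def)
  have next_step: "step_det c z (Suc i) = det_mid z c (i div N) (Suc (i mod N))" for z
  proof (cases "Suc (i mod N) = N")
    case True
    have "det_from z c (Suc (i div N)) = det_mid z c (i div N) N"
    proof (rule fredholm_cong)
      fix u v assume "u \<in> X" "v \<in> X"
      then obtain l x n x' where uv: "u = (l, x)" "v = (n, x')" "n \<le> N" using X by (cases u, cases v) auto
      show "cut_ker ch (K_from z c (Suc (i div N))) u v = cut_ker ch (K_mid z c (i div N) N) u v"
        using K_mid_last[OF uv(3)] by (simp add: cut_ker_def uv)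
    qed
    then show ?thesis using True by (simp add: step_det_def mod_Suc div_Suc)
  next
    case False
    then show ?thesis by (simp add: step_det_def mod_Suc div_Suc)
  qed
  show ?thesis unfolding now next_step using fredholm_det_move[OF r k y] by simp
qed

end

primrec state :: "nat \<Rightarrow> (nat \<Rightarrow> int) \<Rightarrow> (nat \<Rightarrow> int) \<Rightarrow> nat \<Rightarrow> nat \<Rightarrow> int" where
  "state N y w 0 = y"
| "state N y w (Suc i) = move (state N y w i) (Suc (i mod N)) (w i)"

lemma sum_PiE_lessThan_Suc:
  "(\<Sum>w\<in>{..<Suc n} \<rightarrow>\<^sub>E B. f w) = (\<Sum>w\<in>{..<n} \<rightarrow>\<^sub>E B. \<Sum>b\<in>B. f (w(n := b)))"
proof -
  have move: "(restrict w {..<n})(n := w n) = w" if "w \<in> {..<Suc n} \<rightarrow>\<^sub>E B" for w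
    using that by (auto simp: PiE_iff fun_eq_iff extensional_def less_Suc_eq)
  have res: "restrict (w(n := b)) {..<n} = w" if "w \<in> {..<n} \<rightarrow>\<^sub>E B" for w b
    using that by (auto simp: PiE_iff fun_eq_iff extensional_def)
  have "(\<Sum>w\<in>{..<Suc n} \<rightarrow>\<^sub>E B. f w) = (\<Sum>(w, b)\<in>({..<n} \<rightarrow>\<^sub>E B) \<times> B. f (w(n := b)))"
  proof (rule sum.reindex_bij_witness[of _ "\<lambda>(w, b). w(n := b)" "\<lambda>w. (restrict w {..<n}, w n)"])
    fix w assume w: "w \<in> {..<Suc n} \<rightarrow>\<^sub>E B"
    then have "restrict w {..<n} \<in> {..<n} \<rightarrow>\<^sub>E B" "w n \<in> B" by (auto simp: PiE_iff)
    then show "(restrict w {..<n}, w n) \<in> ({..<n} \<rightarrow>\<^sub>E B) \<times> B" by blast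
    show "(case (restrict w {..<n}, w n) of (w, b) \<Rightarrow> w(n := b)) = w" using move[OF w] by simp
    then show "(case (restrict w {..<n}, w n) of (w, b) \<Rightarrow> f (w(n := b))) = f w" by simp
  next
    fix wb assume "wb \<in> ({..<n} \<rightarrow>\<^sub>E B) \<times> B"
    then obtain w b where wb: "wb = (w, b)" "w \<in> {..<n} \<rightarrow>\<^sub>E B" "b \<in> B" by blast
    show "(case wb of (w, b) \<Rightarrow> w(n := b)) \<in> {..<Suc n} \<rightarrow>\<^sub>E B"
      unfolding wb(1) prod.case lessThan_Suc by (rule PiE_fun_upd[OF wb(3,2)])
    show "(restrict (case wb of (w, b) \<Rightarrow> w(n := b)) {..<n}, (case wb of (w, b) \<Rightarrow> w(n := b)) n) = wb"
      unfolding wb(1) prod.case by (simp only: res[OF wb(2)] fun_upd_same)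
  qed
  then show ?thesis by (simp add: sum.cartesian_product)
qed

lemma state_cong: "(\<And>i. i < n \<Longrightarrow> w i = w' i) \<Longrightarrow> state N y w n = state N y w' n"
  by (induction n) auto

lemma ordered_above_state:
  assumes "ordered_above N c y" "\<And>i. i < n \<Longrightarrow> 0 \<le> w i" "0 < N"
  shows "ordered_above N c (state N y w n)"
  using assms(2)
proof (induction n)
  case (Suc n)
  have "ordered_above N c (state N y w n)" using Suc.prems by (intro Suc.IH) simp
  moreover have "Suc (n mod N) \<in> {1..N}" using assms(3) by (simp add: Suc_leI)
  ultimately show ?case using Suc.prems[of n] by (simp add: ordered_above_move)
qed (simp add: assms)

context cut_q_contour begin

text \<open>
  The martingale property, summed over all noise sequences.
\<close>

lemma step_det_expectation:
  assumes y: "ordered_above N c y" and n: "n \<le> t * N" and N: "0 < N"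
  shows "(\<Sum>w\<in>{..<n} \<rightarrow>\<^sub>E {0, 1}. of_real (\<Prod>i<n. jump_weight p q (Suc (i div N)) (Suc (i mod N)) (w i)) *
      step_det c (state N y w n) n) = step_det c y 0"
  using n
proof (induction n)
  case 0
  then show ?case by simp
next
  case (Suc n)
  let ?wt = "\<lambda>i b. jump_weight p q (Suc (i div N)) (Suc (i mod N)) b"
  let ?f = "\<lambda>w. of_real (\<Prod>i<Suc n. ?wt i (w i)) * step_det c (state N y w (Suc n)) (Suc n)"
  have "(\<Sum>w\<in>{..<Suc n} \<rightarrow>\<^sub>E {0, 1}. ?f w) = (\<Sum>w\<in>{..<n} \<rightarrow>\<^sub>E {0, 1}. \<Sum>b\<in>{0, 1}. ?f (w(n := b)))"
    by (rule sum_PiE_lessThan_Suc)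
  also have "\<dots> = (\<Sum>w\<in>{..<n} \<rightarrow>\<^sub>E {0, 1}. of_real (\<Prod>i<n. ?wt i (w i)) * step_det c (state N y w n) n)"
  proof (rule sum.cong[OF refl])
    fix w :: "nat \<Rightarrow> int" assume w: "w \<in> {..<n} \<rightarrow>\<^sub>E {0, 1}"
    have "\<And>i. i < n \<Longrightarrow> 0 \<le> w i" using w by (force simp: PiE_iff)
    then have ord: "ordered_above N c (state N y w n)" using y N by (intro ordered_above_state)
    have st: "state N y (w(n := b)) n = state N y w n" for b by (rule state_cong) simp
    have "(\<Prod>i<n. ?wt i ((w(n := b)) i)) = (\<Prod>i<n. ?wt i (w i))" for b by (intro prod.cong) auto
    then have "?f (w(n := b)) = of_real (\<Prod>i<n. ?wt i (w i)) *
        (of_real (?wt n b) * step_det c (move (state N y w n) (Suc (n mod N)) b) (Suc n))" for b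
      by (simp add: st)
    then have "(\<Sum>b\<in>{0, 1}. ?f (w(n := b))) = of_real (\<Prod>i<n. ?wt i (w i)) *
        (\<Sum>b\<in>{0, 1}. of_real (?wt n b) * step_det c (move (state N y w n) (Suc (n mod N)) b) (Suc n))"
      by (simp only: sum_distrib_left)
    then show "(\<Sum>b\<in>{0, 1}. ?f (w(n := b))) = of_real (\<Prod>i<n. ?wt i (w i)) * step_det c (state N y w n) n"
      using step_det_average[OF _ ord, of n] Suc.prems by simp
  qed
  also have "\<dots> = step_det c y 0" using Suc by simp
  finally show ?case .
qed

end

section \<open>The particle system\<close>

context
  fixes M :: "'a measure" and N :: nat and p q :: "nat \<Rightarrow> real" and y :: "nat \<Rightarrow> int"
    and W Y :: "nat \<Rightarrow> nat \<Rightarrow> 'a \<Rightarrow> int"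
  assumes dtasep: "dTASEP M N p q y W Y" and N: "0 < N"
    and pos: "\<And>l k. 1 \<le> l \<Longrightarrow> k \<in> {1..N} \<Longrightarrow> 0 < p l * q k"
begin

definition noise :: "'a \<Rightarrow> nat \<Rightarrow> int" where
  "noise \<omega> i = W (Suc (i div N)) (Suc (i mod N)) \<omega>"

abbreviation "wt i \<equiv> jump_weight p q (Suc (i div N)) (Suc (i mod N))"

lemma particle_index_mem: "Suc (i mod N) \<in> {1..N}"
  using N by (simp add: Suc_leI)

text \<open>
  When particle \<open>k\<close> moves, particle \<open>k - 1\<close> has already moved, as in the definition of the dynamics.
\<close>

lemma state_noise:
  assumes \<omega>: "\<omega> \<in> space M"
  shows "i \<in> {1..N} \<Longrightarrow> state N y (noise \<omega>) (r * N) i = Y r i \<omega>"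
proof (induction r arbitrary: i)
  case 0
  then show ?case using dtasep \<omega> by (simp add: dTASEP_def)
next
  case (Suc r)
  have "state N y (noise \<omega>) (r * N + k) i = (if i \<le> k then Y (Suc r) i \<omega> else Y r i \<omega>)"
    if "k \<le> N" "i \<in> {1..N}" for k i
    using that
  proof (induction k arbitrary: i)
    case 0
    then show ?case using Suc.IH by simp
  next
    case (Suc k)
    have kN: "k < N" using Suc.prems by simp
    have md: "(r * N + k) mod N = k" "(r * N + k) div N = r" using kN by (simp_all add: div_mult_self3)
    define z where "z = state N y (noise \<omega>) (r * N + k)"
    have z: "z j = (if j \<le> k then Y (Suc r) j \<omega> else Y r j \<omega>)" if "j \<in> {1..N}" for j
      unfolding z_def using Suc.IH[of j] that kN by simp
    have st: "state N y (noise \<omega>) (r * N + Suc k) = move z (Suc k) (W (Suc r) (Suc k) \<omega>)"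
      using md by (simp add: noise_def z_def)
    have dyn: "Y (Suc r) (Suc k) \<omega> = (if Suc k = 1 then Y r (Suc k) \<omega> + W (Suc r) (Suc k) \<omega>
        else min (Y (Suc r) k \<omega> - 1) (Y r (Suc k) \<omega> + W (Suc r) (Suc k) \<omega>))"
    proof -
      have "\<forall>t\<ge>1. \<forall>k\<in>{1..N}. Y t k \<omega> = (if k = 1 then Y (t - 1) k \<omega> + W t k \<omega>
                   else min (Y t (k - 1) \<omega> - 1) (Y (t - 1) k \<omega> + W t k \<omega>))"
        using dtasep \<omega> unfolding dTASEP_def by blast
      then have "Y (Suc r) (Suc k) \<omega> = (if Suc k = 1 then Y (Suc r - 1) (Suc k) \<omega> + W (Suc r) (Suc k) \<omega>
                   else min (Y (Suc r) (Suc k - 1) \<omega> - 1) (Y (Suc r - 1) (Suc k) \<omega> + W (Suc r) (Suc k) \<omega>))"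
        using kN by (elim allE[of _ "Suc r"] impE ballE[of _ _ "Suc k"]) auto
      then show ?thesis by simp
    qed
    show ?case
    proof (cases "i = Suc k")
      case True
      have "z (Suc k) = Y r (Suc k) \<omega>" using z[of "Suc k"] kN by simp
      moreover have "z k = Y (Suc r) k \<omega>" if "k \<noteq> 0" using z[of k] kN that by simp
      ultimately show ?thesis unfolding st True using dyn by (cases "k = 0") (simp_all add: move_def)
    next
      case False
      then show ?thesis unfolding st using z[OF Suc.prems(2)] by (auto simp: move_def)
    qed
  qed
  from this[of N i] Suc.prems show ?case by (simp add: add.commute)
qed

lemma noise_measurable: "(\<lambda>\<omega>. noise \<omega> i) \<in> measurable M (count_space UNIV)"
proof -
  interpret prob_space M using dtasep by (simp add: dTASEP_def)
  have iv: "indep_vars (\<lambda>_. count_space UNIV) (\<lambda>(t, k). W t k) ({1..} \<times> {1..N})"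
    using dtasep by (simp add: dTASEP_def)
  have "(Suc (i div N), Suc (i mod N)) \<in> {1..} \<times> {1..N}" using particle_index_mem by simp
  then have "(case (Suc (i div N), Suc (i mod N)) of (t, k) \<Rightarrow> W t k) \<in> measurable M (count_space UNIV)"
    using iv unfolding indep_vars_def by blast
  then show ?thesis by (simp add: noise_def)
qed

lemma state_measurable: "(\<lambda>\<omega>. state N y (noise \<omega>) n i) \<in> measurable M (count_space UNIV)"
proof (induction n arbitrary: i)
  case (Suc n)
  have comp: "(\<lambda>\<omega>. h (f \<omega>) (g \<omega>)) \<in> measurable M (count_space UNIV)"
    if "f \<in> measurable M (count_space UNIV)" "g \<in> measurable M (count_space UNIV)"
    for f g :: "'a \<Rightarrow> int" and h :: "int \<Rightarrow> int \<Rightarrow> int"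
  proof (rule measurable_compose_countable[OF _ that(1)])
    fix a
    have "(\<lambda>x. h a x) \<in> measurable (count_space UNIV) (count_space UNIV)" by simp
    from measurable_compose[OF that(2) this] show "(\<lambda>\<omega>. h a (g \<omega>)) \<in> measurable M (count_space UNIV)" .
  qed
  show ?case
    unfolding state.simps move_def
    using comp[OF Suc.IH noise_measurable, of "(+)"]
      comp[OF Suc.IH comp[OF Suc.IH noise_measurable, of "(+)"], of "\<lambda>a b. min (a - 1) b"] Suc.IH
    by (simp add: fun_upd_def)
qed simp

lemma prob_noise:
  assumes w: "w \<in> {..<n} \<rightarrow>\<^sub>E {0, 1}"
  shows "measure M {\<omega> \<in> space M. \<forall>i<n. noise \<omega> i = w i} = (\<Prod>i<n. wt i (w i))"
proof -
  interpret prob_space M using dtasep by (simp add: dTASEP_def)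
  have iv: "indep_vars (\<lambda>_. count_space UNIV) (\<lambda>(t, k). W t k) ({1..} \<times> {1..N})"
    using dtasep by (simp add: dTASEP_def)
  have law: "prob {\<omega> \<in> space M. W l k \<omega> = b} = jump_weight p q l k b" if "1 \<le> l" "k \<in> {1..N}" "b \<in> {0, 1}" for l k b
    using dtasep that by (auto simp: dTASEP_def jump_weight_def)
  define e where "e i = (Suc (i div N), Suc (i mod N))" for i
  have inj: "inj e"
    by (rule injI) (metis Pair_inject Suc_inject e_def div_mult_mod_eq)
  show ?thesis
  proof (cases "n = 0")
    case True
    then show ?thesis by (simp add: prob_space)
  next
    case False
    define A where "A tk = {w (inv_into UNIV e tk)}" for tk
    have Ae: "A (e i) = {w i}" for i using inj by (simp add: A_def)
    have "{\<omega> \<in> space M. \<forall>i<n. noise \<omega> i = w i} =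
       (\<Inter>tk\<in>e ` {..<n}. (case tk of (t, k) \<Rightarrow> W t k) -` A tk \<inter> space M)"
      using False Ae by (auto simp: noise_def e_def)
    also have "prob \<dots> = (\<Prod>tk\<in>e ` {..<n}. prob ((case tk of (t, k) \<Rightarrow> W t k) -` A tk \<inter> space M))"
    proof (rule indep_varsD[OF iv])
      show "e ` {..<n} \<subseteq> {1..} \<times> {1..N}" using particle_index_mem by (auto simp: e_def)
    qed (use False in auto)
    also have "\<dots> = (\<Prod>i<n. prob ((case e i of (t, k) \<Rightarrow> W t k) -` A (e i) \<inter> space M))"
      using inj by (subst prod.reindex) (auto intro: inj_on_subset)
    also have "\<dots> = (\<Prod>i<n. wt i (w i))"
    proof (rule prod.cong[OF refl])
      fix i assume "i \<in> {..<n}"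
      then have "w i \<in> {0, 1}" using w by (auto simp: PiE_iff)
      then have "prob {\<omega> \<in> space M. W (Suc (i div N)) (Suc (i mod N)) \<omega> = w i} = wt i (w i)"
        using particle_index_mem by (intro law) auto
      also have "{\<omega> \<in> space M. W (Suc (i div N)) (Suc (i mod N)) \<omega> = w i} =
          (case e i of (t, k) \<Rightarrow> W t k) -` A (e i) \<inter> space M"
        unfolding Ae by (auto simp: e_def)
      finally show "prob ((case e i of (t, k) \<Rightarrow> W t k) -` A (e i) \<inter> space M) = wt i (w i)" .
    qed
    finally show ?thesis .
  qed
qed

text \<open>
  The noise takes values in \<open>{0, 1}\<close> almost surely, since the weights of these sequences add up to one.
\<close>

lemma prob_state:
  fixes \<Phi> :: "(nat \<Rightarrow> int) \<Rightarrow> bool"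
  assumes meas: "{\<omega> \<in> space M. \<Phi> (state N y (noise \<omega>) n)} \<in> sets M"
  shows "measure M {\<omega> \<in> space M. \<Phi> (state N y (noise \<omega>) n)} =
    (\<Sum>w\<in>{..<n} \<rightarrow>\<^sub>E {0, 1}. (\<Prod>i<n. wt i (w i)) * of_bool (\<Phi> (state N y w n)))"
proof -
  interpret prob_space M using dtasep by (simp add: dTASEP_def)
  let ?P = "{..<n} \<rightarrow>\<^sub>E {0, 1} :: (nat \<Rightarrow> int) set"
  define E where "E w = {\<omega> \<in> space M. \<forall>i<n. noise \<omega> i = w i}" for w
  have finP: "finite ?P" by (intro finite_PiE) auto
  have Em: "E w \<in> sets M" for w
  proof -
    have "E w = {\<omega> \<in> space M. \<forall>i\<in>{..<n}. noise \<omega> i = w i}" by (auto simp: E_def)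
    also have "\<dots> \<in> sets M"
    proof (intro sets.sets_Collect_finite_All)
      fix i
      have "(\<lambda>\<omega>. noise \<omega> i) -` {w i} \<inter> space M \<in> sets M"
        by (rule measurable_sets[OF noise_measurable]) simp
      also have "(\<lambda>\<omega>. noise \<omega> i) -` {w i} \<inter> space M = {\<omega> \<in> space M. noise \<omega> i = w i}" by auto
      finally show "{\<omega> \<in> space M. noise \<omega> i = w i} \<in> sets M" .
    qed simp
    finally show ?thesis .
  qed
  have disj: "disjoint_family_on E A" if "A \<subseteq> ?P" for A
    unfolding disjoint_family_on_def
  proof (intro ballI impI)
    fix w w' assume "w \<in> A" "w' \<in> A" "w \<noteq> w'"
    then have "w \<in> ?P" "w' \<in> ?P" using that by auto
    then obtain i where "i < n" "w i \<noteq> w' i"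
      using PiE_ext[of w "{..<n}" "\<lambda>_. {0, 1}" w'] \<open>w \<noteq> w'\<close> by (metis lessThan_iff)
    then show "E w \<inter> E w' = {}" by (auto simp: E_def)
  qed
  have pE: "prob (E w) = (\<Prod>i<n. wt i (w i))" if "w \<in> ?P" for w
    unfolding E_def by (rule prob_noise[OF that])
  have "prob (\<Union>w\<in>?P. E w) = (\<Sum>w\<in>?P. \<Prod>i<n. wt i (w i))"
    using finP Em disj pE by (subst finite_measure_finite_Union) auto
  also have "\<dots> = (\<Prod>i<n. \<Sum>b\<in>{0, 1}. wt i b)" by (rule prod_sum_PiE[symmetric]) auto
  also have "\<dots> = 1"
  proof (rule prod.neutral, rule ballI)
    fix i
    have "0 < p (Suc (i div N)) * q (Suc (i mod N))" using pos particle_index_mem by simp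
    then show "(\<Sum>b\<in>{0, 1}. wt i b) = 1" by (simp add: jump_weight_def add_divide_distrib[symmetric])
  qed
  finally have one: "prob (\<Union>w\<in>?P. E w) = 1" .
  define A where "A = {\<omega> \<in> space M. \<Phi> (state N y (noise \<omega>) n)}"
  define U where "U = (\<Union>w\<in>?P. E w)"
  have Um: "U \<in> sets M" unfolding U_def using finP Em by (intro sets.finite_UN) auto
  have "AE \<omega> in M. \<omega> \<in> U" using prob_eq_1[OF Um] one by (simp add: U_def)
  then have "AE \<omega> in M. \<omega> \<in> A \<longleftrightarrow> \<omega> \<in> A \<inter> U" by eventually_elim simp
  then have "prob A = prob (A \<inter> U)"
    by (rule finite_measure_eq_AE) (use meas Um in \<open>simp_all add: A_def sets.Int\<close>)
  also have "A \<inter> U = (\<Union>w\<in>{w \<in> ?P. \<Phi> (state N y w n)}. E w)"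
  proof -
    have st: "state N y (noise \<omega>) n = state N y w n" "\<omega> \<in> space M" if "\<omega> \<in> E w" for \<omega> w
    proof -
      show "state N y (noise \<omega>) n = state N y w n"
        by (rule state_cong) (use that in \<open>simp add: E_def\<close>)
      show "\<omega> \<in> space M" using that by (simp add: E_def)
    qed
    have "\<omega> \<in> A \<longleftrightarrow> \<Phi> (state N y w n)" if "\<omega> \<in> E w" for \<omega> w
      unfolding A_def using st[OF that] by simp
    then show ?thesis unfolding U_def by blast
  qed
  also have "prob \<dots> = (\<Sum>w\<in>{w \<in> ?P. \<Phi> (state N y w n)}. prob (E w))"
    using finP Em disj by (intro finite_measure_finite_Union) auto
  also have "\<dots> = (\<Sum>w\<in>{w \<in> ?P. \<Phi> (state N y w n)}. \<Prod>i<n. wt i (w i))"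
    using pE by (intro sum.cong) auto
  also have "\<dots> = (\<Sum>w\<in>?P. (\<Prod>i<n. wt i (w i)) * of_bool (\<Phi> (state N y w n)))"
    using finP by (simp add: sum.inter_filter of_bool_def if_distrib cong: if_cong)
  finally show ?thesis unfolding A_def .
qed

end

theorem theorem1p1:
  fixes M :: "'a measure" and N m t :: nat
    and p q :: "nat \<Rightarrow> real" and y :: "nat \<Rightarrow> int"
    and W Y :: "nat \<Rightarrow> nat \<Rightarrow> 'a \<Rightarrow> int"
    and \<kappa> :: "nat \<Rightarrow> nat" and s :: "nat \<Rightarrow> real"
    and \<Gamma>0 \<Gamma>q :: "real \<Rightarrow> complex"
  assumes "N \<ge> 2"
    and "\<And>l. l \<ge> 1 \<Longrightarrow> p l > 0"
    and "\<And>k. k \<in> {1..N} \<Longrightarrow> q k > 0"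
    and "strict_antimono_on {1..N} y"
    and "dTASEP M N p q y W Y"
    and "\<And>k l. k \<in> {1..N} \<Longrightarrow> l \<ge> 1 \<Longrightarrow> q k * p l < 1"
    and "\<And>k. k \<in> {1..N} \<Longrightarrow> q k > 1"
    and "strict_mono_on {1..m} \<kappa>" and "\<kappa> ` {1..m} \<subseteq> {1..N}"
    and "ccw_contour \<Gamma>0 {0} {}"
    and "ccw_contour \<Gamma>q ((\<lambda>k. of_real (q k)) ` {1..N})
           (insert 0 ((\<lambda>l. - inverse (of_real (p l))) ` {1..t}))"
  shows "fredholm_converges (cut_ker (chi m \<kappa> s) (K_ker \<Gamma>0 \<Gamma>q p q y t)) (\<kappa> ` {1..m} \<times> UNIV) \<and>
         complex_of_real
           \<P>(\<omega> in M. (\<forall>i\<in>{1..m}. s i \<le> real_of_int (Y t (\<kappa> i) \<omega>))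
                     \<bar> \<forall>k\<in>{1..N}. Y 0 k \<omega> = y k)
         = fredholm_det (cut_ker (chi m \<kappa> s) (K_ker \<Gamma>0 \<Gamma>q p q y t)) (\<kappa> ` {1..m} \<times> UNIV)"
proof -
  let ?P = "\<P>(\<omega> in M. (\<forall>i\<in>{1..m}. s i \<le> real_of_int (Y t (\<kappa> i) \<omega>)) \<bar> \<forall>k\<in>{1..N}. Y 0 k \<omega> = y k)"
  let ?A = "cut_ker (chi m \<kappa> s) (K_ker \<Gamma>0 \<Gamma>q p q y t)"
  let ?X = "\<kappa> ` {1..m} \<times> UNIV :: (nat \<times> int) set"
  obtain b where b: "0 \<le> b" "\<And>l x. b < x \<Longrightarrow> chi m \<kappa> s (l, x) = 0" "\<And>l x. norm (chi m \<kappa> s (l, x)) \<le> 1"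
    using chi_bound[of m \<kappa> s] by blast
  interpret cut_q_contour \<Gamma>q p q N t "chi m \<kappa> s" ?X b
  proof unfold_locales
    show "ccw_contour \<Gamma>q ((\<lambda>k. of_real (q k)) ` {1..N}) (insert 0 ((\<lambda>l. - inverse (of_real (p l))) ` {1..t}))"
      by (rule assms(11))
    show "?X \<subseteq> {1..N} \<times> UNIV" using assms(9) by blast
  qed (use assms(2,7) b in simp_all)
  interpret prob_space M using assms(5) by (simp add: dTASEP_def)
  have N: "0 < N" using assms(1) by simp
  have yy: "y j < y i" if "1 \<le> i" "i < j" "j \<le> N" for i j
    using assms(4) that by (auto simp: monotone_on_def)
  \<comment> \<open>Strictly below the last particle, so that all its later positions are above \<open>c\<close> as well.\<close>
  define c where "c = y N - 1"
  have ord: "ordered_above N c y"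
    unfolding ordered_above_def c_def
  proof (intro conjI ballI allI impI)
    show "y N - 1 < y i" if "i \<in> {1..N}" for i using that yy[of i N] by (cases "i = N") auto
  qed (use yy in auto)
  have cy: "c \<le> y i" if "i \<in> {1..N}" for i using ord that by (auto simp: ordered_above_def intro: less_imp_le)
  have pos: "0 < p l * q k" if "1 \<le> l" "k \<in> {1..N}" for l k using assms(2,3) that by simp
  note dt = assms(5) N pos
  have Keq: "?A u v = cut_ker (chi m \<kappa> s) (K_from y c 0) u v"
    if "u \<in> ?X" "v \<in> ?X" for u v
  proof -
    obtain l x n x' where uv: "u = (l, x)" "v = (n, x')" by (cases u, cases v)
    have "n \<le> N" using that uv assms(9) by auto
    then show ?thesis using K_ker_eq_K_from[OF assms(10) _ cy] by (simp add: cut_ker_def uv)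
  qed
  have conv: "fredholm_converges ?A ?X"
    using fredholm_cong(2)[of ?X ?A, OF Keq] tame_fredholm_converges[OF tame_K_from[of c y 0]] cy by simp
  have det0: "fredholm_det ?A ?X = step_det c y 0"
    using fredholm_cong(1)[of ?X ?A, OF Keq]
    unfolding step_det_def by (simp only: mod_0 div_0 if_True simp_thms)
  define \<Phi> where "\<Phi> z \<longleftrightarrow> (\<forall>i\<in>{1..m}. s i \<le> real_of_int (z (\<kappa> i)))" for z :: "nat \<Rightarrow> int"
  let ?n = "t * N"
  let ?wt = "\<lambda>i. jump_weight p q (Suc (i div N)) (Suc (i mod N))"
  have last: "step_det c (state N y w ?n) ?n = of_bool (\<Phi> (state N y w ?n))" if w: "w \<in> {..<?n} \<rightarrow>\<^sub>E {0, 1}" for w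
  proof -
    have "\<And>i. i < ?n \<Longrightarrow> 0 \<le> w i" using w by (force simp: PiE_iff)
    then have "ordered_above N c (state N y w ?n)" using ord N by (intro ordered_above_state)
    then have o: "\<And>i. i \<in> {1..N} \<Longrightarrow> c < state N y w ?n i"
      "\<And>i j. 1 \<le> i \<Longrightarrow> i < j \<Longrightarrow> j \<le> N \<Longrightarrow> state N y w ?n j < state N y w ?n i"
      by (simp_all add: ordered_above_def)
    have "?n mod N = 0" "?n div N = t" using N by simp_all
    then show ?thesis
      unfolding step_det_def \<Phi>_def
      using fredholm_det_final[OF assms(8,9), of c "state N y w ?n" s, OF o]
      by (simp only: if_True simp_thms)
  qed
  have event: "{\<omega> \<in> space M. \<forall>i\<in>{1..m}. s i \<le> real_of_int (Y t (\<kappa> i) \<omega>)} =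
      {\<omega> \<in> space M. \<Phi> (state N y (noise N W \<omega>) ?n)}"
  proof -
    have "\<kappa> i \<in> {1..N}" if "i \<in> {1..m}" for i using assms(9) that by blast
    then show ?thesis using state_noise[OF dt] by (auto simp: \<Phi>_def)
  qed
  have meas: "{\<omega> \<in> space M. \<Phi> (state N y (noise N W \<omega>) ?n)} \<in> sets M"
    unfolding \<Phi>_def
  proof (intro sets.sets_Collect_finite_All)
    fix i
    have Z: "{z. s i \<le> real_of_int z} \<in> sets (count_space UNIV)" by simp
    have "(\<lambda>\<omega>. state N y (noise N W \<omega>) ?n (\<kappa> i)) -` {z. s i \<le> real_of_int z} \<inter> space M \<in> sets M"
      by (rule measurable_sets[OF state_measurable[OF dt] Z])
    also have "(\<lambda>\<omega>. state N y (noise N W \<omega>) ?n (\<kappa> i)) -` {z. s i \<le> real_of_int z} \<inter> space M =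
        {\<omega> \<in> space M. s i \<le> real_of_int (state N y (noise N W \<omega>) ?n (\<kappa> i))}" by auto
    finally show "{\<omega> \<in> space M. s i \<le> real_of_int (state N y (noise N W \<omega>) ?n (\<kappa> i))} \<in> sets M" .
  qed simp
  have init: "\<omega> \<in> space M \<Longrightarrow> \<forall>k\<in>{1..N}. Y 0 k \<omega> = y k" for \<omega>
    using assms(5) by (simp add: dTASEP_def)
  have "{\<omega> \<in> space M. \<forall>k\<in>{1..N}. Y 0 k \<omega> = y k} = space M" using init by blast
  moreover have "{\<omega> \<in> space M. (\<forall>i\<in>{1..m}. s i \<le> real_of_int (Y t (\<kappa> i) \<omega>)) \<and> (\<forall>k\<in>{1..N}. Y 0 k \<omega> = y k)} =
      {\<omega> \<in> space M. \<forall>i\<in>{1..m}. s i \<le> real_of_int (Y t (\<kappa> i) \<omega>)}" using init by blast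
  ultimately have "?P =
      prob {\<omega> \<in> space M. \<Phi> (state N y (noise N W \<omega>) ?n)}"
    unfolding cond_prob_def event[symmetric] by (simp add: prob_space)
  also have "\<dots> = (\<Sum>w\<in>{..<?n} \<rightarrow>\<^sub>E {0, 1}. (\<Prod>i<?n. ?wt i (w i)) * of_bool (\<Phi> (state N y w ?n)))"
    by (rule prob_state[OF dt meas])
  finally have prob_eq: "?P =
      (\<Sum>w\<in>{..<?n} \<rightarrow>\<^sub>E {0, 1}. (\<Prod>i<?n. ?wt i (w i)) * of_bool (\<Phi> (state N y w ?n)))" .
  have "complex_of_real ?P =
      (\<Sum>w\<in>{..<?n} \<rightarrow>\<^sub>E {0, 1}. of_real (\<Prod>i<?n. ?wt i (w i)) * of_bool (\<Phi> (state N y w ?n)))"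
  proof -
    have "complex_of_real (of_bool P) = of_bool P" for P by (cases P) simp_all
    then show ?thesis unfolding prob_eq by (simp only: of_real_sum of_real_mult)
  qed
  also have "\<dots> = (\<Sum>w\<in>{..<?n} \<rightarrow>\<^sub>E {0, 1}. of_real (\<Prod>i<?n. ?wt i (w i)) * step_det c (state N y w ?n) ?n)"
    using last by (intro sum.cong) auto
  also have "\<dots> = step_det c y 0" by (rule step_det_expectation[OF ord _ N]) simp
  finally show ?thesis using conv det0 by simp
qed

end
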